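(* Let $F_n$ be a free group of finite rank $n$ and let $A < F_n$ be a proper, nontrivial free factor. Let $\mathsf{Stab}[A] < \mathsf{Out}(F_n)$ be the subgroup stabilizing the conjugacy class $[A]$ of $A$. (1) If $\mathrm{rank}(A) = n-1$ then $\mathsf{Stab}[A]$ is a Lipschitz retract of $\mathsf{Out}(F_n)$, and therefore is undistorted in $\mathsf{Out}(F_n)$. (2) If $\mathrm{rank}(A) \le n-2$ then $\mathsf{Stab}[A]$ is distorted in $\mathsf{Out}(F_n)$.
   Context: The action of $\mathsf{Aut}(F_n)$ on subgroups of $F_n$ induces an action of $\mathsf{Out}(F_n)=\mathsf{Aut}(F_n)/\mathsf{Inn}(F_n)$ on conjugacy classes of subgroups; $\mathsf{Stab}[A]=\{\phi\in\mathsf{Out}(F_n) : \phi[A]=[A]\}$, which is a finitely generated group. Finitely generated groups are equipped with the word metric of any finite generating set. For a finitely generated group $G$ and a finitely generated subgroup $H<G$: $H$ is a Lipschitz retract of $G$ if there is a function $\pi\colon G\to H$ (not necessarily a homomorphism) that restricts to the identity on $H$ and a constant $K\ge 1$ such that $d_H(\pi(a),\pi(b))\le K\,d_G(a,b)$ for all $a,b\in G$; $H$ is undistorted in $G$ if the inclusion $H\hookrightarrow G$ is a quasi-isometric embedding with respect to word metrics, and distorted otherwise. *)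

theory Defs
  imports Complex_Main "HOL-Algebra.Bij" "HOL-Algebra.Group_Action" "HOL-Algebra.Generated_Groups"
begin

section \<open>Words, word metrics and coarse geometry\<close>

text \<open>A letter \<open>(s, e)\<close> stands for \<open>s\<close> if \<open>e\<close> is true and for the inverse of \<open>s\<close> otherwise.\<close>

definition word_value :: "('a, 'b) monoid_scheme \<Rightarrow> ('a \<times> bool) list \<Rightarrow> 'a" where
  "word_value G w =
     foldr (\<lambda>(s, e) x. (if e then s else inv\<^bsub>G\<^esub> s) \<otimes>\<^bsub>G\<^esub> x) w \<one>\<^bsub>G\<^esub>"

definition words :: "'a set \<Rightarrow> ('a \<times> bool) list set" where
  "words S = lists (S \<times> UNIV)"

definition reduced_words :: "'a set \<Rightarrow> ('a \<times> bool) list set" where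
  "reduced_words S =
     {w \<in> words S. successively (\<lambda>x y. \<not> (fst x = fst y \<and> snd x \<noteq> snd y)) w}"

definition finite_generating_set :: "('a, 'b) monoid_scheme \<Rightarrow> 'a set \<Rightarrow> bool" where
  "finite_generating_set G S \<longleftrightarrow> finite S \<and> S \<subseteq> carrier G \<and> generate G S = carrier G"

text \<open>\<open>word_length G S g\<close> is meaningful only if \<open>S\<close> generates \<open>G\<close> and \<open>g\<close> lies in \<open>G\<close>;
  the word metric below is the left-invariant one.\<close>

definition word_length :: "('a, 'b) monoid_scheme \<Rightarrow> 'a set \<Rightarrow> 'a \<Rightarrow> nat" where
  "word_length G S g = (LEAST k. \<exists>w\<in>words S. length w = k \<and> word_value G w = g)"

definition word_dist :: "('a, 'b) monoid_scheme \<Rightarrow> 'a set \<Rightarrow> 'a \<Rightarrow> 'a \<Rightarrow> real" where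
  "word_dist G S a b = real (word_length G S (inv\<^bsub>G\<^esub> a \<otimes>\<^bsub>G\<^esub> b))"

definition quasi_isometric_embedding ::
    "'x set \<Rightarrow> ('x \<Rightarrow> 'x \<Rightarrow> real) \<Rightarrow> ('y \<Rightarrow> 'y \<Rightarrow> real) \<Rightarrow> ('x \<Rightarrow> 'y) \<Rightarrow> bool" where
  "quasi_isometric_embedding X dX dY f \<longleftrightarrow>
     (\<exists>K C. K \<ge> 1 \<and> C \<ge> 0 \<and>
        (\<forall>x\<in>X. \<forall>y\<in>X. dX x y / K - C \<le> dY (f x) (f y) \<and> dY (f x) (f y) \<le> K * dX x y + C))"

text \<open>In the next three definitions \<open>S\<close> and \<open>T\<close> are finite generating sets of the group \<open>G\<close> and of
  its subgroup \<open>H\<close>; they only serve to fix the word metrics.\<close>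

definition lipschitz_retract ::
    "('a, 'b) monoid_scheme \<Rightarrow> 'a set \<Rightarrow> 'a set \<Rightarrow> 'a set \<Rightarrow> bool" where
  "lipschitz_retract G S H T \<longleftrightarrow>
     (\<exists>\<pi> K. \<pi> \<in> carrier G \<rightarrow> H \<and> (\<forall>h\<in>H. \<pi> h = h) \<and> K \<ge> 1 \<and>
        (\<forall>a\<in>carrier G. \<forall>b\<in>carrier G.
           word_dist (G\<lparr>carrier := H\<rparr>) T (\<pi> a) (\<pi> b) \<le> K * word_dist G S a b))"

definition undistorted ::
    "('a, 'b) monoid_scheme \<Rightarrow> 'a set \<Rightarrow> 'a set \<Rightarrow> 'a set \<Rightarrow> bool" where
  "undistorted G S H T \<longleftrightarrow>
     quasi_isometric_embedding H (word_dist (G\<lparr>carrier := H\<rparr>) T) (word_dist G S) (\<lambda>h. h)"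

definition distorted ::
    "('a, 'b) monoid_scheme \<Rightarrow> 'a set \<Rightarrow> 'a set \<Rightarrow> 'a set \<Rightarrow> bool" where
  "distorted G S H T \<longleftrightarrow> \<not> undistorted G S H T"


section \<open>Free groups and free factors\<close>

text \<open>\<open>S\<close> is a free basis if every group element is the value of exactly one reduced word in \<open>S\<close>.\<close>

definition free_basis :: "('a, 'b) monoid_scheme \<Rightarrow> 'a set \<Rightarrow> bool" where
  "free_basis G S \<longleftrightarrow>
     S \<subseteq> carrier G \<and> bij_betw (word_value G) (reduced_words S) (carrier G)"

definition free_group_of_rank :: "('a, 'b) monoid_scheme \<Rightarrow> nat \<Rightarrow> bool" where
  "free_group_of_rank G n \<longleftrightarrow>
     group G \<and> (\<exists>S. free_basis G S \<and> finite S \<and> card S = n)"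

text \<open>Alternating words in two subgroups; the Boolean tag of a syllable records which of the two
  it is taken from. \<open>G\<close> is the internal free product of \<open>A\<close> and \<open>B\<close> if every element of \<open>G\<close> has
  exactly one such normal form.\<close>

definition alternating_words ::
    "('a, 'b) monoid_scheme \<Rightarrow> 'a set \<Rightarrow> 'a set \<Rightarrow> (bool \<times> 'a) list set" where
  "alternating_words G A B =
     {w \<in> lists ({True} \<times> (A - {\<one>\<^bsub>G\<^esub>}) \<union> {False} \<times> (B - {\<one>\<^bsub>G\<^esub>})).
        successively (\<lambda>x y. fst x \<noteq> fst y) w}"

definition internal_free_product ::
    "('a, 'b) monoid_scheme \<Rightarrow> 'a set \<Rightarrow> 'a set \<Rightarrow> bool" where
  "internal_free_product G A B \<longleftrightarrow>
     subgroup A G \<and> subgroup B G \<and>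
     bij_betw (\<lambda>w. foldr (\<otimes>\<^bsub>G\<^esub>) (map snd w) \<one>\<^bsub>G\<^esub>) (alternating_words G A B) (carrier G)"

definition free_factor :: "('a, 'b) monoid_scheme \<Rightarrow> 'a set \<Rightarrow> bool" where
  "free_factor G A \<longleftrightarrow> (\<exists>B. internal_free_product G A B)"


section \<open>Outer automorphisms and stabilizers of conjugacy classes of subgroups\<close>

definition Inn :: "('a, 'b) monoid_scheme \<Rightarrow> ('a \<Rightarrow> 'a) set" where
  "Inn G = {\<lambda>x\<in>carrier G. g \<otimes>\<^bsub>G\<^esub> x \<otimes>\<^bsub>G\<^esub> inv\<^bsub>G\<^esub> g | g. g \<in> carrier G}"

definition Out :: "('a, 'b) monoid_scheme \<Rightarrow> ('a \<Rightarrow> 'a) set monoid" where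
  "Out G = AutoGroup G Mod Inn G"

definition conj_class :: "('a, 'b) monoid_scheme \<Rightarrow> 'a set \<Rightarrow> 'a set set" where
  "conj_class G A = {g <#\<^bsub>G\<^esub> A #>\<^bsub>G\<^esub> inv\<^bsub>G\<^esub> g | g. g \<in> carrier G}"

text \<open>An outer automorphism is a coset of automorphisms, so it acts on a conjugacy class by
  applying all its representatives to all members of the class; \<open>out_action_coset\<close> below shows
  that this is the usual induced action.\<close>

definition out_action :: "('a \<Rightarrow> 'a) set \<Rightarrow> 'a set set \<Rightarrow> 'a set set" where
  "out_action \<phi> C = {f ` B | f B. f \<in> \<phi> \<and> B \<in> C}"

definition Stab :: "('a, 'b) monoid_scheme \<Rightarrow> 'a set \<Rightarrow> ('a \<Rightarrow> 'a) set set" where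
  "Stab G A = stabilizer (Out G) out_action (conj_class G A)"

lemma conjugate_set_eq:
  "g <#\<^bsub>G\<^esub> A #>\<^bsub>G\<^esub> h = (\<lambda>x. g \<otimes>\<^bsub>G\<^esub> x \<otimes>\<^bsub>G\<^esub> h) ` A"
  by (auto simp: l_coset_def r_coset_def)

lemma conj_class_eq:
  "conj_class G A = {(\<lambda>x. g \<otimes>\<^bsub>G\<^esub> x \<otimes>\<^bsub>G\<^esub> inv\<^bsub>G\<^esub> g) ` A | g. g \<in> carrier G}"
  by (simp add: conj_class_def conjugate_set_eq)

lemma AutoGroup_simps:
  "carrier (AutoGroup G) = auto G"
  "f \<in> auto G \<Longrightarrow> h \<in> auto G \<Longrightarrow> f \<otimes>\<^bsub>AutoGroup G\<^esub> h = compose (carrier G) f h"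
  "\<one>\<^bsub>AutoGroup G\<^esub> = (\<lambda>x\<in>carrier G. x)"
  by (auto simp: AutoGroup_def BijGroup_def auto_def)

context group
begin

lemma inv_cancel:
  "g \<in> carrier G \<Longrightarrow> x \<in> carrier G \<Longrightarrow> inv g \<otimes> (g \<otimes> x) = x"
  "g \<in> carrier G \<Longrightarrow> x \<in> carrier G \<Longrightarrow> g \<otimes> (inv g \<otimes> x) = x"
  by (metis inv_closed l_inv l_one m_assoc) (metis inv_closed r_inv l_one m_assoc)

lemma auto_hom: "f \<in> auto G \<Longrightarrow> f \<in> hom G G"
  by (simp add: auto_def)

lemma auto_surj: "f \<in> auto G \<Longrightarrow> f ` carrier G = carrier G"
  by (simp add: auto_def Bij_def bij_betw_def)

lemma auto_closed: "f \<in> auto G \<Longrightarrow> x \<in> carrier G \<Longrightarrow> f x \<in> carrier G"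
  by (rule hom_in_carrier[OF auto_hom])

lemma auto_mult:
  "f \<in> auto G \<Longrightarrow> x \<in> carrier G \<Longrightarrow> y \<in> carrier G \<Longrightarrow> f (x \<otimes> y) = f x \<otimes> f y"
  by (rule hom_mult[OF auto_hom])

lemma auto_inv:
  assumes "f \<in> auto G" "x \<in> carrier G"
  shows "f (inv x) = inv f x"
proof -
  interpret group_hom G G f
    by unfold_locales (rule auto_hom[OF assms(1)])
  show ?thesis
    by (rule hom_inv[OF assms(2)])
qed

lemma inner_auto:
  assumes g: "g \<in> carrier G"
  shows "(\<lambda>x\<in>carrier G. g \<otimes> x \<otimes> inv g) \<in> auto G"
proof -
  have 1: "bij_betw (\<lambda>x\<in>carrier G. g \<otimes> x \<otimes> inv g) (carrier G) (carrier G)"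
    by (rule bij_betw_byWitness[where f' = "\<lambda>x. inv g \<otimes> x \<otimes> g"])
       (use g in \<open>auto simp: m_assoc inv_cancel\<close>)
  have 2: "(\<lambda>x\<in>carrier G. g \<otimes> x \<otimes> inv g) \<in> hom G G"
    using g by (auto simp: hom_def m_assoc inv_cancel)
  show ?thesis
    using 1 2 by (simp add: auto_def Bij_def)
qed

lemma Inn_subset_auto: "Inn G \<subseteq> auto G"
  by (auto simp: Inn_def inner_auto)

lemma subgroup_Inn: "subgroup (Inn G) (AutoGroup G)"
proof (rule group.subgroupI[OF AutoGroup])
  show "Inn G \<subseteq> carrier (AutoGroup G)"
    by (simp add: AutoGroup_simps Inn_subset_auto)
  show "Inn G \<noteq> {}"
    by (auto simp: Inn_def)
  have mult: "(\<lambda>x\<in>carrier G. g \<otimes> x \<otimes> inv g) \<otimes>\<^bsub>AutoGroup G\<^esub> (\<lambda>x\<in>carrier G. h \<otimes> x \<otimes> inv h)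
      = (\<lambda>x\<in>carrier G. (g \<otimes> h) \<otimes> x \<otimes> inv (g \<otimes> h))"
    if "g \<in> carrier G" "h \<in> carrier G" for g h
    using that by (auto simp: AutoGroup_simps inner_auto compose_def m_assoc inv_mult_group)
  show "a \<otimes>\<^bsub>AutoGroup G\<^esub> b \<in> Inn G" if ab: "a \<in> Inn G" "b \<in> Inn G" for a b
  proof -
    obtain g h where gh: "g \<in> carrier G" "h \<in> carrier G"
      and ab: "a = (\<lambda>x\<in>carrier G. g \<otimes> x \<otimes> inv g)" "b = (\<lambda>x\<in>carrier G. h \<otimes> x \<otimes> inv h)"
      using ab by (auto simp: Inn_def)
    have "g \<otimes> h \<in> carrier G"
      using gh by simp
    then show ?thesis
      unfolding ab mult[OF gh] Inn_def by blast
  qed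
  show "inv\<^bsub>AutoGroup G\<^esub> a \<in> Inn G" if a: "a \<in> Inn G" for a
  proof -
    obtain g where g: "g \<in> carrier G" and a: "a = (\<lambda>x\<in>carrier G. g \<otimes> x \<otimes> inv g)"
      using a by (auto simp: Inn_def)
    have ig: "inv g \<in> carrier G"
      using g by simp
    have "inv\<^bsub>AutoGroup G\<^esub> a = (\<lambda>x\<in>carrier G. inv g \<otimes> x \<otimes> inv (inv g))"
    proof (rule group.inv_equality[OF AutoGroup])
      show "(\<lambda>x\<in>carrier G. inv g \<otimes> x \<otimes> inv (inv g)) \<otimes>\<^bsub>AutoGroup G\<^esub> a = \<one>\<^bsub>AutoGroup G\<^esub>"
        unfolding a mult[OF ig g] using g by (auto simp: AutoGroup_simps)
    qed (use g ig a in \<open>simp_all only: AutoGroup_simps inner_auto\<close>)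
    then show ?thesis
      using ig by (auto simp: Inn_def)
  qed
qed

lemma auto_comp_inner:
  assumes "f \<in> auto G" "g \<in> carrier G"
  shows "f \<otimes>\<^bsub>AutoGroup G\<^esub> (\<lambda>x\<in>carrier G. g \<otimes> x \<otimes> inv g)
       = (\<lambda>x\<in>carrier G. f g \<otimes> x \<otimes> inv f g) \<otimes>\<^bsub>AutoGroup G\<^esub> f"
  using assms
  by (auto simp: AutoGroup_simps inner_auto compose_def
      auto_closed[OF assms(1)] auto_mult[OF assms(1)] auto_inv[OF assms(1)])

lemma normal_Inn: "Inn G \<lhd> AutoGroup G"
proof (rule group.normal_invI[OF AutoGroup subgroup_Inn])
  fix f h assume f: "f \<in> carrier (AutoGroup G)" and h: "h \<in> Inn G"
  interpret Aut: group "AutoGroup G" by (rule AutoGroup)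
  obtain g where g: "g \<in> carrier G" and hg: "h = (\<lambda>x\<in>carrier G. g \<otimes> x \<otimes> inv g)"
    using h by (auto simp: Inn_def)
  define k where "k = (\<lambda>x\<in>carrier G. f g \<otimes> x \<otimes> inv f g)"
  have fg: "f g \<in> carrier G"
    using f g by (simp add: AutoGroup_simps auto_closed)
  then have k: "k \<in> Inn G"
    unfolding k_def Inn_def by blast
  have kc: "k \<in> carrier (AutoGroup G)"
    using k Inn_subset_auto by (auto simp: AutoGroup_simps)
  have "f \<otimes>\<^bsub>AutoGroup G\<^esub> h = k \<otimes>\<^bsub>AutoGroup G\<^esub> f"
    unfolding hg k_def by (rule auto_comp_inner) (use f g in \<open>simp_all add: AutoGroup_simps\<close>)
  then have "f \<otimes>\<^bsub>AutoGroup G\<^esub> h \<otimes>\<^bsub>AutoGroup G\<^esub> inv\<^bsub>AutoGroup G\<^esub> f = k"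
    using f kc by (simp add: Aut.m_assoc)
  then show "f \<otimes>\<^bsub>AutoGroup G\<^esub> h \<otimes>\<^bsub>AutoGroup G\<^esub> inv\<^bsub>AutoGroup G\<^esub> f \<in> Inn G"
    using k by simp
qed

theorem group_Out: "group (Out G)"
  unfolding Out_def by (rule normal.factorgroup_is_group[OF normal_Inn])

theorem out_action_coset:
  assumes f: "f \<in> auto G" and A: "A \<subseteq> carrier G"
  shows "out_action (Inn G #>\<^bsub>AutoGroup G\<^esub> f) (conj_class G A) = conj_class G (f ` A)"
proof
  have eq: "((\<lambda>x\<in>carrier G. g \<otimes> x \<otimes> inv g) \<otimes>\<^bsub>AutoGroup G\<^esub> f) ` ((\<lambda>x. h \<otimes> x \<otimes> inv h) ` A)
      = (\<lambda>x. (g \<otimes> f h) \<otimes> x \<otimes> inv (g \<otimes> f h)) ` (f ` A)"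
    if "g \<in> carrier G" "h \<in> carrier G" for g h
    unfolding image_image
    by (rule image_cong)
       (use that f A in \<open>auto simp: AutoGroup_simps inner_auto compose_def auto_mult[OF f]
          auto_inv[OF f] auto_closed[OF f] m_assoc inv_mult_group subset_iff\<close>)
  show "out_action (Inn G #>\<^bsub>AutoGroup G\<^esub> f) (conj_class G A) \<subseteq> conj_class G (f ` A)"
  proof
    fix X assume "X \<in> out_action (Inn G #>\<^bsub>AutoGroup G\<^esub> f) (conj_class G A)"
    then obtain g h where gh: "g \<in> carrier G" "h \<in> carrier G"
      and X: "X = ((\<lambda>x\<in>carrier G. g \<otimes> x \<otimes> inv g) \<otimes>\<^bsub>AutoGroup G\<^esub> f) ` ((\<lambda>x. h \<otimes> x \<otimes> inv h) ` A)"
      by (auto simp: out_action_def conj_class_eq Inn_def r_coset_def)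
    have "g \<otimes> f h \<in> carrier G"
      using gh f by (simp add: auto_closed)
    then show "X \<in> conj_class G (f ` A)"
      unfolding X eq[OF gh] conj_class_eq by blast
  qed
  show "conj_class G (f ` A) \<subseteq> out_action (Inn G #>\<^bsub>AutoGroup G\<^esub> f) (conj_class G A)"
  proof
    fix X assume "X \<in> conj_class G (f ` A)"
    then obtain g where g: "g \<in> carrier G" and X: "X = (\<lambda>x. g \<otimes> x \<otimes> inv g) ` (f ` A)"
      by (auto simp: conj_class_eq)
    obtain h where h: "h \<in> carrier G" "g = f h"
      using auto_surj[OF f] g by blast
    have "X = ((\<lambda>x\<in>carrier G. \<one> \<otimes> x \<otimes> inv \<one>) \<otimes>\<^bsub>AutoGroup G\<^esub> f) ` ((\<lambda>x. h \<otimes> x \<otimes> inv h) ` A)"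
      unfolding eq[OF one_closed h(1)] X using g h by simp
    moreover have "(\<lambda>x\<in>carrier G. \<one> \<otimes> x \<otimes> inv \<one>) \<in> Inn G"
      unfolding Inn_def by blast
    moreover have "(\<lambda>x. h \<otimes> x \<otimes> inv h) ` A \<in> conj_class G A"
      unfolding conj_class_eq using h by blast
    ultimately show "X \<in> out_action (Inn G #>\<^bsub>AutoGroup G\<^esub> f) (conj_class G A)"
      unfolding out_action_def r_coset_def by blast
  qed
qed

end

end

theory Submission
  imports Defs "HOL-Library.Transitive_Closure_Table" "HOL-Number_Theory.Fib"
begin

text \<open>For a subgroup \<open>A\<close> of finite rank \<open>r\<close> and a basis \<open>X\<close> of \<open>F\<close>, a maximal tree of the graph
  \<open>Cayley(F, X) / A\<close> is the same as an \<open>A\<close>-equivariant map \<open>c\<close> from \<open>F\<close> to \<open>A\<close> with connected fibers.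
  Exactly \<open>r\<close> orbits of edges join different fibers; they form a basis \<open>Y\<close> of \<open>A\<close> (Nielsen--Schreier).
  If \<open>c'\<close> belongs to a second basis \<open>X'\<close> of words of bounded length in \<open>X\<close>, then \<open>c' g \<otimes> inv (c g)\<close>
  varies with \<open>g\<close> by a bounded amount in the word metric of \<open>Y\<close>: an \<open>X'\<close>-path without repetitions in a
  fiber of \<open>c'\<close> visits no coset of \<open>A\<close> twice, so only boundedly many of its steps come close to one of
  the \<open>r\<close> orbits of edges along which \<open>c\<close> changes.

  In corank one, \<open>F\<close> is the free product of \<open>A\<close> and \<open>\<langle>t\<rangle>\<close>. Normalize \<open>c\<close> to be trivial at the end
  \<open>a\<^sup>\<infinity> t\<close> and let \<open>b\<close> be its value at the end \<open>a\<^sup>\<infinity> t\<^sup>-\<^sup>1\<close>. The automorphism that sends the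
  basis of \<open>A\<close> to \<open>Y\<close> and \<open>t\<close> to \<open>b t\<close> changes by a bounded amount when \<open>X\<close> does, and it is close to any
  automorphism that preserves \<open>A\<close> and takes the given basis to \<open>X\<close>; this is the Lipschitz retraction.

  In corank at least two, \<open>F\<close> is the free product of \<open>A\<close> and \<open>B\<close>, where \<open>B\<close> has two basis elements
  \<open>z\<close> and \<open>t\<close>, and \<open>Stab[A]\<close> acts on \<open>F / \<langle>\<langle>A\<rangle>\<rangle> = B\<close>. The same construction for the cyclic
  subgroup \<open>\<langle>z\<rangle>\<close> of \<open>B\<close> shows that the twists \<open>t \<mapsto> z\<^sup>N t\<close> have length at least
  linear in \<open>N\<close> in \<open>Out(B)\<close>. But the twists \<open>t \<mapsto> u t\<close> of \<open>F\<close> with \<open>u\<close> in \<open>\<langle>a, z\<rangle>\<close> are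
  conjugate in \<open>Out(F)\<close> under automorphisms of \<open>\<langle>a, z\<rangle>\<close> that do not preserve \<open>A\<close>, so that exponents
  \<open>N\<close> that grow exponentially with the length in \<open>Out(F)\<close> occur.\<close>

section \<open>Words and free bases\<close>

text \<open>Trees are never formed: every geometric statement is about values of an equivariant map
  \<open>c\<close> on the group, and bases are recognized by their universal property. For fixed
  ranks the comparison bounds depend only on the length \<open>k\<close> and not on the basis, and
  this is what makes the retraction Lipschitz.

  A base vertex would be moved when the basis is conjugated, so \<open>c\<close> is normalized at an
  end: left multiplication by a fixed element displaces all points of a ray by a bounded distance
  and does not change the limit. In this way the construction descends to outer automorphisms. The
  first end removes the freedom of a left factor from \<open>A\<close>; the second one sees the
  twisting of \<open>t\<close>, which a basis of \<open>A\<close> alone cannot record.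

  Two kinds of slack remain. The choices are unique only up to bounded error, so the retraction
  starts as a relation. Moreover it is the identity on the stabilizer only up to finitely many
  errors: there \<open>t\<close> goes to a product of an element of \<open>A\<close>, a power of
  \<open>t\<close> with exponent 1 or -1, and another element of \<open>A\<close>. These outer
  factors are unbounded, and the point is that they cancel.\<close>

definition letter_value :: "('a, 'b) monoid_scheme \<Rightarrow> 'a \<times> bool \<Rightarrow> 'a" where
  "letter_value G s = (if snd s then fst s else inv\<^bsub>G\<^esub> (fst s))"

definition inv_letter :: "'a \<times> bool \<Rightarrow> 'a \<times> bool" where
  "inv_letter s = (fst s, \<not> snd s)"

definition inv_word :: "('a \<times> bool) list \<Rightarrow> ('a \<times> bool) list" where
  "inv_word w = rev (map inv_letter w)"

text \<open>Left multiplication by a letter, seen on reduced words. These maps are permutations (van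
  der Waerden's trick); they supply the action of the group on its own normal forms in
  \<open>free_basisI\<close>.\<close>

fun push :: "'a \<times> bool \<Rightarrow> ('a \<times> bool) list \<Rightarrow> ('a \<times> bool) list" where
  "push s [] = [s]"
| "push s (s' # w) = (if s' = inv_letter s then w else s # s' # w)"

lemma inv_letter_simps [simp]:
  "inv_letter (inv_letter s) = s" "fst (inv_letter s) = fst s" "inv_letter s \<noteq> s" "s \<noteq> inv_letter s"
  "inv_letter (x, e) = (x, \<not> e)"
  by (auto simp: inv_letter_def prod_eq_iff)

lemma not_inverse_letters:
  "(\<lambda>x y. \<not> (fst x = fst y \<and> snd x \<noteq> snd y)) = (\<lambda>x y. y \<noteq> inv_letter x)"
  by (auto simp: inv_letter_def prod_eq_iff fun_eq_iff)

lemma words_Cons [simp]: "s # w \<in> words X \<longleftrightarrow> fst s \<in> X \<and> w \<in> words X"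
  by (cases s) (auto simp: words_def)

lemma words_Nil [simp]: "[] \<in> words X"
  by (simp add: words_def)

lemma words_append [simp]: "v @ w \<in> words X \<longleftrightarrow> v \<in> words X \<and> w \<in> words X"
  by (auto simp: words_def)

lemma words_iff: "w \<in> words X \<longleftrightarrow> fst ` set w \<subseteq> X"
  by (induction w) auto

lemma inv_word_words [simp]: "inv_word w \<in> words X \<longleftrightarrow> w \<in> words X"
  by (simp add: words_iff inv_word_def image_image)

lemma inv_word_simps [simp]:
  "inv_word [] = []" "inv_word (v @ w) = inv_word w @ inv_word v" "length (inv_word w) = length w"
  "inv_word (s # w) = inv_word w @ [inv_letter s]" "inv_word (inv_word w) = w"
  "inv_word w = [] \<longleftrightarrow> w = []"
  by (auto simp: inv_word_def rev_map comp_def)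

lemma reduced_words_iff:
  "w \<in> reduced_words X \<longleftrightarrow> w \<in> words X \<and> successively (\<lambda>x y. y \<noteq> inv_letter x) w"
  unfolding reduced_words_def not_inverse_letters by simp

lemma reduced_words_Nil [simp]: "[] \<in> reduced_words X"
  by (simp add: reduced_words_iff)

lemma reduced_words_Cons:
  "s # w \<in> reduced_words X \<longleftrightarrow> fst s \<in> X \<and> w \<in> reduced_words X \<and> (w \<noteq> [] \<longrightarrow> hd w \<noteq> inv_letter s)"
  by (cases w) (auto simp: reduced_words_iff)

lemma reduced_words_append:
  "v @ w \<in> reduced_words X \<longleftrightarrow> v \<in> reduced_words X \<and> w \<in> reduced_words X \<and>
     (v \<noteq> [] \<longrightarrow> w \<noteq> [] \<longrightarrow> hd w \<noteq> inv_letter (last v))"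
  by (auto simp: reduced_words_iff successively_append_iff)

lemma reduced_words_subset: "reduced_words X \<subseteq> words X"
  by (auto simp: reduced_words_iff)

lemma reduced_words_mono: "X \<subseteq> Y \<Longrightarrow> reduced_words X \<subseteq> reduced_words Y"
  by (force simp: reduced_words_iff words_iff)

lemma inv_word_reduced [simp]: "inv_word w \<in> reduced_words X \<longleftrightarrow> w \<in> reduced_words X"
proof -
  have "inv_word w \<in> reduced_words X" if "w \<in> reduced_words X" for w
    using that
  proof (induction w)
    case (Cons s w)
    have "w \<noteq> [] \<Longrightarrow> last (inv_word w) = inv_letter (hd w)"
      by (cases w) auto
    then show ?case
      using Cons by (auto simp: reduced_words_append reduced_words_Cons)
  qed simp
  from this[of w] this[of "inv_word w"] show ?thesis
    by auto
qed

lemma push_reduced: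
  "w \<in> reduced_words X \<Longrightarrow> fst s \<in> X \<Longrightarrow> push s w \<in> reduced_words X"
  by (cases w) (auto simp: reduced_words_Cons)

lemma push_eq_Cons: "s # w \<in> reduced_words X \<Longrightarrow> push s w = s # w"
  by (cases w) (auto simp: reduced_words_Cons)

lemma push_inverse: "w \<in> reduced_words X \<Longrightarrow> push (inv_letter s) (push s w) = w"
proof (cases w)
  case (Cons s' v)
  assume "w \<in> reduced_words X"
  then show ?thesis
    using Cons by (cases v) (auto simp: reduced_words_Cons)
qed simp

lemma word_value_Nil [simp]: "word_value G [] = \<one>\<^bsub>G\<^esub>"
  by (simp add: word_value_def)

lemma word_value_Cons [simp]: "word_value G (s # w) = letter_value G s \<otimes>\<^bsub>G\<^esub> word_value G w"
  by (cases s) (simp add: word_value_def letter_value_def)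

context group
begin

lemma letter_closed: "X \<subseteq> carrier G \<Longrightarrow> fst s \<in> X \<Longrightarrow> letter_value G s \<in> carrier G"
  by (auto simp: letter_value_def)

lemma letter_inverse: "fst s \<in> carrier G \<Longrightarrow> letter_value G (inv_letter s) = inv (letter_value G s)"
  by (auto simp: letter_value_def inv_letter_def)

lemma word_value_closed: "X \<subseteq> carrier G \<Longrightarrow> w \<in> words X \<Longrightarrow> word_value G w \<in> carrier G"
  by (induction w) (auto intro: letter_closed)

lemma word_value_append:
  "X \<subseteq> carrier G \<Longrightarrow> v \<in> words X \<Longrightarrow> w \<in> words X \<Longrightarrow>
    word_value G (v @ w) = word_value G v \<otimes> word_value G w"
  by (induction v) (auto simp: word_value_closed letter_closed m_assoc)

lemma word_value_inverse:
  assumes "X \<subseteq> carrier G" "w \<in> words X"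
  shows "word_value G (inv_word w) = inv (word_value G w)"
  using assms(2)
proof (induction w)
  case (Cons s w)
  then have "word_value G (inv_word w @ [inv_letter s]) = inv (word_value G w) \<otimes> inv (letter_value G s)"
    using assms(1)
    by (subst word_value_append[of X]) (auto simp: letter_inverse letter_closed subset_iff)
  then show ?case
    using Cons assms(1) by (auto simp: inv_mult_group word_value_closed letter_closed)
qed simp

lemma letter_push:
  assumes "X \<subseteq> carrier G" "fst s \<in> X" "w \<in> words X"
  shows "word_value G (push s w) = letter_value G s \<otimes> word_value G w"
proof (cases w)
  case (Cons s' v)
  have *: "fst s \<in> carrier G" "letter_value G s \<in> carrier G"
    using assms by (auto intro: letter_closed)
  show ?thesis
    using Cons assms * by (auto simp: letter_inverse word_value_closed inv_cancel)
qed (use assms in \<open>simp add: letter_closed\<close>)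

lemma generate_eq_words:
  assumes "X \<subseteq> carrier G"
  shows "generate G X = word_value G ` words X"
proof
  show "word_value G ` words X \<subseteq> generate G X"
  proof (intro image_subsetI)
    fix w assume "w \<in> words X"
    then show "word_value G w \<in> generate G X"
    proof (induction w)
      case (Cons s w)
      then show ?case
        by (cases "snd s") (auto simp: letter_value_def intro: generate.intros)
    qed (auto intro: generate.one)
  qed
  show "generate G X \<subseteq> word_value G ` words X"
  proof
    fix g assume "g \<in> generate G X"
    then show "g \<in> word_value G ` words X"
    proof (induction g rule: generate.induct)
      case one
      show ?case by (rule image_eqI[of _ _ "[]"]) auto
    next
      case (incl h)
      then show ?case using assms
        by (intro image_eqI[of _ _ "[(h, True)]"]) (auto simp: letter_value_def)
    next
      case (inv h)
      then show ?case using assms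
        by (intro image_eqI[of _ _ "[(h, False)]"]) (auto simp: letter_value_def)
    next
      case (eng h1 h2)
      then obtain v w where "v \<in> words X" "w \<in> words X" "h1 = word_value G v" "h2 = word_value G w"
        by auto
      then show ?case
        using word_value_append[OF assms, of v w] by (intro image_eqI[of _ _ "v @ w"]) auto
    qed
  qed
qed

lemma reduce_word:
  assumes "X \<subseteq> carrier G" "w \<in> words X"
  shows "\<exists>v\<in>reduced_words X. word_value G v = word_value G w"
  using assms(2)
proof (induction w)
  case (Cons s w)
  then obtain v where "v \<in> reduced_words X" "word_value G v = word_value G w"
    by auto
  then show ?case
    using Cons.prems push_reduced[of v X s] letter_push[OF assms(1), of s v] reduced_words_subset[of X]
    by (intro bexI[of _ "push s v"]) auto
qed (auto intro: bexI[of _ "[]"])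

lemma generate_eq_reduced_words:
  "X \<subseteq> carrier G \<Longrightarrow> generate G X = word_value G ` reduced_words X"
proof -
  assume X: "X \<subseteq> carrier G"
  have "word_value G ` words X \<subseteq> word_value G ` reduced_words X"
  proof (intro image_subsetI)
    fix w assume "w \<in> words X"
    then obtain v where "v \<in> reduced_words X" "word_value G v = word_value G w"
      using reduce_word[OF X] by blast
    then show "word_value G w \<in> word_value G ` reduced_words X"
      by (metis imageI)
  qed
  then show ?thesis
    using generate_eq_words[OF X] image_mono[OF reduced_words_subset] by (metis subset_antisym)
qed

lemma free_basis_generate: "free_basis G X \<Longrightarrow> generate G X = carrier G"
  by (auto simp: free_basis_def generate_eq_reduced_words bij_betw_def)

lemma free_basisD:
  assumes "free_basis G X"
  shows "X \<subseteq> carrier G" "inj_on (word_value G) (reduced_words X)" "word_value G ` reduced_words X = carrier G"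
  using assms by (auto simp: free_basis_def bij_betw_def)

lemma hom_word_value:
  assumes "X \<subseteq> carrier G" "\<phi> \<in> hom G H" "group H" "w \<in> words X"
  shows "\<phi> (word_value G w) = word_value H (map (apfst \<phi>) w)"
proof -
  interpret h: group_hom G H \<phi>
    using assms is_group by (simp add: group_hom_def group_hom_axioms_def)
  show ?thesis
    using assms(4)
  proof (induction w)
    case (Cons s w)
    moreover have "\<phi> (letter_value G s) = letter_value H (apfst \<phi> s)"
      using Cons assms(1) by (cases s) (auto simp: letter_value_def subset_iff)
    ultimately show ?case
      using assms(1) by (simp add: letter_closed word_value_closed)
  qed simp
qed

lemma hom_eqI:
  assumes X: "X \<subseteq> carrier G" and gen: "g \<in> generate G X"
    and hom: "\<phi> \<in> hom G H" "\<psi> \<in> hom G H" "group H"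
    and eq: "\<And>x. x \<in> X \<Longrightarrow> \<phi> x = \<psi> x"
  shows "\<phi> g = \<psi> g"
proof -
  obtain w where w: "w \<in> words X" "g = word_value G w"
    using gen generate_eq_words[OF X] by auto
  have "map (apfst \<phi>) w = map (apfst \<psi>) w"
    using w(1) eq by (auto simp: words_iff subset_iff prod_eq_iff)
  then have "word_value H (map (apfst \<phi>) w) = word_value H (map (apfst \<psi>) w)"
    by (rule arg_cong)
  then show ?thesis
    using w hom_word_value[OF X hom(1,3) w(1)] hom_word_value[OF X hom(2,3) w(1)] by simp
qed

text \<open>Evaluate the normal form in \<open>H\<close>. Multiplicativity has to be checked only
  for one letter on the left, where the normal form changes by \<open>push\<close>, that is, by at
  most one cancellation.\<close>

theorem free_basis_extend:
  fixes H :: "('c, 'd) monoid_scheme"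
  assumes basis: "free_basis G X" and H: "group H" and f: "f \<in> X \<rightarrow> carrier H"
  shows "\<exists>\<phi>\<in>hom G H. \<forall>x\<in>X. \<phi> x = f x"
proof -
  interpret H: group H by (rule H)
  note X = free_basisD[OF basis]
  define nf where "nf = the_inv_into (reduced_words X) (word_value G)"
  have nf: "nf g \<in> reduced_words X" "word_value G (nf g) = g" if "g \<in> carrier G" for g
    using that X by (auto simp: nf_def the_inv_into_into f_the_inv_into_f)
  have nf_eq: "nf g = w" if "w \<in> reduced_words X" "word_value G w = g" for g w
    using that X by (auto simp: nf_def the_inv_into_f_f)
  define ev where "ev w = word_value H (map (apfst f) w)" for w
  have fX: "f ` X \<subseteq> carrier H" using f by auto
  have mapw: "map (apfst f) w \<in> words (f ` X)" if "w \<in> words X" for w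
    using that by (auto simp: words_iff)
  have ev_closed: "ev w \<in> carrier H" if "w \<in> words X" for w
    unfolding ev_def by (rule H.word_value_closed[OF fX mapw[OF that]])
  have map_push: "ev (push s w) = letter_value H (apfst f s) \<otimes>\<^bsub>H\<^esub> ev w"
    if "fst s \<in> X" "w \<in> words X" for s w
  proof (cases "w \<noteq> [] \<and> hd w = inv_letter s")
    case True
    then obtain v where w: "w = inv_letter s # v" by (cases w) auto
    have s: "letter_value H (apfst f s) \<in> carrier H"
      using H.letter_closed[OF fX, of "apfst f s"] that by auto
    have i: "letter_value H (apfst f (inv_letter s)) = inv\<^bsub>H\<^esub> letter_value H (apfst f s)"
      using H.letter_inverse[of "apfst f s"] that fX by (auto simp: inv_letter_def apfst_def map_prod_def split_beta)
    show ?thesis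
      using w that s i ev_closed[of v] by (auto simp: H.inv_cancel ev_def)
  next
    case False
    then show ?thesis
      by (cases w) (auto simp: ev_def)
  qed
  define \<phi> where "\<phi> g = ev (nf g)" for g
  have step: "\<phi> (letter_value G s \<otimes> g) = letter_value H (apfst f s) \<otimes>\<^bsub>H\<^esub> \<phi> g"
    if "fst s \<in> X" "g \<in> carrier G" for s g
  proof -
    have "nf (letter_value G s \<otimes> g) = push s (nf g)"
      using nf[OF that(2)] that X(1) reduced_words_subset[of X]
      by (intro nf_eq push_reduced) (auto simp: letter_push)
    then show ?thesis
      using map_push[OF that(1), of "nf g"] nf[OF that(2)] reduced_words_subset[of X] by (auto simp: \<phi>_def)
  qed
  have mult: "\<phi> (word_value G w \<otimes> g) = ev w \<otimes>\<^bsub>H\<^esub> \<phi> g" if "w \<in> words X" "g \<in> carrier G" for w g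
    using that(1)
  proof (induction w)
    case Nil
    then show ?case using that(2) nf(1)[OF that(2)] reduced_words_subset[of X]
      by (auto simp: \<phi>_def ev_def ev_closed[unfolded ev_def])
  next
    case (Cons s w)
    have "\<phi> (word_value G (s # w) \<otimes> g) = \<phi> (letter_value G s \<otimes> (word_value G w \<otimes> g))"
      using Cons that(2) X(1) by (simp add: m_assoc letter_closed word_value_closed)
    also have "\<dots> = letter_value H (apfst f s) \<otimes>\<^bsub>H\<^esub> (ev w \<otimes>\<^bsub>H\<^esub> \<phi> g)"
      using Cons that(2) X(1) by (subst step) (auto simp: word_value_closed)
    also have "\<dots> = ev (s # w) \<otimes>\<^bsub>H\<^esub> \<phi> g"
    proof -
      have "letter_value H (apfst f s) \<in> carrier H"
        using H.letter_closed[OF fX, of "apfst f s"] Cons by auto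
      moreover have "\<phi> g \<in> carrier H"
        using nf(1)[OF that(2)] reduced_words_subset[of X] by (auto simp: \<phi>_def intro: ev_closed)
      ultimately show ?thesis
        using Cons ev_closed[of w] by (simp add: H.m_assoc ev_def)
    qed
    finally show ?case .
  qed
  have "\<phi> \<in> hom G H"
  proof (rule homI)
    fix g assume g: "g \<in> carrier G"
    then show "\<phi> g \<in> carrier H"
      using nf(1) reduced_words_subset[of X] by (auto simp: \<phi>_def intro: ev_closed)
    fix h assume h: "h \<in> carrier G"
    show "\<phi> (g \<otimes> h) = \<phi> g \<otimes>\<^bsub>H\<^esub> \<phi> h"
      using mult[of "nf g" h] nf[OF g] h reduced_words_subset[of X] by (auto simp: \<phi>_def)
  qed
  moreover have "\<phi> x = f x" if "x \<in> X" for x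
  proof -
    have "nf x = [(x, True)]"
      using that X(1) by (intro nf_eq) (auto simp: reduced_words_Cons letter_value_def)
    then show ?thesis
      using that fX by (auto simp: \<phi>_def ev_def letter_value_def image_subset_iff)
  qed
  ultimately show ?thesis by blast
qed

text \<open>The universal property for one target, the permutation group of the reduced words,
  already characterizes free bases.\<close>

theorem free_basisI:
  assumes X: "X \<subseteq> carrier G" and gen: "carrier G \<subseteq> generate G X"
    and ext: "\<And>f. f \<in> X \<rightarrow> carrier (BijGroup (reduced_words X)) \<Longrightarrow>
      \<exists>\<phi>\<in>hom G (BijGroup (reduced_words X)). \<forall>x\<in>X. \<phi> x = f x"
  shows "free_basis G X"
proof -
  let ?R = "reduced_words X" and ?B = "BijGroup (reduced_words X)"
  interpret B: group ?B by (rule group_BijGroup)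
  define p where "p s = (\<lambda>w\<in>?R. push s w)" for s :: "'a \<times> bool"
  have p: "p s \<in> carrier ?B" if "fst s \<in> X" for s
  proof -
    have "bij_betw (p s) ?R ?R"
      by (rule bij_betw_byWitness[where f' = "push (inv_letter s)"])
         (use that push_inverse[of _ X s] push_inverse[of _ X "inv_letter s"] in
           \<open>auto simp: p_def intro!: push_reduced\<close>)
    then show ?thesis
      by (auto simp: BijGroup_def Bij_def p_def)
  qed
  have pinv: "p (inv_letter s) = inv\<^bsub>?B\<^esub> p s" if "fst s \<in> X" for s
  proof (rule B.inv_equality[symmetric])
    show "p (inv_letter s) \<otimes>\<^bsub>?B\<^esub> p s = \<one>\<^bsub>?B\<^esub>"
      using p[OF that] p[of "inv_letter s"] that
      by (auto simp: BijGroup_def compose_def p_def push_inverse push_reduced fun_eq_iff)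
  qed (use p that in auto)
  obtain \<phi> where \<phi>: "\<phi> \<in> hom G ?B" "\<And>x. x \<in> X \<Longrightarrow> \<phi> x = p (x, True)"
    using ext[of "\<lambda>x. p (x, True)"] p by auto
  interpret h: group_hom G ?B \<phi>
    using \<phi> is_group B.is_group by (simp add: group_hom_def group_hom_axioms_def)
  have letter: "\<phi> (letter_value G s) = p s" if "fst s \<in> X" for s
  proof (cases "snd s")
    case True
    then show ?thesis using that \<phi>(2)[OF that] by (cases s) (simp add: letter_value_def)
  next
    case False
    then show ?thesis
      using that \<phi>(2)[OF that] X pinv[of "(fst s, True)"] by (cases s) (auto simp: letter_value_def subset_iff)
  qed
  \<comment> \<open>Acting on the empty word reads off the reduced word, so different reduced words
    have different values.\<close>
  have act: "\<phi> (word_value G w) [] = w" if "w \<in> ?R" for w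
    using that
  proof (induction w)
    case Nil
    then show ?case by (simp add: BijGroup_def)
  next
    case (Cons s w)
    then have w: "w \<in> ?R" "fst s \<in> X" "w \<in> words X" using reduced_words_subset[of X] by (auto simp: reduced_words_Cons)
    have "\<phi> (word_value G (s # w)) = p s \<otimes>\<^bsub>?B\<^esub> \<phi> (word_value G w)"
      using w X letter by (simp add: letter_closed word_value_closed)
    moreover have "\<phi> (word_value G w) \<in> carrier ?B"
      using w X by (simp add: word_value_closed)
    ultimately have "\<phi> (word_value G (s # w)) [] = p s w"
      using p[OF w(2)] Cons.IH[OF w(1)] by (simp add: BijGroup_def compose_def)
    then show ?case
      using Cons.prems w by (simp add: p_def push_eq_Cons)
  qed
  have "inj_on (word_value G) ?R"
    by (rule inj_onI) (metis act)
  moreover have "word_value G ` ?R = carrier G"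
    using gen generate_eq_reduced_words[OF X] generate_in_carrier[OF X] by auto
  ultimately show ?thesis
    using X by (simp add: free_basis_def bij_betw_def)
qed

end

section \<open>Invariance of the rank, and automorphisms that carry bases to bases\<close>

definition Z2 :: "bool monoid" where
  "Z2 = \<lparr>carrier = UNIV, mult = (\<noteq>), one = False\<rparr>"

lemma group_Z2: "group Z2"
  by (rule groupI) (auto simp: Z2_def)

context group
begin

lemma free_basis_not_one:
  assumes "free_basis G X" "x \<in> X"
  shows "x \<noteq> \<one>"
proof
  assume "x = \<one>"
  then have "word_value G [(x, True)] = word_value G []"
    by (simp add: letter_value_def)
  moreover have "[(x, True)] \<in> reduced_words X"
    using assms(2) by (simp add: reduced_words_Cons)
  ultimately show False
    using inj_onD[OF free_basisD(2)[OF assms(1)]] reduced_words_Nil by blast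
qed

text \<open>Extensional homomorphisms are counted by their values on the group alone. They amount to
  free choices of a bit for each basis element, so their number determines the size of the
  basis.\<close>

lemma bij_betw_homs_Z2:
  assumes "free_basis G X"
  shows "bij_betw (\<lambda>\<phi>. restrict \<phi> X) (hom G Z2 \<inter> extensional (carrier G)) (X \<rightarrow>\<^sub>E UNIV)"
proof -
  note X = free_basisD(1)[OF assms]
  have "\<phi> = \<psi>" if "\<phi> \<in> hom G Z2 \<inter> extensional (carrier G)" "\<psi> \<in> hom G Z2 \<inter> extensional (carrier G)"
    "restrict \<phi> X = restrict \<psi> X" for \<phi> \<psi>
  proof (rule extensionalityI[of _ "carrier G"])
    fix g assume "g \<in> carrier G"
    moreover have "\<phi> x = \<psi> x" if "x \<in> X" for x
      using \<open>restrict \<phi> X = restrict \<psi> X\<close> that by (metis restrict_apply')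
    ultimately show "\<phi> g = \<psi> g"
      using hom_eqI[OF X, of g \<phi> Z2 \<psi>] that group_Z2 free_basis_generate[OF assms] by auto
  qed (use that in auto)
  moreover have "\<exists>\<phi>\<in>hom G Z2 \<inter> extensional (carrier G). f = restrict \<phi> X" if "f \<in> X \<rightarrow>\<^sub>E UNIV" for f
  proof -
    obtain \<phi> where \<phi>: "\<phi> \<in> hom G Z2" "\<And>x. x \<in> X \<Longrightarrow> \<phi> x = f x"
      using free_basis_extend[OF assms group_Z2, of f] by (auto simp: Z2_def)
    show ?thesis
    proof (rule bexI[of _ "restrict \<phi> (carrier G)"])
      show "f = restrict (restrict \<phi> (carrier G)) X"
        using that \<phi>(2) X by (auto simp: fun_eq_iff restrict_def PiE_def extensional_def)
      show "restrict \<phi> (carrier G) \<in> hom G Z2 \<inter> extensional (carrier G)"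
        using \<phi>(1) by (auto simp: hom_def)
    qed
  qed
  ultimately show ?thesis
    by (auto simp: bij_betw_def inj_on_def image_iff)
qed

theorem free_basis_card:
  assumes X: "free_basis G X" "finite X" and Y: "free_basis G Y"
  shows "finite Y" "card Y = card X"
proof -
  let ?P = "\<lambda>X. X \<rightarrow>\<^sub>E (UNIV :: bool set)"
  obtain f where f: "bij_betw f (?P X) (?P Y)"
    using bij_betw_trans[OF bij_betw_inv_into[OF bij_betw_homs_Z2[OF X(1)]] bij_betw_homs_Z2[OF Y]] by blast
  have "finite (?P X)" using X(2) by (intro finite_PiE) auto
  then have fin: "finite (?P Y)" using bij_betw_finite[OF f] by simp
  \<comment> \<open>Rules out an infinite \<open>Y\<close>: its indicator functions would be
    infinitely many elements of the finite set \<open>?P Y\<close>.\<close>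
  define ind where "ind y = (\<lambda>z\<in>Y. z = y)" for y
  have "inj_on ind Y"
  proof (rule inj_onI)
    fix y y' assume y: "y \<in> Y" "ind y = ind y'"
    then have "ind y y = ind y' y" by simp
    then show "y = y'" using y(1) by (simp add: ind_def)
  qed
  moreover have "ind ` Y \<subseteq> ?P Y" by (auto simp: ind_def)
  ultimately show "finite Y"
    using fin by (meson finite_imageD finite_subset)
  then have "(2::nat) ^ card Y = 2 ^ card X"
    using bij_betw_same_card[OF f] X(2) by (simp add: card_PiE)
  then show "card Y = card X" by simp
qed

lemma generate_image:
  assumes "\<phi> \<in> hom G G" "X \<subseteq> carrier G"
  shows "\<phi> ` generate G X = generate G (\<phi> ` X)"
proof -
  interpret group_hom G G \<phi>
    using assms by (simp add: group_hom_def group_hom_axioms_def is_group)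
  show ?thesis
    by (rule generate_img[symmetric, OF assms(2)])
qed

lemma auto_inverse:
  assumes "f \<in> auto G"
  obtains f' where "f' \<in> auto G" "\<And>x. x \<in> carrier G \<Longrightarrow> f' (f x) = x" "\<And>x. x \<in> carrier G \<Longrightarrow> f (f' x) = x"
proof -
  interpret Aut: group "AutoGroup G" by (rule AutoGroup)
  let ?f' = "inv\<^bsub>AutoGroup G\<^esub> f"
  have f: "f \<in> carrier (AutoGroup G)" using assms by (simp add: AutoGroup_simps)
  then have f': "?f' \<in> carrier (AutoGroup G)" by simp
  have "compose (carrier G) ?f' f = (\<lambda>x\<in>carrier G. x)" "compose (carrier G) f ?f' = (\<lambda>x\<in>carrier G. x)"
    using Aut.l_inv[OF f] Aut.r_inv[OF f] f f' by (auto simp: AutoGroup_simps)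
  then have "?f' (f x) = x \<and> f (?f' x) = x" if "x \<in> carrier G" for x
    using that by (metis compose_eq restrict_apply')
  then show ?thesis
    using that f' by (simp add: AutoGroup_simps)
qed

text \<open>Both composites need testing on generators only. Two generating sets are allowed because
  in \<open>free_bases_auto\<close> the inverse is prescribed on the target basis.\<close>

lemma auto_of_inverse_homs:
  assumes X: "X \<subseteq> carrier G" "carrier G \<subseteq> generate G X" and Y: "Y \<subseteq> carrier G" "carrier G \<subseteq> generate G Y"
    and hom: "\<phi> \<in> hom G G" "\<psi> \<in> hom G G"
    and inv: "\<And>x. x \<in> X \<Longrightarrow> \<psi> (\<phi> x) = x" "\<And>y. y \<in> Y \<Longrightarrow> \<phi> (\<psi> y) = y"
  shows "restrict \<phi> (carrier G) \<in> auto G"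
proof -
  have comp: "\<psi> \<circ> \<phi> \<in> hom G G" "\<phi> \<circ> \<psi> \<in> hom G G"
    using hom by (blast intro: Group.hom_compose)+
  have id: "id \<in> hom G G"
    by (simp add: hom_def)
  have "\<psi> (\<phi> g) = g" "\<phi> (\<psi> g) = g" if "g \<in> carrier G" for g
    using hom_eqI[OF X(1) _ comp(1) id is_group, of g] hom_eqI[OF Y(1) _ comp(2) id is_group, of g] that X Y inv
    by auto
  then have "bij_betw \<phi> (carrier G) (carrier G)"
    using hom by (intro bij_betw_byWitness[where f' = \<psi>]) (auto simp: hom_def)
  then show ?thesis
    using hom(1) by (auto simp: auto_def Bij_def hom_def bij_betw_restrict_eq)
qed

lemma free_bases_auto:
  assumes X: "free_basis G X" and Y: "free_basis G Y" and \<sigma>: "bij_betw \<sigma> X Y"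
  obtains h where "h \<in> auto G" "\<And>x. x \<in> X \<Longrightarrow> h x = \<sigma> x"
proof -
  note XY = free_basisD(1)[OF X] free_basisD(1)[OF Y] free_basis_generate[OF X] free_basis_generate[OF Y]
  let ?\<tau> = "the_inv_into X \<sigma>"
  have \<tau>: "?\<tau> (\<sigma> x) = x" if "x \<in> X" for x
    using that \<sigma> by (auto simp: bij_betw_def the_inv_into_f_f)
  have \<tau>Y: "?\<tau> y \<in> X" "\<sigma> (?\<tau> y) = y" if "y \<in> Y" for y
    using that \<sigma> by (auto simp: bij_betw_def f_the_inv_into_f intro: the_inv_into_into)
  have \<sigma>X: "\<sigma> x \<in> Y" if "x \<in> X" for x using that \<sigma> by (auto simp: bij_betw_def)
  obtain \<phi> where \<phi>: "\<phi> \<in> hom G G" "\<And>x. x \<in> X \<Longrightarrow> \<phi> x = \<sigma> x"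
    using free_basis_extend[OF X is_group, of \<sigma>] \<sigma>X XY by blast
  obtain \<psi> where \<psi>: "\<psi> \<in> hom G G" "\<And>y. y \<in> Y \<Longrightarrow> \<psi> y = ?\<tau> y"
    using free_basis_extend[OF Y is_group, of ?\<tau>] \<tau>Y XY by blast
  have "restrict \<phi> (carrier G) \<in> auto G"
    using XY \<phi> \<psi> \<tau> \<tau>Y \<sigma>X by (intro auto_of_inverse_homs[of X Y \<phi> \<psi>]) auto
  moreover have "restrict \<phi> (carrier G) x = \<sigma> x" if "x \<in> X" for x
    using \<phi>(2)[OF that] XY(1) that by auto
  ultimately show ?thesis
    using that by blast
qed

lemma free_basis_auto_image:
  assumes X: "free_basis G X" and h: "h \<in> auto G"
  shows "free_basis G (h ` X)"
proof (rule free_basisI)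
  note Xc = free_basisD(1)[OF X]
  show "h ` X \<subseteq> carrier G" using Xc h auto_closed by blast
  show "carrier G \<subseteq> generate G (h ` X)"
    using generate_image[OF auto_hom[OF h] Xc] free_basis_generate[OF X] auto_surj[OF h] by simp
  obtain h' where h': "h' \<in> auto G" "\<And>x. x \<in> carrier G \<Longrightarrow> h' (h x) = x"
    using auto_inverse[OF h] by metis
  let ?B = "BijGroup (reduced_words (h ` X))"
  fix f assume "f \<in> h ` X \<rightarrow> carrier ?B"
  then obtain \<phi> where \<phi>: "\<phi> \<in> hom G ?B" "\<And>x. x \<in> X \<Longrightarrow> \<phi> x = f (h x)"
    using free_basis_extend[OF X group_BijGroup, of "\<lambda>x. f (h x)" "reduced_words (h ` X)"] by (auto simp: Pi_iff)
  have "\<phi> \<circ> h' \<in> hom G ?B"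
    using \<phi>(1) h'(1) auto_hom[OF h'(1)] by (auto simp: hom_def)
  then show "\<exists>\<phi>\<in>hom G ?B. \<forall>x\<in>h ` X. \<phi> x = f x"
    using \<phi>(2) h'(2) Xc by (intro bexI[of _ "\<phi> \<circ> h'"]) auto
qed

end


section \<open>Free products\<close>

fun push_syllable :: "('a, 'b) monoid_scheme \<Rightarrow> bool \<Rightarrow> 'a \<Rightarrow> (bool \<times> 'a) list \<Rightarrow> (bool \<times> 'a) list" where
  "push_syllable G t s [] = (if s = \<one>\<^bsub>G\<^esub> then [] else [(t, s)])"
| "push_syllable G t s (u # w) = (if s = \<one>\<^bsub>G\<^esub> then u # w else if fst u = t
     then (if s \<otimes>\<^bsub>G\<^esub> snd u = \<one>\<^bsub>G\<^esub> then w else (t, s \<otimes>\<^bsub>G\<^esub> snd u) # w) else (t, s) # u # w)"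

lemma alternating_words_Nil [simp]: "[] \<in> alternating_words G A B"
  by (simp add: alternating_words_def)

lemma alternating_words_Cons:
  "u # w \<in> alternating_words G A B \<longleftrightarrow> snd u \<in> (if fst u then A else B) \<and> snd u \<noteq> \<one>\<^bsub>G\<^esub> \<and>
     w \<in> alternating_words G A B \<and> (w \<noteq> [] \<longrightarrow> fst (hd w) \<noteq> fst u)"
  by (cases u; cases w) (auto simp: alternating_words_def)

context group
begin

lemma sub_group: "subgroup A G \<Longrightarrow> group (G\<lparr>carrier := A\<rparr>)"
  by (rule subgroup_imp_group)

text \<open>As for \<open>free_basis_extend\<close>, normal forms are evaluated and multiplicativity
  is checked for one syllable on the left. The cases are a trivial syllable, a new syllable, a
  cancellation, and a merge of two syllables from the same factor.\<close>

lemma free_product_extend: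
  fixes H :: "('c, 'd) monoid_scheme"
  assumes prod: "internal_free_product G A B" and H: "group H"
    and f: "f \<in> hom (G\<lparr>carrier := A\<rparr>) H" "g \<in> hom (G\<lparr>carrier := B\<rparr>) H"
  shows "\<exists>\<phi>\<in>hom G H. (\<forall>a\<in>A. \<phi> a = f a) \<and> (\<forall>b\<in>B. \<phi> b = g b)"
proof -
  interpret H: group H by (rule H)
  let ?W = "alternating_words G A B"
  define V where "V w = foldr (\<otimes>) (map snd w) \<one>" for w :: "(bool \<times> 'a) list"
  have V_simps: "V [] = \<one>" "V (u # w) = snd u \<otimes> V w" for u w
    by (simp_all add: V_def)
  define C where "C t = (if t then A else B)" for t
  define k where "k t = (if t then f else g)" for t
  have sub: "subgroup (C t) G" for t
    using prod by (auto simp: C_def internal_free_product_def)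
  have bij: "bij_betw V ?W (carrier G)"
    using prod by (simp add: internal_free_product_def V_def[abs_def])
  have Cc: "s \<in> carrier G" if "s \<in> C t" for s t
    using subgroup.mem_carrier[OF sub that] .
  have Cm: "s \<otimes> s' \<in> C t" if "s \<in> C t" "s' \<in> C t" for s s' t
    using subgroup.m_closed[OF sub that] .
  have kc: "k t s \<in> carrier H" if "s \<in> C t" for s t
    using f that by (auto simp: k_def C_def hom_def split: if_splits)
  have km: "k t (s \<otimes> s') = k t s \<otimes>\<^bsub>H\<^esub> k t s'" if "s \<in> C t" "s' \<in> C t" for s s' t
    using f that by (auto simp: k_def C_def hom_def split: if_splits)
  have k1: "k t \<one> = \<one>\<^bsub>H\<^esub>" for t
    using km[of \<one> t \<one>] kc[of \<one> t] subgroup.one_closed[OF sub[of t]] by (simp add: H.l_cancel_one)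
  have WC: "u # w \<in> ?W \<longleftrightarrow> snd u \<in> C (fst u) \<and> snd u \<noteq> \<one> \<and> w \<in> ?W \<and> (w \<noteq> [] \<longrightarrow> fst (hd w) \<noteq> fst u)" for u w
    by (simp add: alternating_words_Cons C_def)
  have V: "V w \<in> carrier G" if "w \<in> ?W" for w
    using that by (induction w) (auto simp: WC Cc V_simps)
  define ev where "ev w = foldr (\<otimes>\<^bsub>H\<^esub>) (map (\<lambda>u. k (fst u) (snd u)) w) \<one>\<^bsub>H\<^esub>" for w
  have ev_simps: "ev [] = \<one>\<^bsub>H\<^esub>" "ev (u # w) = k (fst u) (snd u) \<otimes>\<^bsub>H\<^esub> ev w" for u w
    by (simp_all add: ev_def)
  have evc: "ev w \<in> carrier H" if "w \<in> ?W" for w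
    using that by (induction w) (auto simp: ev_simps V_simps WC kc)
  have push: "push_syllable G t s w \<in> ?W \<and> V (push_syllable G t s w) = s \<otimes> V w \<and>
      ev (push_syllable G t s w) = k t s \<otimes>\<^bsub>H\<^esub> ev w" if s: "s \<in> C t" and w: "w \<in> ?W" for t s w
  proof (cases w)
    case Nil
    then show ?thesis using s by (auto simp: WC ev_simps V_simps Cc kc k1)
  next
    case (Cons u v)
    have u: "snd u \<in> C (fst u)" "snd u \<noteq> \<one>" "v \<in> ?W" "v \<noteq> [] \<Longrightarrow> fst (hd v) \<noteq> fst u"
      using w Cons by (auto simp: WC)
    have cl: "s \<in> carrier G" "snd u \<in> carrier G" "V v \<in> carrier G" "k t s \<in> carrier H"
      "k (fst u) (snd u) \<in> carrier H" "ev v \<in> carrier H"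
      using s u Cc V kc evc by blast+
    consider "s = \<one>" | "s \<noteq> \<one>" "fst u \<noteq> t" | "s \<noteq> \<one>" "fst u = t" "s \<otimes> snd u = \<one>"
      | "s \<noteq> \<one>" "fst u = t" "s \<otimes> snd u \<noteq> \<one>" by blast
    then show ?thesis
    proof cases
      case 1
      then show ?thesis using w Cons cl k1 by (auto simp: WC ev_simps V_simps)
    next
      case 2
      then show ?thesis using s w Cons by (auto simp: WC ev_simps V_simps)
    next
      case 3
      have "s \<otimes> (snd u \<otimes> V v) = V v" "k t s \<otimes>\<^bsub>H\<^esub> (k t (snd u) \<otimes>\<^bsub>H\<^esub> ev v) = ev v"
        using 3 cl km[of s t "snd u"] s u(1) k1 by (simp_all add: m_assoc[symmetric] H.m_assoc[symmetric])
      then show ?thesis using 3 Cons u by (auto simp: ev_simps V_simps)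
    next
      case 4
      have "s \<otimes> (snd u \<otimes> V v) = s \<otimes> snd u \<otimes> V v"
        "k t s \<otimes>\<^bsub>H\<^esub> (k t (snd u) \<otimes>\<^bsub>H\<^esub> ev v) = k t (s \<otimes> snd u) \<otimes>\<^bsub>H\<^esub> ev v"
        using 4 cl km[of s t "snd u"] s u(1) by (simp_all add: m_assoc H.m_assoc)
      then show ?thesis using 4 Cons u s Cm[of s t "snd u"] by (auto simp: ev_simps V_simps WC)
    qed
  qed
  define nf where "nf = the_inv_into ?W V"
  have nf: "nf x \<in> ?W" "V (nf x) = x" if "x \<in> carrier G" for x
    using that bij by (auto simp: nf_def bij_betw_def the_inv_into_into f_the_inv_into_f)
  have nf_eq: "nf x = w" if "w \<in> ?W" "V w = x" for x w
    using that bij by (auto simp: nf_def bij_betw_def the_inv_into_f_f)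
  define \<phi> where "\<phi> x = ev (nf x)" for x
  have step: "\<phi> (s \<otimes> x) = k t s \<otimes>\<^bsub>H\<^esub> \<phi> x" if "s \<in> C t" "x \<in> carrier G" for s t x
  proof -
    note p = push[OF that(1) nf(1)[OF that(2)], unfolded nf(2)[OF that(2)]]
    have "nf (s \<otimes> x) = push_syllable G t s (nf x)"
      using p by (intro nf_eq) auto
    then show ?thesis
      using p by (simp add: \<phi>_def)
  qed
  have \<phi>c: "\<phi> x \<in> carrier H" if "x \<in> carrier G" for x
    using nf(1)[OF that] evc by (simp add: \<phi>_def)
  have mult: "\<phi> (V w \<otimes> x) = ev w \<otimes>\<^bsub>H\<^esub> \<phi> x" if "w \<in> ?W" "x \<in> carrier G" for w x
    using that(1)
  proof (induction w)
    case (Cons u w)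
    then have u: "snd u \<in> C (fst u)" "w \<in> ?W" by (auto simp: WC)
    then have "\<phi> (V (u # w) \<otimes> x) = \<phi> (snd u \<otimes> (V w \<otimes> x))"
      using that(2) V Cc by (simp add: m_assoc V_simps)
    then show ?case
      using step[OF u(1), of "V w \<otimes> x"] Cons.IH[OF u(2)] u V that(2) kc evc \<phi>c
      by (simp add: ev_simps V_simps H.m_assoc)
  qed (use that \<phi>c in \<open>simp add: ev_simps V_simps\<close>)
  have "\<phi> \<in> hom G H"
  proof (rule homI)
    fix x y assume "x \<in> carrier G" "y \<in> carrier G"
    then show "\<phi> (x \<otimes> y) = \<phi> x \<otimes>\<^bsub>H\<^esub> \<phi> y"
      using mult[of "nf x" y] nf[of x] by (simp add: \<phi>_def)
  qed (rule \<phi>c)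
  moreover have "\<phi> s = k t s" if "s \<in> C t" for s t
  proof -
    have "\<phi> \<one> = \<one>\<^bsub>H\<^esub>"
      using nf_eq[of "[]" \<one>] by (simp add: \<phi>_def ev_simps V_simps)
    then show ?thesis
      using step[OF that one_closed] that by (simp add: Cc kc)
  qed
  from this[of _ True] this[of _ False] have "\<forall>a\<in>A. \<phi> a = f a" "\<forall>b\<in>B. \<phi> b = g b"
    by (auto simp: C_def k_def)
  ultimately show ?thesis by blast
qed

text \<open>A map on the two bases extends first over each factor and then over the free product;
  this is the universal property demanded by \<open>free_basisI\<close>.\<close>

theorem free_product_basis:
  assumes prod: "internal_free_product G A B"
    and Y: "free_basis (G\<lparr>carrier := A\<rparr>) Y" and Z: "free_basis (G\<lparr>carrier := B\<rparr>) Z"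
  shows "free_basis G (Y \<union> Z)" "Y \<inter> Z = {}"
proof -
  have sub: "subgroup A G" "subgroup B G"
    and bij: "bij_betw (\<lambda>w. foldr (\<otimes>) (map snd w) \<one>) (alternating_words G A B) (carrier G)"
    using prod by (auto simp: internal_free_product_def)
  interpret A: group "G\<lparr>carrier := A\<rparr>" using sub by (intro sub_group)
  interpret B: group "G\<lparr>carrier := B\<rparr>" using sub by (intro sub_group)
  have Yc: "Y \<subseteq> A" and Zc: "Z \<subseteq> B" using A.free_basisD(1)[OF Y] B.free_basisD(1)[OF Z] by auto
  have Ac: "A \<subseteq> carrier G" and Bc: "B \<subseteq> carrier G" using sub by (auto simp: subgroup.subset)
  show disj: "Y \<inter> Z = {}"
  proof (rule ccontr)
    assume "Y \<inter> Z \<noteq> {}"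
    then obtain x where x: "x \<in> Y" "x \<in> Z" by auto
    then have "x \<noteq> \<one>" using A.free_basis_not_one[OF Y] by auto
    then have "[(True, x)] \<in> alternating_words G A B" "[(False, x)] \<in> alternating_words G A B"
      using x Yc Zc by (auto simp: alternating_words_Cons)
    then have "[(True, x)] = [(False, x)]"
      using bij by (intro inj_onD[of "\<lambda>w. foldr (\<otimes>) (map snd w) \<one>"]) (auto simp: bij_betw_def)
    then show False by simp
  qed
  have genA: "A \<subseteq> generate G (Y \<union> Z)"
    using A.free_basis_generate[OF Y] generate_consistent[OF Yc sub(1)] mono_generate[of Y "Y \<union> Z"] by auto
  have genB: "B \<subseteq> generate G (Y \<union> Z)"
    using B.free_basis_generate[OF Z] generate_consistent[OF Zc sub(2)] mono_generate[of Z "Y \<union> Z"] by auto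
  show "free_basis G (Y \<union> Z)"
  proof (rule free_basisI)
    show YZ: "Y \<union> Z \<subseteq> carrier G" using Yc Zc Ac Bc by auto
    have "foldr (\<otimes>) (map snd w) \<one> \<in> generate G (Y \<union> Z)" if "w \<in> alternating_words G A B" for w
      using that
    proof (induction w)
      case (Cons u w)
      then have "snd u \<in> generate G (Y \<union> Z)"
        using genA genB by (auto simp: alternating_words_Cons split: if_splits)
      then show ?case using Cons by (auto simp: alternating_words_Cons intro: generate.eng)
    qed (auto intro: generate.one)
    then show "carrier G \<subseteq> generate G (Y \<union> Z)"
      unfolding bij_betw_imp_surj_on[OF bij, symmetric] by (rule image_subsetI)
    let ?P = "BijGroup (reduced_words (Y \<union> Z))"
    fix f assume "f \<in> Y \<union> Z \<rightarrow> carrier ?P"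
    then have f: "f \<in> Y \<rightarrow> carrier ?P" "f \<in> Z \<rightarrow> carrier ?P" by auto
    obtain a where a: "a \<in> hom (G\<lparr>carrier := A\<rparr>) ?P" "\<forall>x\<in>Y. a x = f x"
      using A.free_basis_extend[OF Y group_BijGroup f(1)] by blast
    obtain b where b: "b \<in> hom (G\<lparr>carrier := B\<rparr>) ?P" "\<forall>x\<in>Z. b x = f x"
      using B.free_basis_extend[OF Z group_BijGroup f(2)] by blast
    show "\<exists>\<phi>\<in>hom G ?P. \<forall>x\<in>Y \<union> Z. \<phi> x = f x"
      using free_product_extend[OF prod group_BijGroup a(1) b(1)] a(2) b(2) Yc Zc by (metis Un_iff subsetD)
  qed
qed

end

section \<open>Schreier transversals and the Nielsen--Schreier theorem\<close>

text \<open>Balls are preferred to \<open>word_length\<close>: membership provides a short word at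
  once and is meaningful before \<open>Y\<close> is known to generate anything.\<close>

definition word_ball :: "('a, 'b) monoid_scheme \<Rightarrow> 'a set \<Rightarrow> nat \<Rightarrow> 'a set" where
  "word_ball G Y k = word_value G ` {w \<in> words Y. length w \<le> k}"

text \<open>A right \<open>A\<close>-equivariant map \<open>c\<close> from \<open>G\<close> to \<open>A\<close> encodes a transversal \<open>{g. c g = \<one>}\<close> of the
  left cosets of \<open>A\<close> together with its translates, the other fibers. The Cayley graph in question
  has the edges from \<open>g\<close> to \<open>x \<otimes> g\<close>, on which \<open>A\<close> acts from the right; the fibers of a
  \<open>schreier\<close> map are connected subgraphs.\<close>

definition coset_retraction :: "('a, 'b) monoid_scheme \<Rightarrow> 'a set \<Rightarrow> ('a \<Rightarrow> 'a) \<Rightarrow> bool" where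
  "coset_retraction G A c \<longleftrightarrow>
     c \<in> carrier G \<rightarrow> A \<and> (\<forall>g\<in>carrier G. \<forall>a\<in>A. c (g \<otimes>\<^bsub>G\<^esub> a) = c g \<otimes>\<^bsub>G\<^esub> a)"

definition fiber_step :: "('a, 'b) monoid_scheme \<Rightarrow> 'a set \<Rightarrow> ('a \<Rightarrow> 'a) \<Rightarrow> 'a \<Rightarrow> 'a \<Rightarrow> bool" where
  "fiber_step G X c g h \<longleftrightarrow>
     g \<in> carrier G \<and> c h = c g \<and> (\<exists>s. fst s \<in> X \<and> h = letter_value G s \<otimes>\<^bsub>G\<^esub> g)"

definition schreier :: "('a, 'b) monoid_scheme \<Rightarrow> 'a set \<Rightarrow> 'a set \<Rightarrow> ('a \<Rightarrow> 'a) \<Rightarrow> bool" where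
  "schreier G A X c \<longleftrightarrow> coset_retraction G A c \<and>
     (\<forall>g\<in>carrier G. \<forall>h\<in>carrier G. c g = c h \<longrightarrow> (fiber_step G X c)\<^sup>*\<^sup>* g h)"

text \<open>For equivariant \<open>c\<close> the quotient does not change when \<open>g\<close> is
  replaced by \<open>g \<otimes> a\<close> with \<open>a\<close> in \<open>A\<close>, so it belongs
  to the orbit of the edge from \<open>g\<close> to \<open>x \<otimes> g\<close>. Discarding
  \<open>\<one>\<close> leaves the edges that join different fibers.\<close>

definition schreier_gens :: "('a, 'b) monoid_scheme \<Rightarrow> 'a set \<Rightarrow> ('a \<Rightarrow> 'a) \<Rightarrow> 'a set" where
  "schreier_gens G X c =
     {c (x \<otimes>\<^bsub>G\<^esub> g) \<otimes>\<^bsub>G\<^esub> inv\<^bsub>G\<^esub> (c g) | x g. x \<in> X \<and> g \<in> carrier G} - {\<one>\<^bsub>G\<^esub>}"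

context group
begin

lemma word_ball_closed: "Y \<subseteq> carrier G \<Longrightarrow> g \<in> word_ball G Y k \<Longrightarrow> g \<in> carrier G"
  by (auto simp: word_ball_def intro: word_value_closed)

lemma word_ball_one: "\<one> \<in> word_ball G Y k"
  by (auto simp: word_ball_def intro!: image_eqI[of _ _ "[]"])

lemma word_ball_letter: "Y \<subseteq> carrier G \<Longrightarrow> fst s \<in> Y \<Longrightarrow> letter_value G s \<in> word_ball G Y 1"
  by (auto simp: word_ball_def letter_closed intro!: image_eqI[of _ _ "[s]"])

lemma word_ball_base: "Y \<subseteq> carrier G \<Longrightarrow> y \<in> Y \<Longrightarrow> y \<in> word_ball G Y 1"
  using word_ball_letter[of Y "(y, True)"] by (simp add: letter_value_def)

lemma word_ball_mono: "k \<le> l \<Longrightarrow> g \<in> word_ball G Y k \<Longrightarrow> g \<in> word_ball G Y l"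
  by (auto simp: word_ball_def)

lemma word_ball_mult:
  "Y \<subseteq> carrier G \<Longrightarrow> g \<in> word_ball G Y k \<Longrightarrow> h \<in> word_ball G Y l \<Longrightarrow> g \<otimes> h \<in> word_ball G Y (k + l)"
proof -
  assume Y: "Y \<subseteq> carrier G" and "g \<in> word_ball G Y k" "h \<in> word_ball G Y l"
  then obtain v w where "v \<in> words Y" "w \<in> words Y" "length v \<le> k" "length w \<le> l"
    "g = word_value G v" "h = word_value G w"
    by (auto simp: word_ball_def)
  then show ?thesis
    using word_value_append[OF Y, of v w]
    unfolding word_ball_def by (intro image_eqI[of _ _ "v @ w"]) auto
qed

lemma word_ball_inv: "Y \<subseteq> carrier G \<Longrightarrow> g \<in> word_ball G Y k \<Longrightarrow> inv g \<in> word_ball G Y k"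
proof -
  assume Y: "Y \<subseteq> carrier G" and "g \<in> word_ball G Y k"
  then obtain w where "w \<in> words Y" "length w \<le> k" "g = word_value G w"
    by (auto simp: word_ball_def)
  then show ?thesis
    using word_value_inverse[OF Y, of w]
    unfolding word_ball_def by (intro image_eqI[of _ _ "inv_word w"]) auto
qed

lemma word_ball_generate: "Y \<subseteq> carrier G \<Longrightarrow> g \<in> word_ball G Y k \<Longrightarrow> g \<in> generate G Y"
  by (auto simp: word_ball_def generate_eq_words)

lemma coset_retractionD:
  assumes "coset_retraction G A c"
  shows "g \<in> carrier G \<Longrightarrow> c g \<in> A" "g \<in> carrier G \<Longrightarrow> a \<in> A \<Longrightarrow> c (g \<otimes> a) = c g \<otimes> a"
  using assms by (auto simp: coset_retraction_def)

lemma schreierD: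
  assumes "schreier G A X c"
  shows "coset_retraction G A c"
    "g \<in> carrier G \<Longrightarrow> h \<in> carrier G \<Longrightarrow> c g = c h \<Longrightarrow> (fiber_step G X c)\<^sup>*\<^sup>* g h"
  using assms by (auto simp: schreier_def)

lemma fiber_step_sym:
  assumes X: "X \<subseteq> carrier G" and gh: "fiber_step G X c g h"
  shows "fiber_step G X c h g"
proof -
  obtain s where s: "fst s \<in> X" "h = letter_value G s \<otimes> g" and g: "g \<in> carrier G" "c h = c g"
    using gh by (auto simp: fiber_step_def)
  have l: "letter_value G s \<in> carrier G" "fst s \<in> carrier G" using letter_closed[OF X s(1)] X s(1) by auto
  then have "g = letter_value G (inv_letter s) \<otimes> h"
    using s(2) g by (simp add: letter_inverse inv_cancel)
  then show ?thesis
    unfolding fiber_step_def using g s l by (intro conjI exI[of _ "inv_letter s"]) auto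
qed

lemma fiber_steps_sym:
  assumes X: "X \<subseteq> carrier G"
  shows "(fiber_step G X c)\<^sup>*\<^sup>* g h \<Longrightarrow> (fiber_step G X c)\<^sup>*\<^sup>* h g"
proof (induction rule: rtranclp_induct)
  case (step y z)
  then show ?case
    using fiber_step_sym[OF X step(2)] by (meson converse_rtranclp_into_rtranclp)
qed simp

lemma fiber_steps_translate:
  assumes X: "X \<subseteq> carrier G" and A: "subgroup A G" and c: "coset_retraction G A c" and a: "a \<in> A"
  shows "(fiber_step G X c)\<^sup>*\<^sup>* g h \<Longrightarrow> (fiber_step G X c)\<^sup>*\<^sup>* (g \<otimes> a) (h \<otimes> a)"
proof (induction rule: rtranclp_induct)
  case (step y z)
  obtain s where s: "fst s \<in> X" "z = letter_value G s \<otimes> y" and y: "y \<in> carrier G" "c z = c y"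
    using step(2) by (auto simp: fiber_step_def)
  have cl: "letter_value G s \<in> carrier G" "a \<in> carrier G" "z \<in> carrier G"
    using letter_closed[OF X s(1)] a subgroup.mem_carrier[OF A] s y by auto
  have "c (z \<otimes> a) = c (y \<otimes> a)" "z \<otimes> a = letter_value G s \<otimes> (y \<otimes> a)"
    using cl y a coset_retractionD(2)[OF c cl(3) a] coset_retractionD(2)[OF c y(1) a] by (simp_all add: s(2) m_assoc)
  then have "fiber_step G X c (y \<otimes> a) (z \<otimes> a)"
    unfolding fiber_step_def using cl y s a by (intro conjI exI[of _ s]) auto
  then show ?case using step(3) by simp
qed simp

text \<open>Each left coset is represented by its word of least \<open>key\<close>. Suffixes of
  minimal words are minimal, and the suffixes of a word are the vertices of its path from
  \<open>\<one>\<close>; so this path stays in one fiber.\<close>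

theorem schreier_exists:
  assumes A: "subgroup A G" and X: "X \<subseteq> carrier G" "finite X" "generate G X = carrier G"
  shows "\<exists>c. schreier G A X c"
proof -
  note Ac = subgroup.mem_carrier[OF A] subgroup.m_closed[OF A] subgroup.m_inv_closed[OF A] subgroup.one_closed[OF A]
  obtain n and f :: "'a \<Rightarrow> nat" where f: "f ` X = {i. i < n}" "inj_on f X"
    using finite_imp_inj_to_nat_seg[OF X(2)] by blast
  define code :: "'a \<times> bool \<Rightarrow> nat" where "code s = 2 * f (fst s) + (if snd s then 1 else 0)" for s
  define b where "b = 2 * n"
  have code_less: "code s < b" if "fst s \<in> X" for s
  proof -
    have "f (fst s) < n" using f(1) that by auto
    then show ?thesis by (auto simp: code_def b_def)
  qed
  have code_inj: "s = t" if "fst s \<in> X" "fst t \<in> X" "code s = code t" for s t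
  proof -
    have "snd s = snd t" using that(3) by (auto simp: code_def split: if_splits) presburger+
    moreover from this have "f (fst s) = f (fst t)" using that(3) by (auto simp: code_def)
    ultimately show ?thesis using inj_onD[OF f(2)] that by (simp add: prod_eq_iff)
  qed
  \<comment> \<open>Bijective numeration in base \<open>b\<close>, with digits from \<open>1\<close>
    to \<open>b\<close>, hence injective without any problem of leading zeros. The first letter is
    the least significant digit, so putting the same letter in front of two words preserves their
    order.\<close>
  define key where "key w = foldr (\<lambda>s k. k * b + (code s + 1)) w 0" for w
  have key_simps: "key [] = 0" "key (s # w) = key w * b + (code s + 1)" for s w
    by (simp_all add: key_def)
  have key_inj: "v = w" if "v \<in> words X" "w \<in> words X" "key v = key w" for v w
    using that
  proof (induction v arbitrary: w)
    case Nil
    then show ?case by (cases w) (auto simp: key_simps)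
  next
    case (Cons s v)
    then obtain t u where w: "w = t # u" by (cases w) (auto simp: key_simps)
    have st: "fst s \<in> X" "fst t \<in> X" using Cons w by auto
    have eq: "key v * b + code s = key u * b + code t"
      using Cons.prems(3) w by (simp add: key_simps)
    have "code s = (key v * b + code s) mod b" using code_less[OF st(1)] by simp
    also have "\<dots> = code t" unfolding eq using code_less[OF st(2)] by simp
    finally have "s = t" using code_inj st by blast
    moreover have "key v = key u"
      using eq code_less[OF st(1)] \<open>s = t\<close> by auto
    ultimately show ?case using Cons w by auto
  qed
  define P where "P g w \<longleftrightarrow> w \<in> words X \<and> inv g \<otimes> word_value G w \<in> A" for g w
  have Wc: "word_value G w \<in> carrier G" if "w \<in> words X" for w
    using word_value_closed[OF X(1) that] .
  have P_ex: "\<exists>w. P g w" if g: "g \<in> carrier G" for g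
  proof -
    obtain w where "w \<in> words X" "g = word_value G w"
      using g X(3) generate_eq_words[OF X(1)] by auto
    then show ?thesis using g Ac by (auto simp: P_def)
  qed
  have P_trans: "P g w" if "g \<in> carrier G" "P g v" "P (word_value G v) w" for g v w
  proof -
    have "inv g \<otimes> word_value G v \<otimes> (inv (word_value G v) \<otimes> word_value G w) \<in> A"
      using that Ac by (auto simp: P_def)
    then show ?thesis
      using that Wc by (auto simp: P_def m_assoc inv_cancel)
  qed
  define rp where "rp g = (ARG_MIN key w. P g w)" for g
  have rp: "P g (rp g)" "P g w \<Longrightarrow> key (rp g) \<le> key w" if "g \<in> carrier G" for g w
    using arg_min_natI[of "P g"] arg_min_nat_le[of "P g"] P_ex[OF that] by (auto simp: rp_def)
  have rp_eq: "rp g = w" if "g \<in> carrier G" "P g w" "\<And>v. P g v \<Longrightarrow> key w \<le> key v" for g w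
    using rp[OF that(1)] that by (intro key_inj) (auto simp: P_def intro!: antisym)
  have P_coset: "P (g \<otimes> a) = P g" if "g \<in> carrier G" "a \<in> A" for g a
  proof
    fix w
    show "P (g \<otimes> a) w = P g w"
    proof (cases "w \<in> words X")
      case True
      have eq: "inv (g \<otimes> a) \<otimes> word_value G w = inv a \<otimes> (inv g \<otimes> word_value G w)"
        using that Ac Wc[OF True] by (simp add: inv_mult_group m_assoc)
      have "inv g \<otimes> word_value G w = a \<otimes> (inv a \<otimes> (inv g \<otimes> word_value G w))"
        using that Ac Wc[OF True] by (simp add: inv_cancel)
      then show ?thesis
        unfolding P_def eq using that Ac by metis
    qed (simp add: P_def)
  qed
  define c where "c g = inv (word_value G (rp g)) \<otimes> g" for g
  have cA: "c g \<in> A" if g: "g \<in> carrier G" for g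
  proof -
    have "inv (inv g \<otimes> word_value G (rp g)) \<in> A"
      using rp(1)[OF g] Ac by (simp add: P_def)
    then show ?thesis
      using rp(1)[OF g] g Wc by (simp add: P_def c_def inv_mult_group)
  qed
  have c_eq: "c (g \<otimes> a) = c g \<otimes> a" if "g \<in> carrier G" "a \<in> A" for g a
    using that Ac rp(1)[OF that(1)] Wc by (simp add: c_def rp_def P_coset m_assoc P_def)
  have c: "coset_retraction G A c"
    using cA c_eq by (auto simp: coset_retraction_def)
  define mini where "mini w \<longleftrightarrow> w \<in> words X \<and> (\<forall>v. P (word_value G w) v \<longrightarrow> key w \<le> key v)" for w
  have c_mini: "c (word_value G w) = \<one>" if "mini w" for w
  proof -
    have w: "w \<in> words X" "word_value G w \<in> carrier G" using that Wc by (auto simp: mini_def)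
    have "rp (word_value G w) = w"
      using that w Ac by (intro rp_eq) (auto simp: mini_def P_def)
    then show ?thesis using w by (simp add: c_def)
  qed
  have path: "mini w \<Longrightarrow> (fiber_step G X c)\<^sup>*\<^sup>* \<one> (word_value G w)" for w
  proof (induction w)
    case (Cons s w)
    then have s: "fst s \<in> X" "w \<in> words X" by (auto simp: mini_def)
    have l: "letter_value G s \<in> carrier G" "word_value G w \<in> carrier G"
      using letter_closed[OF X(1) s(1)] Wc[OF s(2)] by auto
    have "mini w"
      unfolding mini_def
    proof (intro conjI allI impI s(2))
      fix v assume v: "P (word_value G w) v"
      then have "inv (letter_value G s \<otimes> word_value G w) \<otimes> (letter_value G s \<otimes> word_value G v) \<in> A"
        using l Wc[of v] by (simp add: P_def inv_mult_group m_assoc inv_cancel)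
      then have "P (word_value G (s # w)) (s # v)"
        using v s by (auto simp: P_def)
      then have "key (s # w) \<le> key (s # v)"
        using Cons.prems by (auto simp: mini_def)
      then have "key w * b \<le> key v * b" by (simp add: key_simps)
      moreover have "b > 0" using code_less[OF s(1)] by simp
      ultimately show "key w \<le> key v" by simp
    qed
    then have "fiber_step G X c (word_value G w) (word_value G (s # w))"
      using c_mini[OF Cons.prems] c_mini[OF \<open>mini w\<close>] s(1) l unfolding fiber_step_def
      by (intro conjI exI[of _ s]) auto
    then show ?case using Cons.IH[OF \<open>mini w\<close>] by simp
  qed simp
  have to_rep: "(fiber_step G X c)\<^sup>*\<^sup>* (c g) g" if g: "g \<in> carrier G" for g
  proof -
    have w: "rp g \<in> words X" "word_value G (rp g) \<in> carrier G" using rp(1)[OF g] Wc by (auto simp: P_def)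
    have "mini (rp g)"
      unfolding mini_def using rp[OF g] w P_trans[OF g rp(1)[OF g]] by blast
    then have "(fiber_step G X c)\<^sup>*\<^sup>* (\<one> \<otimes> c g) (word_value G (rp g) \<otimes> c g)"
      using path cA[OF g] by (intro fiber_steps_translate[OF X(1) A c]) auto
    then show ?thesis
      using w g Ac(1)[OF cA[OF g]] by (simp add: c_def inv_cancel)
  qed
  have "schreier G A X c"
    unfolding schreier_def
  proof (intro conjI ballI impI c)
    fix g h assume "g \<in> carrier G" "h \<in> carrier G" "c g = c h"
    then show "(fiber_step G X c)\<^sup>*\<^sup>* g h"
      using to_rep[of g] to_rep[of h] fiber_steps_sym[OF X(1)] by (metis rtranclp_trans)
  qed
  then show ?thesis by blast
qed

section \<open>Schreier generators and their freeness\<close>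

lemma schreier_gens_subset:
  assumes "subgroup A G" "X \<subseteq> carrier G" "coset_retraction G A c"
  shows "schreier_gens G X c \<subseteq> A"
proof
  fix y assume "y \<in> schreier_gens G X c"
  then obtain x g where "x \<in> X" "g \<in> carrier G" "y = c (x \<otimes> g) \<otimes> inv (c g)"
    by (auto simp: schreier_gens_def)
  then show "y \<in> A"
    using assms(2) subgroup.m_closed[OF assms(1)] subgroup.m_inv_closed[OF assms(1)]
      coset_retractionD(1)[OF assms(3), of g] coset_retractionD(1)[OF assms(3), of "x \<otimes> g"] by auto
qed

lemma schreier_letter_ball:
  assumes A: "subgroup A G" and X: "X \<subseteq> carrier G" and c: "coset_retraction G A c"
    and s: "fst s \<in> X" and g: "g \<in> carrier G"
  shows "c (letter_value G s \<otimes> g) \<otimes> inv (c g) \<in> word_ball G (schreier_gens G X c) 1"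
proof -
  let ?Y = "schreier_gens G X c"
  have Y: "?Y \<subseteq> carrier G" using schreier_gens_subset[OF A X c] subgroup.subset[OF A] by blast
  have cc: "c h \<in> carrier G" if "h \<in> carrier G" for h
    using coset_retractionD(1)[OF c that] subgroup.mem_carrier[OF A] by blast
  have pos: "c (x \<otimes> h) \<otimes> inv (c h) \<in> word_ball G ?Y 1" if "x \<in> X" "h \<in> carrier G" for x h
  proof (cases "c (x \<otimes> h) \<otimes> inv (c h) = \<one>")
    case False
    then have "c (x \<otimes> h) \<otimes> inv (c h) \<in> ?Y" using that by (auto simp: schreier_gens_def)
    then show ?thesis by (rule word_ball_base[OF Y])
  qed (simp add: word_ball_one)
  have x: "fst s \<in> carrier G" using s X by auto
  show ?thesis
  proof (cases "snd s")
    case True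
    then show ?thesis using pos[OF s g] by (simp add: letter_value_def)
  next
    case False
    have h: "inv (fst s) \<otimes> g \<in> carrier G" using x g by simp
    have "inv (c (fst s \<otimes> (inv (fst s) \<otimes> g)) \<otimes> inv (c (inv (fst s) \<otimes> g))) \<in> word_ball G ?Y 1"
      using word_ball_inv[OF Y pos[OF s h]] .
    then show ?thesis
      using False x g h cc[OF h] cc[OF g] by (simp add: letter_value_def inv_cancel inv_mult_group)
  qed
qed

text \<open>Telescoping along the path of \<open>w\<close>: every edge contributes a Schreier
  generator, an inverse of one, or nothing. In other words \<open>c\<close> is 1-Lipschitz.\<close>

lemma schreier_word_ball:
  assumes A: "subgroup A G" and X: "X \<subseteq> carrier G" and c: "coset_retraction G A c"
    and w: "w \<in> words X" and g: "g \<in> carrier G"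
  shows "c (word_value G w \<otimes> g) \<otimes> inv (c g) \<in> word_ball G (schreier_gens G X c) (length w)"
  using w
proof (induction w)
  case Nil
  have "c g \<in> carrier G" using coset_retractionD(1)[OF c g] subgroup.mem_carrier[OF A] by blast
  then show ?case using g by (simp add: word_ball_one)
next
  case (Cons s w)
  let ?Y = "schreier_gens G X c"
  have Y: "?Y \<subseteq> carrier G" using schreier_gens_subset[OF A X c] subgroup.subset[OF A] by blast
  have cc: "c h \<in> carrier G" if "h \<in> carrier G" for h
    using coset_retractionD(1)[OF c that] subgroup.mem_carrier[OF A] by blast
  have s: "fst s \<in> X" "w \<in> words X" using Cons by auto
  have l: "letter_value G s \<in> carrier G" "word_value G w \<in> carrier G"
    using letter_closed[OF X s(1)] word_value_closed[OF X s(2)] by auto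
  define h where "h = word_value G w \<otimes> g"
  have h: "h \<in> carrier G" "letter_value G s \<otimes> h \<in> carrier G" using l g by (auto simp: h_def)
  have "(c (letter_value G s \<otimes> h) \<otimes> inv (c h)) \<otimes> (c h \<otimes> inv (c g)) \<in> word_ball G ?Y (1 + length w)"
    using Cons.IH[OF s(2)] by (intro word_ball_mult[OF Y] schreier_letter_ball[OF A X c s(1) h(1)]) (simp add: h_def)
  then show ?case
    using h l g cc[OF h(1)] cc[OF h(2)] cc[OF g] by (simp add: m_assoc inv_cancel h_def)
qed

lemma schreier_gens_generate:
  assumes A: "subgroup A G" and X: "X \<subseteq> carrier G" "generate G X = carrier G" and c: "coset_retraction G A c"
  shows "A \<subseteq> generate G (schreier_gens G X c)"
proof
  fix a assume a: "a \<in> A"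
  have Y: "schreier_gens G X c \<subseteq> carrier G"
    using schreier_gens_subset[OF A X(1) c] subgroup.subset[OF A] by blast
  define u where "u = c \<one>"
  have u: "u \<in> A" "u \<in> carrier G" "a \<in> carrier G"
    using coset_retractionD(1)[OF c one_closed] subgroup.mem_carrier[OF A] a by (auto simp: u_def)
  \<comment> \<open>The value \<open>u\<close> of \<open>c\<close> at \<open>\<one>\<close> need not
    be trivial. Conjugation compensates for it: \<open>c h \<otimes> inv (c \<one>) = u \<otimes> h
    \<otimes> inv u = a\<close>.\<close>
  define h where "h = inv u \<otimes> a \<otimes> u"
  have h: "h \<in> A" "h \<in> carrier G"
    using a u subgroup.m_closed[OF A] subgroup.m_inv_closed[OF A] by (auto simp: h_def)
  obtain w where w: "w \<in> words X" "word_value G w = h"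
    using h(2) X generate_eq_words[OF X(1)] by (metis imageE)
  have "c (word_value G w \<otimes> \<one>) \<otimes> inv (c \<one>) \<in> generate G (schreier_gens G X c)"
    by (rule word_ball_generate[OF Y schreier_word_ball[OF A X(1) c w(1) one_closed]])
  moreover have "c (h \<otimes> \<one>) = u \<otimes> h"
    using coset_retractionD(2)[OF c one_closed h(1)] h by (simp add: u_def)
  ultimately show "a \<in> generate G (schreier_gens G X c)"
    using w u h by (simp add: h_def m_assoc inv_cancel u_def[symmetric])
qed


text \<open>The universal property behind Nielsen--Schreier: values \<open>F\<close> are prescribed
  on the edges that leave the transversal and are trivial on the edges inside it. \<open>G\<close>
  acts on the product of the transversal with \<open>H\<close>, where \<open>x\<close> moves
  \<open>m\<close> to the representative of \<open>x \<otimes> m\<close> and multiplies the second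
  coordinate by \<open>F m x\<close>. The homomorphism \<open>\<psi>\<close> is the monodromy of
  this action at a base point.\<close>

lemma schreier_extend:
  fixes H :: "('c, 'd) monoid_scheme"
  assumes basis: "free_basis G X" and A: "subgroup A G" and sch: "schreier G A X c" and H: "group H"
    and F: "\<And>m x. m \<in> carrier G \<Longrightarrow> c m = \<one> \<Longrightarrow> x \<in> X \<Longrightarrow> F m x \<in> carrier H"
    and F1: "\<And>m x. m \<in> carrier G \<Longrightarrow> c m = \<one> \<Longrightarrow> x \<in> X \<Longrightarrow> c (x \<otimes> m) = \<one> \<Longrightarrow> F m x = \<one>\<^bsub>H\<^esub>"
  shows "\<exists>\<psi>\<in>hom (G\<lparr>carrier := A\<rparr>) H. \<forall>m\<in>carrier G. c m = \<one> \<longrightarrow> (\<forall>x\<in>X. \<psi> (c (x \<otimes> m)) = F m x)"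
proof -
  interpret H: group H by (rule H)
  note X = free_basisD(1)[OF basis]
  note c = schreierD(1)[OF sch]
  note Ac = subgroup.mem_carrier[OF A] subgroup.m_closed[OF A] subgroup.m_inv_closed[OF A] subgroup.one_closed[OF A]
  have cA: "c g \<in> A" "c g \<in> carrier G" if "g \<in> carrier G" for g
    using coset_retractionD(1)[OF c that] Ac by auto
  have cm: "c (g \<otimes> a) = c g \<otimes> a" if "g \<in> carrier G" "a \<in> A" for g a
    using coset_retractionD(2)[OF c that] .
  define M where "M = {m \<in> carrier G. c m = \<one>}"
  \<comment> \<open>The point of the transversal \<open>M\<close> in the left coset of
    \<open>g\<close>.\<close>
  define \<mu> where "\<mu> g = g \<otimes> inv (c g)" for g
  have \<mu>M: "\<mu> g \<in> M" if "g \<in> carrier G" for g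
    using cA[OF that] that cm[OF that, of "inv (c g)"] Ac by (simp add: M_def \<mu>_def)
  have \<mu>_id: "\<mu> m = m" if "m \<in> M" for m
    using that by (simp add: \<mu>_def M_def)
  have \<mu>_coset: "\<mu> (g \<otimes> a) = \<mu> g" if "g \<in> carrier G" "a \<in> A" for g a
    using that cA[OF that(1)] Ac by (simp add: \<mu>_def cm inv_mult_group m_assoc inv_cancel)
  have \<mu>_\<mu>: "\<mu> (y \<otimes> \<mu> g) = \<mu> (y \<otimes> g)" if "y \<in> carrier G" "g \<in> carrier G" for y g
    using that \<mu>_coset[of "y \<otimes> g" "inv (c g)"] cA[OF that(2)] Ac by (simp add: \<mu>_def[of g] m_assoc)
  have Mc: "m \<in> carrier G" if "m \<in> M" for m using that by (simp add: M_def)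
  have Fc: "F m x \<in> carrier H" if "m \<in> M" "x \<in> X" for m x using F that by (simp add: M_def)
  have Xc: "x \<in> carrier G" if "x \<in> X" for x using X that by auto
  define S where "S = M \<times> carrier H"
  let ?B = "BijGroup S"
  interpret B: group ?B by (rule group_BijGroup)
  define p where "p x = (\<lambda>(m, h)\<in>S. (\<mu> (x \<otimes> m), F m x \<otimes>\<^bsub>H\<^esub> h))" for x
  define q where "q x = (\<lambda>(m, h). (\<mu> (inv x \<otimes> m), inv\<^bsub>H\<^esub> F (\<mu> (inv x \<otimes> m)) x \<otimes>\<^bsub>H\<^esub> h))" for x
  have qp: "q x (p x s) = s" "p x s \<in> S" if "x \<in> X" "s \<in> S" for x s
    using that Xc Mc Fc by (auto simp: S_def p_def q_def \<mu>_\<mu> \<mu>_id \<mu>M inv_cancel H.inv_cancel)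
  have pq: "p x (q x s) = s" "q x s \<in> S" if "x \<in> X" "s \<in> S" for x s
    using that Xc Mc Fc by (auto simp: S_def p_def q_def \<mu>_\<mu> \<mu>_id \<mu>M inv_cancel H.inv_cancel)
  have p: "p x \<in> carrier ?B" if "x \<in> X" for x
  proof -
    have "bij_betw (p x) S S"
      by (rule bij_betw_byWitness[where f' = "q x"]) (use that qp pq in auto)
    then show ?thesis by (auto simp: BijGroup_def Bij_def p_def)
  qed
  obtain \<Phi> where \<Phi>: "\<Phi> \<in> hom G ?B" "\<And>x. x \<in> X \<Longrightarrow> \<Phi> x = p x"
    using free_basis_extend[OF basis group_BijGroup, of p S] p by blast
  interpret h: group_hom G ?B \<Phi>
    using \<Phi> is_group B.is_group by (simp add: group_hom_def group_hom_axioms_def)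
  have \<Phi>_mult: "\<Phi> (g \<otimes> g') s = \<Phi> g (\<Phi> g' s)" if "g \<in> carrier G" "g' \<in> carrier G" "s \<in> S" for g g' s
  proof -
    have "\<Phi> g \<in> Bij S" "\<Phi> g' \<in> Bij S" using that h.hom_closed by (auto simp: BijGroup_def)
    then show ?thesis using that by (simp add: BijGroup_def compose_def)
  qed
  have \<Phi>_one: "\<Phi> \<one> s = s" if "s \<in> S" for s
    using that h.hom_one by (simp add: BijGroup_def)
  have \<Phi>S: "\<Phi> g s \<in> S" if "g \<in> carrier G" "s \<in> S" for g s
    using h.hom_closed[OF that(1)] that(2) Bij_imp_funcset[of "\<Phi> g" S] by (auto simp: BijGroup_def)
  have \<Phi>_inv: "\<Phi> (inv x) s = q x s" if "x \<in> X" "s \<in> S" for x s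
  proof -
    have "p x (\<Phi> (inv x) s) = s"
      using \<Phi>_mult[of x "inv x" s] Xc that \<Phi>_one \<Phi>(2)[OF that(1)] by simp
    then show ?thesis using qp(1)[OF that(1) \<Phi>S[of "inv x" s]] Xc that by simp
  qed
  \<comment> \<open>Left translations of \<open>H\<close> are closed under composition and
    inversion, so every group element acts on the second coordinate by a translation that depends
    only on \<open>g\<close> and \<open>m\<close>.\<close>
  have shape: "\<exists>k\<in>carrier H. \<forall>h\<in>carrier H. \<Phi> g (m, h) = (\<mu> (g \<otimes> m), k \<otimes>\<^bsub>H\<^esub> h)"
    if "g \<in> carrier G" "m \<in> M" for g m
  proof -
    have "g \<in> generate G X" using that free_basis_generate[OF basis] by simp
    then show ?thesis using that(2)
    proof (induction g arbitrary: m rule: generate.induct)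
      case one
      then show ?case using Mc \<mu>_id \<Phi>_one by (intro bexI[of _ "\<one>\<^bsub>H\<^esub>"]) (auto simp: S_def)
    next
      case (incl x)
      then show ?case using Fc \<Phi>(2) by (intro bexI[of _ "F m x"]) (auto simp: S_def p_def)
    next
      case (inv x)
      then show ?case using Fc[OF \<mu>M] Xc Mc \<Phi>_inv
        by (intro bexI[of _ "inv\<^bsub>H\<^esub> F (\<mu> (inv x \<otimes> m)) x"]) (auto simp: S_def q_def)
    next
      case (eng g1 g2)
      have g: "g1 \<in> carrier G" "g2 \<in> carrier G" using eng(1,2) generate_in_carrier[OF X] by auto
      have m: "m \<in> carrier G" "\<mu> (g2 \<otimes> m) \<in> M" using Mc[OF eng.prems] \<mu>M g by auto
      obtain k2 where k2: "k2 \<in> carrier H" "\<forall>h\<in>carrier H. \<Phi> g2 (m, h) = (\<mu> (g2 \<otimes> m), k2 \<otimes>\<^bsub>H\<^esub> h)"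
        using eng.IH(2)[OF eng.prems] by blast
      obtain k1 where k1: "k1 \<in> carrier H"
        "\<forall>h\<in>carrier H. \<Phi> g1 (\<mu> (g2 \<otimes> m), h) = (\<mu> (g1 \<otimes> \<mu> (g2 \<otimes> m)), k1 \<otimes>\<^bsub>H\<^esub> h)"
        using eng.IH(1)[OF m(2)] by blast
      show ?case
        using k1 k2 g m eng.prems \<Phi>_mult[OF g]
        by (intro bexI[of _ "k1 \<otimes>\<^bsub>H\<^esub> k2"]) (auto simp: S_def \<mu>_\<mu> m_assoc H.m_assoc)
    qed
  qed
  define \<kappa> where "\<kappa> g m = snd (\<Phi> g (m, \<one>\<^bsub>H\<^esub>))" for g m
  have \<kappa>: "\<kappa> g m \<in> carrier H" "\<And>h. h \<in> carrier H \<Longrightarrow> \<Phi> g (m, h) = (\<mu> (g \<otimes> m), \<kappa> g m \<otimes>\<^bsub>H\<^esub> h)"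
    if gm: "g \<in> carrier G" "m \<in> M" for g m
  proof -
    obtain k where k: "k \<in> carrier H" "\<forall>h\<in>carrier H. \<Phi> g (m, h) = (\<mu> (g \<otimes> m), k \<otimes>\<^bsub>H\<^esub> h)"
      using shape[OF gm] by blast
    moreover have "\<kappa> g m = k" using k by (simp add: \<kappa>_def)
    ultimately show "\<kappa> g m \<in> carrier H" "\<And>h. h \<in> carrier H \<Longrightarrow> \<Phi> g (m, h) = (\<mu> (g \<otimes> m), \<kappa> g m \<otimes>\<^bsub>H\<^esub> h)"
      by auto
  qed
  \<comment> \<open>The cocycle identity for the translation parts.\<close>
  have \<kappa>_mult: "\<kappa> (g \<otimes> g') m = \<kappa> g (\<mu> (g' \<otimes> m)) \<otimes>\<^bsub>H\<^esub> \<kappa> g' m"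
    if "g \<in> carrier G" "g' \<in> carrier G" "m \<in> M" for g g' m
  proof -
    have "\<mu> (g' \<otimes> m) \<in> M" using that Mc \<mu>M by auto
    then show ?thesis
      using \<kappa>_def[of "g \<otimes> g'" m] \<Phi>_mult[OF that(1,2), of "(m, \<one>\<^bsub>H\<^esub>)"] \<kappa>[OF that(2,3)] \<kappa>(2)[OF that(1)] that(3)
      by (auto simp: S_def)
  qed
  have \<kappa>_gen: "\<kappa> x m = F m x" if "x \<in> X" "m \<in> M" for x m
    using that Fc by (simp add: \<kappa>_def \<Phi>(2) p_def S_def)
  have \<kappa>_one: "\<kappa> \<one> m = \<one>\<^bsub>H\<^esub>" if "m \<in> M" for m
    using \<Phi>_one[of "(m, \<one>\<^bsub>H\<^esub>)"] that by (simp add: \<kappa>_def S_def del: h.hom_one)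
  define m0 where "m0 = \<mu> \<one>"
  have m0: "m0 \<in> M" "m0 \<in> carrier G" using \<mu>M[OF one_closed] Mc by (auto simp: m0_def)
  \<comment> \<open>In the action on the transversal, conjugates of elements of \<open>A\<close> by
    \<open>m0\<close> fix \<open>m0\<close>; on them the cocycle identity becomes
    multiplicativity.\<close>
  define \<psi> where "\<psi> a = \<kappa> (m0 \<otimes> a \<otimes> inv m0) m0" for a
  have base: "\<mu> (m0 \<otimes> a \<otimes> inv m0 \<otimes> m0) = m0" if "a \<in> A" for a
    using that m0 Ac \<mu>_coset[OF m0(2) that] \<mu>_id[OF m0(1)] by (simp add: m_assoc)
  have "\<psi> \<in> hom (G\<lparr>carrier := A\<rparr>) H"
  proof (rule homI)
    fix a assume "a \<in> carrier (G\<lparr>carrier := A\<rparr>)"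
    then have a: "a \<in> A" "a \<in> carrier G" using Ac by auto
    then show "\<psi> a \<in> carrier H" unfolding \<psi>_def using m0 by (intro \<kappa>(1)) auto
    fix b assume "b \<in> carrier (G\<lparr>carrier := A\<rparr>)"
    then have b: "b \<in> A" "b \<in> carrier G" using Ac by auto
    have "m0 \<otimes> (a \<otimes> b) \<otimes> inv m0 = (m0 \<otimes> a \<otimes> inv m0) \<otimes> (m0 \<otimes> b \<otimes> inv m0)"
      using a b m0 by (simp add: m_assoc inv_cancel)
    then show "\<psi> (a \<otimes>\<^bsub>G\<lparr>carrier := A\<rparr>\<^esub> b) = \<psi> a \<otimes>\<^bsub>H\<^esub> \<psi> b"
      using \<kappa>_mult[of "m0 \<otimes> a \<otimes> inv m0" "m0 \<otimes> b \<otimes> inv m0" m0] base[OF b(1)] a b m0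
      by (simp add: \<psi>_def)
  qed
  moreover have "\<psi> (c (x \<otimes> m)) = F m x" if m: "m \<in> M" and x: "x \<in> X" for m x
  proof -
    \<comment> \<open>Moving inside the transversal costs nothing: by \<open>F1\<close> its edges
      carry the identity, in whichever direction they are traversed.\<close>
    have path: "\<kappa> (z \<otimes> inv m0) m0 = \<one>\<^bsub>H\<^esub>" if z: "z \<in> M" for z
    proof -
      have "(fiber_step G X c)\<^sup>*\<^sup>* m0 z"
        using schreierD(2)[OF sch] z m0 by (auto simp: M_def)
      then have "z \<in> M \<and> \<kappa> (z \<otimes> inv m0) m0 = \<one>\<^bsub>H\<^esub>"
      proof (induction rule: rtranclp_induct)
        case base
        then show ?case using m0 \<kappa>_one by simp
      next
        case (step y z)
        obtain s where s: "fst s \<in> X" "z = letter_value G s \<otimes> y" "c z = c y"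
          using step(2) by (auto simp: fiber_step_def)
        have y: "y \<in> M" "y \<in> carrier G" "\<kappa> (y \<otimes> inv m0) m0 = \<one>\<^bsub>H\<^esub>" using step(3) Mc by auto
        have l: "letter_value G s \<in> carrier G" "fst s \<in> carrier G" using letter_closed[OF X s(1)] Xc s(1) by auto
        have z: "z \<in> M" "z \<in> carrier G" using y s l by (auto simp: M_def)
        have "z \<otimes> inv m0 = letter_value G s \<otimes> (y \<otimes> inv m0)"
          using s l y m0 by (simp add: m_assoc)
        moreover have "\<mu> (y \<otimes> inv m0 \<otimes> m0) = y" using y m0 \<mu>_id by (simp add: m_assoc)
        ultimately have 1: "\<kappa> (z \<otimes> inv m0) m0 = \<kappa> (letter_value G s) y"
          using \<kappa>_mult[of "letter_value G s" "y \<otimes> inv m0" m0] y m0 l \<kappa>(1)[of "letter_value G s" y] by simp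
        have "\<kappa> (letter_value G s) y = \<one>\<^bsub>H\<^esub>"
        proof (cases "snd s")
          case True
          then show ?thesis
            using s y z F1[of y "fst s"] \<kappa>_gen[OF s(1) y(1)] by (simp add: letter_value_def M_def)
        next
          case False
          then have z': "z = inv (fst s) \<otimes> y" using s by (simp add: letter_value_def)
          then have "fst s \<otimes> z = y" using l y by (simp add: inv_cancel)
          then have "F z (fst s) = \<one>\<^bsub>H\<^esub>"
            using F1[of z "fst s"] z y s by (auto simp: M_def)
          moreover have "\<kappa> (fst s \<otimes> inv (fst s)) y = \<kappa> (fst s) z \<otimes>\<^bsub>H\<^esub> \<kappa> (inv (fst s)) y"
            using \<kappa>_mult[of "fst s" "inv (fst s)" y] l y z z' \<mu>_id by simp
          ultimately show ?thesis
            using False l y \<kappa>_one[OF y(1)] \<kappa>_gen[OF s(1) z(1)] \<kappa>(1)[of "inv (fst s)" y]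
            by (simp add: letter_value_def)
        qed
        then show ?case using 1 z by simp
      qed
      then show ?thesis by simp
    qed
    define y where "y = c (x \<otimes> m)"
    define m' where "m' = \<mu> (x \<otimes> m)"
    have xm: "x \<otimes> m \<in> carrier G" "m \<in> carrier G" "x \<in> carrier G" using x m Xc Mc by auto
    have y: "y \<in> A" "y \<in> carrier G" using cA[OF xm(1)] by (auto simp: y_def)
    have m': "m' \<in> M" "m' \<in> carrier G" using \<mu>M[OF xm(1)] Mc by (auto simp: m'_def)
    have "x \<otimes> m = m' \<otimes> y"
      using xm y by (simp add: m'_def y_def \<mu>_def m_assoc)
    \<comment> \<open>The edge from \<open>m\<close> along \<open>x\<close> ends in
      \<open>m' \<otimes> y\<close>. Evaluating the cocycle at \<open>m0\<close> gives
      \<open>F m x\<close> on the left side and \<open>\<psi> y\<close> on the right side.\<close>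
    then have eq: "x \<otimes> (m \<otimes> inv m0) = (m' \<otimes> inv m0) \<otimes> (m0 \<otimes> y \<otimes> inv m0)"
      using xm m' y m0 by (simp add: m_assoc[symmetric]) (simp add: m_assoc inv_cancel)
    have "\<mu> (m \<otimes> inv m0 \<otimes> m0) = m" using xm m0 \<mu>_id[OF m] by (simp add: m_assoc)
    then have "\<kappa> (x \<otimes> (m \<otimes> inv m0)) m0 = F m x"
      using \<kappa>_mult[of x "m \<otimes> inv m0" m0] xm m0 path[OF m] \<kappa>_gen[OF x m] Fc[OF m x] by simp
    moreover have "\<kappa> ((m' \<otimes> inv m0) \<otimes> (m0 \<otimes> y \<otimes> inv m0)) m0 = \<psi> y"
      using \<kappa>_mult[of "m' \<otimes> inv m0" "m0 \<otimes> y \<otimes> inv m0" m0] m0 m' y base[OF y(1)] path[OF m'(1)]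
        \<kappa>(1)[of "m0 \<otimes> y \<otimes> inv m0" m0] by (simp add: \<psi>_def)
    ultimately show ?thesis using eq by (simp add: y_def)
  qed
  ultimately show ?thesis by (auto simp: M_def)
qed

text \<open>Both parts come from \<open>schreier_extend\<close>. Permutations of the reduced words
  as target give the universal property of a basis; \<open>Z2\<close> as target, with the indicator
  of a single edge, shows that different edges have different generators.\<close>

theorem nielsen_schreier:
  assumes basis: "free_basis G X" and A: "subgroup A G" and sch: "schreier G A X c"
  shows "free_basis (G\<lparr>carrier := A\<rparr>) (schreier_gens G X c)" (is "free_basis ?A ?Y")
    and "bij_betw (\<lambda>(m, x). c (x \<otimes> m)) {(m, x). m \<in> carrier G \<and> c m = \<one> \<and> x \<in> X \<and> c (x \<otimes> m) \<noteq> \<one>}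
      (schreier_gens G X c)"
      (is "bij_betw ?f ?E _")
proof -
  note X = free_basisD(1)[OF basis]
  note c = schreierD(1)[OF sch]
  interpret A: group ?A by (rule sub_group[OF A])
  have sub: "?Y \<subseteq> A" by (rule schreier_gens_subset[OF A X c])
  have rep: "\<exists>(m, x)\<in>?E. y = c (x \<otimes> m)" if y: "y \<in> ?Y" for y
  proof -
    obtain x g where xg: "x \<in> X" "x \<in> carrier G" "g \<in> carrier G" "y = c (x \<otimes> g) \<otimes> inv (c g)" "y \<noteq> \<one>"
      using y X unfolding schreier_gens_def by blast
    have a: "inv (c g) \<in> A" "c g \<in> carrier G"
      using coset_retractionD(1)[OF c xg(3)] subgroup.m_inv_closed[OF A] subgroup.mem_carrier[OF A] by auto
    define m where "m = g \<otimes> inv (c g)"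
    have "c m = \<one>" "m \<in> carrier G"
      using coset_retractionD(2)[OF c xg(3) a(1)] a xg by (auto simp: m_def)
    moreover have "c (x \<otimes> m) = y"
      using coset_retractionD(2)[OF c _ a(1), of "x \<otimes> g"] xg a by (simp add: m_def m_assoc)
    ultimately show ?thesis using xg by (intro bexI[of _ "(m, x)"]) auto
  qed
  have mem: "c (x \<otimes> m) \<in> ?Y" if "(m, x) \<in> ?E" for m x
  proof -
    have "c (x \<otimes> m) = c (x \<otimes> m) \<otimes> inv (c m)" "x \<in> carrier G"
      using that X coset_retractionD(1)[OF c, of "x \<otimes> m"] subgroup.mem_carrier[OF A] by auto
    then show ?thesis using that unfolding schreier_gens_def by blast
  qed
  show "free_basis ?A ?Y"
  proof (rule A.free_basisI)
    show "?Y \<subseteq> carrier ?A" using sub by simp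
    show "carrier ?A \<subseteq> generate ?A ?Y"
      using schreier_gens_generate[OF A X free_basis_generate[OF basis] c] generate_consistent[OF sub A] by simp
    let ?B = "BijGroup (reduced_words ?Y)"
    interpret B: group ?B by (rule group_BijGroup)
    fix f assume f: "f \<in> ?Y \<rightarrow> carrier ?B"
    define F where "F m x = (if c (x \<otimes> m) = \<one> then \<one>\<^bsub>?B\<^esub> else f (c (x \<otimes> m)))" for m x
    have Fc: "F m x \<in> carrier ?B" if "m \<in> carrier G" "c m = \<one>" "x \<in> X" for m x
    proof (cases "c (x \<otimes> m) = \<one>")
      case False
      then have "c (x \<otimes> m) \<in> ?Y" using mem[of m x] that by simp
      then show ?thesis using f False by (auto simp: F_def simp del: B.one_closed)
    qed (simp add: F_def)
    have "\<exists>\<psi>\<in>hom ?A ?B. \<forall>m\<in>carrier G. c m = \<one> \<longrightarrow> (\<forall>x\<in>X. \<psi> (c (x \<otimes> m)) = F m x)"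
      using Fc by (intro schreier_extend[OF basis A sch group_BijGroup]) (auto simp: F_def)
    then obtain \<psi> where \<psi>: "\<psi> \<in> hom ?A ?B"
      "\<And>m x. m \<in> carrier G \<Longrightarrow> c m = \<one> \<Longrightarrow> x \<in> X \<Longrightarrow> \<psi> (c (x \<otimes> m)) = F m x"
      by blast
    show "\<exists>\<phi>\<in>hom ?A ?B. \<forall>x\<in>?Y. \<phi> x = f x"
    proof (rule bexI[OF _ \<psi>(1)], intro ballI)
      fix y assume "y \<in> ?Y"
      then obtain m x where "(m, x) \<in> ?E" "y = c (x \<otimes> m)" using rep by blast
      then show "\<psi> y = f y" using \<psi>(2)[of m x] by (simp add: F_def)
    qed
  qed
  have "inj_on ?f ?E"
  proof (rule inj_onI, clarify)
    fix m x m' x'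
    assume E: "m \<in> carrier G" "c m = \<one>" "x \<in> X" "c (x \<otimes> m) \<noteq> \<one>"
      and E': "m' \<in> carrier G" "c m' = \<one>" "x' \<in> X" "c (x' \<otimes> m') \<noteq> \<one>" and eq: "c (x \<otimes> m) = c (x' \<otimes> m')"
    define F where "F u v \<longleftrightarrow> (u, v) = (m, x)" for u v
    have "\<exists>\<psi>\<in>hom ?A Z2. \<forall>m\<in>carrier G. c m = \<one> \<longrightarrow> (\<forall>x\<in>X. \<psi> (c (x \<otimes> m)) = F m x)"
      using E(4) by (intro schreier_extend[OF basis A sch group_Z2]) (auto simp: F_def Z2_def)
    then obtain \<psi> where \<psi>: "\<And>u v. u \<in> carrier G \<Longrightarrow> c u = \<one> \<Longrightarrow> v \<in> X \<Longrightarrow> \<psi> (c (v \<otimes> u)) = F u v"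
      by blast
    then have "F m x = F m' x'" using E E' eq by metis
    then show "m = m' \<and> x = x'" by (simp add: F_def)
  qed
  moreover have "?f ` ?E = ?Y" using rep mem by fast
  ultimately show "bij_betw ?f ?E ?Y" by (simp add: bij_betw_def)
qed

end

section \<open>Comparing transversals for different bases\<close>

text \<open>With \<open>n\<close> the rank of the group and \<open>r\<close> that of the subgroup:
  the sum counts the words of length at most \<open>k\<close>, \<open>2 * r\<close> bounds the
  number of endpoints of crossing edges up to translation, and the outer factor \<open>k\<close> is
  the cost of one step.\<close>

definition oscillation :: "nat \<Rightarrow> nat \<Rightarrow> nat \<Rightarrow> nat" where
  "oscillation n r k = k * ((\<Sum>i\<le>k. (2 * n) ^ i) * (2 * r))"

context group
begin

lemma word_value_sub:
  assumes "subgroup A G" "Y \<subseteq> A" "w \<in> words Y"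
  shows "word_value (G\<lparr>carrier := A\<rparr>) w = word_value G w"
  using assms(3)
proof (induction w)
  case (Cons s w)
  then show ?case using assms(1,2) by (auto simp: letter_value_def subset_iff)
qed simp

text \<open>A Schreier generator belongs to exactly one edge that leaves the transversal and crosses
  into another fiber. Its two endpoints, the second one translated back by \<open>p\<close>, are the
  only points counted here.\<close>

lemma crossing_points_finite:
  assumes basis: "free_basis G X" and A: "subgroup A G" and sch: "schreier G A X c"
    and fin: "finite (schreier_gens G X c)"
  defines "E \<equiv> {g \<in> carrier G. c g = \<one> \<and> (\<exists>s. fst s \<in> X \<and> c (letter_value G s \<otimes> g) \<noteq> \<one>)}"
  shows "finite E" "card E \<le> 2 * card (schreier_gens G X c)"
proof -
  note X = free_basisD(1)[OF basis]
  note c = schreierD(1)[OF sch]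
  note Ac = subgroup.mem_carrier[OF A] subgroup.m_closed[OF A] subgroup.m_inv_closed[OF A] subgroup.one_closed[OF A]
  let ?E = "{(m, x). m \<in> carrier G \<and> c m = \<one> \<and> x \<in> X \<and> c (x \<otimes> m) \<noteq> \<one>}"
  define p where "p = (\<lambda>(m, x). x \<otimes> m \<otimes> inv (c (x \<otimes> m)))"
  have bij: "bij_betw (\<lambda>(m, x). c (x \<otimes> m)) ?E (schreier_gens G X c)"
    by (rule nielsen_schreier(2)[OF basis A sch])
  have fE: "finite ?E" and cE: "card ?E = card (schreier_gens G X c)"
    using bij_betw_finite[OF bij] bij_betw_same_card[OF bij] fin by auto
  have sub: "E \<subseteq> fst ` ?E \<union> p ` ?E"
  proof
    fix g assume "g \<in> E"
    then obtain s where g: "g \<in> carrier G" "c g = \<one>" and s: "fst s \<in> X" "c (letter_value G s \<otimes> g) \<noteq> \<one>"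
      by (auto simp: E_def)
    have x: "fst s \<in> carrier G" using s X by auto
    show "g \<in> fst ` ?E \<union> p ` ?E"
    proof (cases "snd s")
      case True
      then have "(g, fst s) \<in> ?E" using g s by (simp add: letter_value_def)
      then show ?thesis by force
    next
      case False
      define u where "u = c (inv (fst s) \<otimes> g)"
      have u: "u \<in> A" "u \<noteq> \<one>" "u \<in> carrier G"
        using coset_retractionD(1)[OF c] s g x False Ac by (auto simp: u_def letter_value_def)
      define m where "m = inv (fst s) \<otimes> g \<otimes> inv u"
      have m: "m \<in> carrier G" "c m = \<one>"
        using coset_retractionD(2)[OF c, of "inv (fst s) \<otimes> g" "inv u"] x g u Ac by (auto simp: m_def u_def)
      have xm: "fst s \<otimes> m = g \<otimes> inv u" using x g u by (simp add: m_def m_assoc inv_cancel)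
      then have "c (fst s \<otimes> m) = inv u"
        using coset_retractionD(2)[OF c g(1), of "inv u"] g u Ac by simp
      moreover from this have "p (m, fst s) = g" using xm u g by (simp add: p_def m_assoc)
      ultimately have "(m, fst s) \<in> ?E" "p (m, fst s) = g"
        using m s u by auto
      then show ?thesis by (intro UnI2 image_eqI[of _ p "(m, fst s)"]) simp_all
    qed
  qed
  show "finite E" using sub fE by (meson finite_UnI finite_imageI finite_subset)
  have "card E \<le> card (fst ` ?E \<union> p ` ?E)" using sub fE by (intro card_mono) auto
  also have "\<dots> \<le> card (fst ` ?E) + card (p ` ?E)" by (rule card_Un_le)
  also have "\<dots> \<le> card ?E + card ?E" using fE by (intro add_mono card_image_le) auto
  finally show "card E \<le> 2 * card (schreier_gens G X c)" using cE by simp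
qed

lemma last_change:
  assumes "X \<subseteq> carrier G" "w \<in> words X" "g \<in> carrier G" "c (word_value G w \<otimes> g) \<noteq> c g"
  shows "\<exists>s v. fst s \<in> X \<and> v \<in> words X \<and> length v \<le> length w \<and>
    c (letter_value G s \<otimes> (word_value G v \<otimes> g)) \<noteq> c (word_value G v \<otimes> g)"
  using assms(2,4)
proof (induction w)
  case (Cons s w)
  then have s: "fst s \<in> X" "w \<in> words X" by auto
  show ?case
  proof (cases "c (word_value G w \<otimes> g) = c g")
    case True
    have "word_value G (s # w) \<otimes> g = letter_value G s \<otimes> (word_value G w \<otimes> g)"
      using s assms(1,3) letter_closed[OF assms(1) s(1)] word_value_closed[OF assms(1) s(2)] by (simp add: m_assoc)
    then show ?thesis using True Cons.prems s by (intro exI[of _ s] exI[of _ w]) auto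
  next
    case False
    from Cons.IH[OF s(2) this] obtain u v where "fst u \<in> X" "v \<in> words X" "length v \<le> length w"
      "c (letter_value G u \<otimes> (word_value G v \<otimes> g)) \<noteq> c (word_value G v \<otimes> g)"
      by blast
    then show ?thesis by (intro exI[of _ u] exI[of _ v]) simp
  qed
qed (use assms in simp)

text \<open>A path in a fiber of \<open>c'\<close> meets every coset of \<open>A\<close> at most once, and \<open>c\<close> can only change
  near the boundary of its own fibers, which consists of few orbits.\<close>

theorem fiber_oscillation:
  assumes basis: "free_basis G X" and finX: "finite X" and A: "subgroup A G" and sch: "schreier G A X c"
    and fin: "finite (schreier_gens G X c)"
    and sch': "schreier G A X' c'" and X': "X' \<subseteq> word_ball G X k"
    and gz: "g \<in> carrier G" "z \<in> carrier G" "c' z = c' g"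
  shows "c g \<otimes> inv (c z) \<in> word_ball G (schreier_gens G X c)
    (oscillation (card X) (card (schreier_gens G X c)) k)"
proof -
  let ?Y = "schreier_gens G X c"
  note X = free_basisD(1)[OF basis]
  note c = schreierD(1)[OF sch] and c' = schreierD(1)[OF sch']
  note Ac = subgroup.mem_carrier[OF A] subgroup.m_closed[OF A] subgroup.m_inv_closed[OF A] subgroup.one_closed[OF A]
  have Y: "?Y \<subseteq> carrier G" using schreier_gens_subset[OF A X c] subgroup.subset[OF A] by blast
  have cc: "c h \<in> A" "c h \<in> carrier G" if "h \<in> carrier G" for h
    using coset_retractionD(1)[OF c that] Ac by auto
  have X'c: "X' \<subseteq> carrier G" using X' word_ball_closed[OF X] by blast
  define E where "E = {g \<in> carrier G. c g = \<one> \<and> (\<exists>s. fst s \<in> X \<and> c (letter_value G s \<otimes> g) \<noteq> \<one>)}"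
  have E: "finite E" "card E \<le> 2 * card ?Y"
    using crossing_points_finite[OF basis A sch fin] by (auto simp: E_def)
  define W where "W = {w \<in> words X. length w \<le> k}"
  have W_eq: "W = {w. set w \<subseteq> X \<times> UNIV \<and> length w \<le> k}"
    by (auto simp: W_def words_def)
  have W: "finite W" "card W = (\<Sum>i\<le>k. (2 * card X) ^ i)"
    unfolding W_eq using finX finite_lists_length_le[of "X \<times> (UNIV :: bool set)" k]
    by (auto simp: card_lists_length_le card_cartesian_product mult.commute)
  \<comment> \<open>The points in the fiber of \<open>c'\<close> from which some
    \<open>X'\<close>-edge changes \<open>c\<close>.\<close>
  define bad where "bad = {y \<in> carrier G. c' y = c' g \<and> (\<exists>s. fst s \<in> X' \<and> c (letter_value G s \<otimes> y) \<noteq> c y)}"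
  have letter': "\<exists>w\<in>W. letter_value G s = word_value G w" if "fst s \<in> X'" for s
  proof -
    have "fst s \<in> word_ball G X k" using that X' by auto
    then have "letter_value G s \<in> word_ball G X k"
      using word_ball_inv[OF X] by (auto simp: letter_value_def)
    then show ?thesis by (auto simp: word_ball_def W_def)
  qed
  \<comment> \<open>An \<open>X'\<close>-edge is a path of at most \<open>k\<close> letters of
    \<open>X\<close>. If \<open>c\<close> changes along it, then it passes a crossing point, up to
    translation by \<open>A\<close>.\<close>
  have near: "\<exists>(w, e)\<in>W \<times> E. \<exists>a\<in>A. y = inv (word_value G w) \<otimes> e \<otimes> a" if y: "y \<in> bad" for y
  proof -
    obtain s where s: "y \<in> carrier G" "fst s \<in> X'" "c (letter_value G s \<otimes> y) \<noteq> c y"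
      using y by (auto simp: bad_def)
    obtain w where w: "w \<in> W" "letter_value G s = word_value G w" using letter'[OF s(2)] by blast
    then obtain u v where u: "fst u \<in> X" and v: "v \<in> words X" "length v \<le> length w"
      and ne: "c (letter_value G u \<otimes> (word_value G v \<otimes> y)) \<noteq> c (word_value G v \<otimes> y)"
      using last_change[OF X, of w y c] s by (auto simp: W_def)
    have vc: "word_value G v \<in> carrier G" "letter_value G u \<in> carrier G"
      using word_value_closed[OF X v(1)] letter_closed[OF X u] by auto
    define h where "h = word_value G v \<otimes> y"
    have h: "h \<in> carrier G" "letter_value G u \<otimes> h \<in> carrier G" using vc s by (auto simp: h_def)
    define e where "e = h \<otimes> inv (c h)"
    have "c e = \<one>" "e \<in> carrier G"
      using coset_retractionD(2)[OF c h(1), of "inv (c h)"] cc[OF h(1)] h Ac by (auto simp: e_def)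
    moreover have "c (letter_value G u \<otimes> e) = c (letter_value G u \<otimes> h) \<otimes> inv (c h)"
      using coset_retractionD(2)[OF c h(2), of "inv (c h)"] cc[OF h(1)] h vc Ac by (simp add: e_def m_assoc)
    then have "c (letter_value G u \<otimes> e) \<noteq> \<one>"
      using ne cc[OF h(1)] cc[OF h(2)] inv_equality[of "c (letter_value G u \<otimes> h)" "inv (c h)"]
      by (auto simp: h_def[symmetric])
    ultimately have "e \<in> E" using u unfolding E_def by blast
    moreover have "v \<in> W" using v w by (auto simp: W_def)
    moreover have "y = inv (word_value G v) \<otimes> e \<otimes> c h"
      using vc s h cc[OF h(1)] by (simp add: e_def m_assoc) (simp add: h_def inv_cancel)
    ultimately show ?thesis using cc[OF h(1)] by blast
  qed
  define Q where "Q y q \<longleftrightarrow> q \<in> W \<times> E \<and> (\<exists>a\<in>A. y = inv (word_value G (fst q)) \<otimes> snd q \<otimes> a)" for y q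
  have "\<exists>q. Q y q" if "y \<in> bad" for y
  proof -
    from near[OF that] obtain w e where "(w, e) \<in> W \<times> E" "\<exists>a\<in>A. y = inv (word_value G w) \<otimes> e \<otimes> a"
      by blast
    then have "Q y (w, e)" by (simp add: Q_def)
    then show ?thesis ..
  qed
  then obtain f where "\<And>y. y \<in> bad \<Longrightarrow> Q y (f y)" by metis
  note f = this[unfolded Q_def]
  \<comment> \<open>Bad points with the same pair lie in one left coset of \<open>A\<close>. They
    also have the same value under the equivariant \<open>c'\<close>, so they coincide; hence the
    number of bad points is bounded.\<close>
  have inj: "inj_on f bad"
  proof (rule inj_onI)
    fix y y' assume y: "y \<in> bad" "y' \<in> bad" "f y = f y'"
    define u where "u = inv (word_value G (fst (f y))) \<otimes> snd (f y)"
    obtain a a' where a: "a \<in> A" "a' \<in> A" "y = u \<otimes> a" "y' = u \<otimes> a'"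
      using f[OF y(1)] f[OF y(2)] unfolding u_def y(3) by blast
    have "fst (f y) \<in> words X" "snd (f y) \<in> carrier G" using f[OF y(1)] by (auto simp: W_def E_def)
    then have u: "u \<in> carrier G" using word_value_closed[OF X] by (simp add: u_def)
    have "c' y = c' y'" using y by (auto simp: bad_def)
    then have "c' u \<otimes> a = c' u \<otimes> a'" using a coset_retractionD(2)[OF c' u] by simp
    then have "a = a'" using a Ac coset_retractionD(1)[OF c' u] by simp
    then show "y = y'" using a by simp
  qed
  have sub: "f ` bad \<subseteq> W \<times> E" using f by blast
  have WE: "finite (W \<times> E)" using W(1) E(1) by simp
  have bad: "finite bad" "card bad \<le> card W * card E"
    using inj_on_finite[OF inj sub WE] card_inj_on_le[OF inj sub WE] by (simp_all add: card_cartesian_product)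
  \<comment> \<open>Along a path without repetitions each bad point is left at most once, at a cost
    of at most \<open>k\<close>; all other steps are free.\<close>
  have path: "c h \<otimes> inv (c y) \<in> word_ball G ?Y (k * card (bad \<inter> set (y # ys)))"
    if "rtrancl_path (fiber_step G X' c') y ys h" "y \<in> carrier G" "c' y = c' g" "distinct (y # ys)" for y ys h
    using that
  proof (induction rule: rtrancl_path.induct)
    case (base y)
    then show ?case using cc[of y] by (simp add: word_ball_one)
  next
    case (step y y1 ys h)
    obtain s where s: "fst s \<in> X'" "y1 = letter_value G s \<otimes> y" "c' y1 = c' y"
      using step.hyps(1) by (auto simp: fiber_step_def)
    have y1: "y1 \<in> carrier G" using s step.prems letter_closed[OF X'c s(1)] by simp
    have h: "h \<in> carrier G"
    proof -
      have "(fiber_step G X' c')\<^sup>*\<^sup>* y1 h"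
        using step.hyps(2) by (auto simp: rtranclp_eq_rtrancl_path)
      then show ?thesis
        using y1
      proof (induction rule: rtranclp_induct)
        case (step u v)
        then show ?case using letter_closed[OF X'c] by (auto simp: fiber_step_def)
      qed
    qed
    have IH: "c h \<otimes> inv (c y1) \<in> word_ball G ?Y (k * card (bad \<inter> set (y1 # ys)))"
      using step y1 s by simp
    have eq: "c h \<otimes> inv (c y) = (c h \<otimes> inv (c y1)) \<otimes> (c y1 \<otimes> inv (c y))"
      using cc[OF h] cc[OF y1] cc[of y] step.prems(1) by (simp add: m_assoc inv_cancel)
    show ?case
    proof (cases "c y1 = c y")
      case True
      have "k * card (bad \<inter> set (y1 # ys)) \<le> k * card (bad \<inter> set (y # y1 # ys))"
        by (intro mult_le_mono2 card_mono) auto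
      then show ?thesis
        using True IH word_ball_mono by metis
    next
      case False
      then have "y \<in> bad" using s step.prems unfolding bad_def by blast
      then have "bad \<inter> set (y # y1 # ys) = insert y (bad \<inter> set (y1 # ys))" by auto
      then have card: "card (bad \<inter> set (y # y1 # ys)) = Suc (card (bad \<inter> set (y1 # ys)))"
        using step.prems(3) by simp
      obtain w where w: "w \<in> words X" "length w \<le> k" "letter_value G s = word_value G w"
        using letter'[OF s(1)] by (auto simp: W_def)
      have "c y1 \<otimes> inv (c y) \<in> word_ball G ?Y k"
        using word_ball_mono[OF w(2) schreier_word_ball[OF A X c w(1) step.prems(1)]] s(2) w(3) by simp
      then have "(c h \<otimes> inv (c y1)) \<otimes> (c y1 \<otimes> inv (c y)) \<in> word_ball G ?Y (k * card (bad \<inter> set (y1 # ys)) + k)"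
        by (rule word_ball_mult[OF Y IH])
      then show ?thesis unfolding eq card by (simp add: add.commute)
    qed
  qed
  obtain ys where ys: "rtrancl_path (fiber_step G X' c') z ys g" "distinct (z # ys)"
    using schreierD(2)[OF sch' gz(2,1,3)] rtrancl_path_distinct unfolding rtranclp_eq_rtrancl_path by metis
  have "card (bad \<inter> set (z # ys)) \<le> card bad" using bad by (intro card_mono) auto
  also have "\<dots> \<le> card W * (2 * card ?Y)" using bad(2) E(2) by (meson le_trans mult_le_mono2)
  finally have "k * card (bad \<inter> set (z # ys)) \<le> oscillation (card X) (card ?Y) k"
    unfolding oscillation_def W(2) by (rule mult_le_mono2)
  then show ?thesis
    using path[OF ys(1) gz(2,3) ys(2)] word_ball_mono by blast
qed

text \<open>Right multiplication by \<open>inv (c' g)\<close> moves \<open>g\<close> into the fiber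
  of \<open>c'\<close> that contains \<open>z\<close>, where \<open>fiber_oscillation\<close>
  compares it with \<open>z\<close>.\<close>

corollary schreier_ratio:
  assumes basis: "free_basis G X" and finX: "finite X" and A: "subgroup A G" and sch: "schreier G A X c"
    and fin: "finite (schreier_gens G X c)"
    and sch': "schreier G A X' c'" and X': "X' \<subseteq> word_ball G X k"
    and z: "z \<in> carrier G" "c z = \<one>" "c' z = \<one>" and g: "g \<in> carrier G"
  shows "c' g \<otimes> inv (c g) \<in> word_ball G (schreier_gens G X c)
    (oscillation (card X) (card (schreier_gens G X c)) k)"
proof -
  let ?Y = "schreier_gens G X c"
  note X = free_basisD(1)[OF basis]
  note c = schreierD(1)[OF sch] and c' = schreierD(1)[OF sch']
  note Ac = subgroup.mem_carrier[OF A] subgroup.m_inv_closed[OF A]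
  have Y: "?Y \<subseteq> carrier G" using schreier_gens_subset[OF A X c] subgroup.subset[OF A] by blast
  have cg: "c g \<in> carrier G" "c' g \<in> A" "c' g \<in> carrier G"
    using coset_retractionD(1)[OF c g] coset_retractionD(1)[OF c' g] Ac by auto
  have "c' (g \<otimes> inv (c' g)) = \<one>" "c (g \<otimes> inv (c' g)) = c g \<otimes> inv (c' g)"
    using coset_retractionD(2)[OF c g] coset_retractionD(2)[OF c' g] cg Ac by auto
  then have "c g \<otimes> inv (c' g) \<in> word_ball G ?Y (oscillation (card X) (card ?Y) k)"
    using fiber_oscillation[OF basis finX A sch fin sch' X', of "g \<otimes> inv (c' g)" z] z g cg by simp
  then have "inv (c g \<otimes> inv (c' g)) \<in> word_ball G ?Y (oscillation (card X) (card ?Y) k)"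
    by (rule word_ball_inv[OF Y])
  then show ?thesis using cg by (simp add: inv_mult_group)
qed

text \<open>The \<open>s i\<close> lie in pairwise different left cosets of \<open>A\<close>, while
  the crossing points meet only finitely many. So a given letter changes \<open>c\<close> at
  finitely many \<open>s i\<close> only, and \<open>g\<close> is a finite product of
  letters.\<close>

lemma eventually_translate:
  assumes basis: "free_basis G X" and A: "subgroup A G" and sch: "schreier G A X c"
    and fin: "finite (schreier_gens G X c)"
    and s: "\<And>i. s i \<in> carrier G" and sep: "\<And>i j. i < j \<Longrightarrow> inv (s i) \<otimes> s j \<notin> A" and g: "g \<in> carrier G"
  shows "\<forall>\<^sub>F i in sequentially. c (g \<otimes> s i) = c (s i)"
proof -
  note X = free_basisD(1)[OF basis]
  note c = schreierD(1)[OF sch]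
  note Ac = subgroup.mem_carrier[OF A] subgroup.m_closed[OF A] subgroup.m_inv_closed[OF A]
  define E where "E = {g \<in> carrier G. c g = \<one> \<and> (\<exists>s. fst s \<in> X \<and> c (letter_value G s \<otimes> g) \<noteq> \<one>)}"
  have E: "finite E" using crossing_points_finite(1)[OF basis A sch fin] by (simp add: E_def)
  have letter: "\<forall>\<^sub>F i in sequentially. c (letter_value G u \<otimes> s i) = c (s i)"
    if u: "fst u \<in> X" and s: "\<And>i. s i \<in> carrier G" and sep: "\<And>i j. i < j \<Longrightarrow> inv (s i) \<otimes> s j \<notin> A"
    for u and s :: "nat \<Rightarrow> 'a"
  proof -
    define p where "p i = s i \<otimes> inv (c (s i))" for i
    have cs: "c (s i) \<in> A" "c (s i) \<in> carrier G" for i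
      using coset_retractionD(1)[OF c s] Ac by auto
    let ?I = "{i. c (letter_value G u \<otimes> s i) \<noteq> c (s i)}"
    have lc: "letter_value G u \<in> carrier G" using letter_closed[OF X u] .
    have "p i \<in> E" if "i \<in> ?I" for i
    proof -
      have ls: "letter_value G u \<otimes> s i \<in> carrier G" using lc s by simp
      have "c (letter_value G u \<otimes> p i) = c (letter_value G u \<otimes> s i) \<otimes> inv (c (s i))"
        using coset_retractionD(2)[OF c ls, of "inv (c (s i))"] cs Ac s lc by (simp add: p_def m_assoc)
      then have "c (letter_value G u \<otimes> p i) \<noteq> \<one>"
        using that cs[of i] coset_retractionD(1)[OF c ls] Ac inv_equality[of "c (letter_value G u \<otimes> s i)" "inv (c (s i))"]
        by auto
      moreover have "c (p i) = \<one>" "p i \<in> carrier G"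
        using coset_retractionD(2)[OF c s, of "inv (c (s i))" i] cs[of i] s Ac by (auto simp: p_def)
      ultimately show ?thesis using u unfolding E_def by blast
    qed
    moreover have "inj p"
    proof (rule linorder_inj_onI)
      fix i j :: nat assume "i < j"
      show "p i \<noteq> p j"
      proof
        assume "p i = p j"
        then have eq: "s i \<otimes> inv (c (s i)) \<otimes> c (s j) = s j \<otimes> inv (c (s j)) \<otimes> c (s j)"
          by (simp add: p_def)
        define d where "d = inv (c (s i)) \<otimes> c (s j)"
        have d: "d \<in> A" "d \<in> carrier G" using cs Ac by (auto simp: d_def)
        have "s i \<otimes> d = s j"
          using eq s cs by (simp add: d_def m_assoc)
        then have "inv (s i) \<otimes> s j = d"
          using inv_cancel(1)[OF s d(2), of i] by simp
        with d show False using sep[OF \<open>i < j\<close>] by simp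
      qed
    qed auto
    ultimately have "finite ?I"
      using finite_imageD[of p ?I] E finite_subset[of "p ` ?I" E] by (auto intro: inj_on_subset)
    then show ?thesis by (simp add: eventually_cofinite flip: cofinite_eq_sequentially)
  qed
  obtain w where w: "w \<in> words X" "g = word_value G w"
    using g free_basis_generate[OF basis] generate_eq_words[OF X] by auto
  have "\<forall>\<^sub>F i in sequentially. c (word_value G w \<otimes> s i) = c (s i)"
    using w(1)
  proof (induction w)
    case (Cons u w)
    then have u: "fst u \<in> X" "w \<in> words X" by auto
    have cl: "letter_value G u \<in> carrier G" "word_value G w \<in> carrier G"
      using letter_closed[OF X u(1)] word_value_closed[OF X u(2)] by auto
    have "\<forall>\<^sub>F i in sequentially. c (letter_value G u \<otimes> (word_value G w \<otimes> s i)) = c (word_value G w \<otimes> s i)"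
    proof (rule letter[OF u(1)])
      fix i j :: nat assume "i < j"
      then show "inv (word_value G w \<otimes> s i) \<otimes> (word_value G w \<otimes> s j) \<notin> A"
        using sep[of i j] s cl by (simp add: inv_mult_group m_assoc inv_cancel)
    qed (use s cl in auto)
    with Cons.IH[OF u(2)] show ?case
      by eventually_elim (use s cl in \<open>simp add: m_assoc\<close>)
  qed (use s in simp)
  then show ?thesis using w by simp
qed

lemma eventually_const:
  assumes basis: "free_basis G X" and A: "subgroup A G" and sch: "schreier G A X c"
    and fin: "finite (schreier_gens G X c)"
    and s: "\<And>i. s i \<in> carrier G" and sep: "\<And>i j. i < j \<Longrightarrow> inv (s i) \<otimes> s j \<notin> A"
    and a: "a \<in> carrier G" "\<And>i. s (Suc i) = a \<otimes> s i"
  obtains v where "v \<in> A" "\<forall>\<^sub>F i in sequentially. c (s i) = v"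
proof -
  obtain N where N: "\<And>i. N \<le> i \<Longrightarrow> c (s (Suc i)) = c (s i)"
    using eventually_translate[where s = s, OF basis A sch fin s sep a(1)]
    unfolding eventually_sequentially a(2)[symmetric] by blast
  have "c (s i) = c (s N)" if "N \<le> i" for i
    using that by (induction rule: dec_induct) (auto simp: N)
  then have "\<forall>\<^sub>F i in sequentially. c (s i) = c (s N)" by (rule eventually_sequentiallyI)
  then show ?thesis by (rule that[OF coset_retractionD(1)[OF schreierD(1)[OF sch] s[of N]]])
qed

section \<open>Schreier maps under left factors, conjugation and automorphisms\<close>

lemma schreier_left_mult:
  assumes A: "subgroup A G" and sch: "schreier G A X c" and u: "u \<in> A"
  shows "schreier G A X (\<lambda>g. u \<otimes> c g)"
proof -
  note c = schreierD(1)[OF sch]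
  note Ac = subgroup.mem_carrier[OF A] subgroup.m_closed[OF A]
  have cr: "coset_retraction G A (\<lambda>g. u \<otimes> c g)"
    unfolding coset_retraction_def using coset_retractionD[OF c] u Ac by (auto simp: m_assoc)
  have "fiber_step G X c g h \<Longrightarrow> fiber_step G X (\<lambda>g. u \<otimes> c g) g h" for g h
    by (auto simp: fiber_step_def)
  then have step: "(fiber_step G X c)\<^sup>*\<^sup>* g h \<Longrightarrow> (fiber_step G X (\<lambda>g. u \<otimes> c g))\<^sup>*\<^sup>* g h" for g h
    using mono_rtranclp[of "fiber_step G X c" "fiber_step G X (\<lambda>g. u \<otimes> c g)"] by blast
  show ?thesis
    unfolding schreier_def
  proof (intro conjI cr ballI impI)
    fix g h assume gh: "g \<in> carrier G" "h \<in> carrier G" "u \<otimes> c g = u \<otimes> c h"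
    then have "c g = c h" using coset_retractionD(1)[OF c] u Ac by simp
    then show "(fiber_step G X (\<lambda>g. u \<otimes> c g))\<^sup>*\<^sup>* g h" using step schreierD(2)[OF sch gh(1,2)] by blast
  qed
qed

text \<open>Left translation by \<open>w\<close> is an isomorphism from the Cayley graph of
  \<open>X\<close> to that of the conjugated basis, and it commutes with the right action of
  \<open>A\<close>; therefore the generators are not even conjugated.\<close>

lemma schreier_conjugate:
  assumes X: "X \<subseteq> carrier G" and sch: "schreier G A X c" and A: "A \<subseteq> carrier G" and w: "w \<in> carrier G"
  shows "schreier G A ((\<lambda>x. w \<otimes> x \<otimes> inv w) ` X) (\<lambda>g. c (inv w \<otimes> g))"
    and "schreier_gens G ((\<lambda>x. w \<otimes> x \<otimes> inv w) ` X) (\<lambda>g. c (inv w \<otimes> g)) = schreier_gens G X c"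
proof -
  note c = schreierD(1)[OF sch]
  let ?X = "(\<lambda>x. w \<otimes> x \<otimes> inv w) ` X" and ?c = "\<lambda>g. c (inv w \<otimes> g)"
  have cr: "coset_retraction G A ?c"
    unfolding coset_retraction_def using coset_retractionD[OF c] w A by (auto simp: m_assoc[symmetric] subset_iff)
  have step: "fiber_step G ?X ?c (w \<otimes> g) (w \<otimes> h)" if gh: "fiber_step G X c g h" for g h
  proof -
    obtain s where s: "fst s \<in> X" "h = letter_value G s \<otimes> g" "g \<in> carrier G" "c h = c g"
      using gh by (auto simp: fiber_step_def)
    have cl: "letter_value G s \<in> carrier G" "fst s \<in> carrier G" using letter_closed[OF X s(1)] X s(1) by auto
    have "letter_value G (w \<otimes> fst s \<otimes> inv w, snd s) = w \<otimes> letter_value G s \<otimes> inv w"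
      using cl w by (simp add: letter_value_def inv_mult_group m_assoc)
    then have "w \<otimes> h = letter_value G (w \<otimes> fst s \<otimes> inv w, snd s) \<otimes> (w \<otimes> g)"
      using s cl w by (simp add: m_assoc inv_cancel)
    moreover have "w \<otimes> fst s \<otimes> inv w \<in> ?X" using s(1) by blast
    moreover have "c (inv w \<otimes> (w \<otimes> h)) = c (inv w \<otimes> (w \<otimes> g))" using s cl w by (simp add: inv_cancel)
    moreover have "w \<otimes> g \<in> carrier G" using s w by simp
    ultimately show ?thesis
      unfolding fiber_step_def by (metis fst_conv)
  qed
  have steps: "(fiber_step G ?X ?c)\<^sup>*\<^sup>* (w \<otimes> g) (w \<otimes> h)" if "(fiber_step G X c)\<^sup>*\<^sup>* g h" for g h
    using that by (induction rule: rtranclp_induct) (auto intro: step rtranclp.rtrancl_into_rtrancl)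
  show "schreier G A ?X ?c"
    unfolding schreier_def
  proof (intro conjI cr ballI impI)
    fix g h assume gh: "g \<in> carrier G" "h \<in> carrier G" "c (inv w \<otimes> g) = c (inv w \<otimes> h)"
    then show "(fiber_step G ?X ?c)\<^sup>*\<^sup>* g h"
      using steps[OF schreierD(2)[OF sch, of "inv w \<otimes> g" "inv w \<otimes> h"]] w by (simp add: inv_cancel)
  qed
  have "(\<exists>x g. x \<in> ?X \<and> g \<in> carrier G \<and> y = c (inv w \<otimes> (x \<otimes> g)) \<otimes> inv (c (inv w \<otimes> g))) \<longleftrightarrow>
      (\<exists>x g. x \<in> X \<and> g \<in> carrier G \<and> y = c (x \<otimes> g) \<otimes> inv (c g))" (is "?L \<longleftrightarrow> ?R") for y
  proof
    assume ?L
    then obtain x g where x: "x \<in> X" "g \<in> carrier G" "x \<in> carrier G"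
      and y: "y = c (inv w \<otimes> (w \<otimes> x \<otimes> inv w \<otimes> g)) \<otimes> inv (c (inv w \<otimes> g))"
      using X by auto
    have "y = c (x \<otimes> (inv w \<otimes> g)) \<otimes> inv (c (inv w \<otimes> g))"
      using y x w by (simp add: m_assoc inv_cancel)
    then show ?R using x w by blast
  next
    assume ?R
    then obtain x g where x: "x \<in> X" "g \<in> carrier G" "x \<in> carrier G" and y: "y = c (x \<otimes> g) \<otimes> inv (c g)"
      using X by auto
    have "y = c (inv w \<otimes> ((w \<otimes> x \<otimes> inv w) \<otimes> (w \<otimes> g))) \<otimes> inv (c (inv w \<otimes> (w \<otimes> g)))"
      using y x w by (simp add: m_assoc inv_cancel)
    then show ?L using x w by blast
  qed
  then show "schreier_gens G ?X ?c = schreier_gens G X c"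
    unfolding schreier_gens_def by blast
qed

lemma schreier_transport:
  assumes X: "X \<subseteq> carrier G" and sch: "schreier G A X c" and A: "A \<subseteq> carrier G"
    and h: "h \<in> auto G" "h ` A = A"
    and h': "\<And>g. g \<in> carrier G \<Longrightarrow> h' g \<in> carrier G \<and> h (h' g) = g \<and> h' (h g) = g" "h' \<in> hom G G"
  shows "schreier G A (h ` X) (\<lambda>g. h (c (h' g)))"
    and "schreier_gens G (h ` X) (\<lambda>g. h (c (h' g))) = h ` schreier_gens G X c"
proof -
  note c = schreierD(1)[OF sch]
  let ?c = "\<lambda>g. h (c (h' g))"
  note hm = auto_mult[OF h(1)] and hc = auto_closed[OF h(1)] and hi = auto_inv[OF h(1)]
  have h'm: "h' (g \<otimes> k) = h' g \<otimes> h' k" if "g \<in> carrier G" "k \<in> carrier G" for g k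
    using h'(2) that by (simp add: hom_mult)
  have cc: "c g \<in> A" "c g \<in> carrier G" if "g \<in> carrier G" for g
    using coset_retractionD(1)[OF c that] A by auto
  have h'A: "h' a \<in> A" if a: "a \<in> A" for a
  proof -
    obtain b where b: "b \<in> A" "a = h b" using a h(2) by blast
    then have "h' a = b" using h'(1)[of b] A by blast
    then show ?thesis using b by simp
  qed
  have cr: "coset_retraction G A ?c"
    unfolding coset_retraction_def
  proof (intro conjI ballI)
    show "?c \<in> carrier G \<rightarrow> A" using cc h'(1) h(2) by blast
    fix g a assume "g \<in> carrier G" "a \<in> A"
    then show "h (c (h' (g \<otimes> a))) = h (c (h' g)) \<otimes> a"
      using A h'(1)[of a] h'(1)[of g] h'A[of a] coset_retractionD(2)[OF c, of "h' g" "h' a"] cc[of "h' g"]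
      by (auto simp: h'm hm subset_iff)
  qed
  have hl: "letter_value G (h (fst s), snd s) = h (letter_value G s)" if "fst s \<in> X" for s
    using that X hi by (auto simp: letter_value_def)
  have step: "fiber_step G (h ` X) ?c (h g) (h k)" if gk: "fiber_step G X c g k" for g k
  proof -
    obtain s where s: "fst s \<in> X" "k = letter_value G s \<otimes> g" "g \<in> carrier G" "c k = c g"
      using gk by (auto simp: fiber_step_def)
    have cl: "letter_value G s \<in> carrier G" "k \<in> carrier G" using letter_closed[OF X s(1)] s by auto
    have "h k = letter_value G (h (fst s), snd s) \<otimes> h g" using cl s by (simp add: hl hm)
    moreover have "h (c (h' (h k))) = h (c (h' (h g)))"
      using h'(1)[OF s(3)] h'(1)[OF cl(2)] s(4) by simp
    moreover have "h (fst s) \<in> h ` X" "h g \<in> carrier G" using s hc by auto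
    ultimately show ?thesis
      unfolding fiber_step_def by (metis fst_conv)
  qed
  have steps: "(fiber_step G (h ` X) ?c)\<^sup>*\<^sup>* (h g) (h k)" if "(fiber_step G X c)\<^sup>*\<^sup>* g k" for g k
    using that by (induction rule: rtranclp_induct) (auto intro: step rtranclp.rtrancl_into_rtrancl)
  show "schreier G A (h ` X) ?c"
    unfolding schreier_def
  proof (intro conjI cr ballI impI)
    fix g k assume gk: "g \<in> carrier G" "k \<in> carrier G" "h (c (h' g)) = h (c (h' k))"
    have cl: "h' g \<in> carrier G" "h' k \<in> carrier G" using gk h'(1) by blast+
    have "h' (h (c (h' g))) = h' (h (c (h' k)))" by (simp only: gk(3))
    then have "c (h' g) = c (h' k)"
      using h'(1)[OF cc(2)[OF cl(1)]] h'(1)[OF cc(2)[OF cl(2)]] by simp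
    then have "(fiber_step G (h ` X) ?c)\<^sup>*\<^sup>* (h (h' g)) (h (h' k))"
      by (intro steps schreierD(2)[OF sch] cl)
    then show "(fiber_step G (h ` X) ?c)\<^sup>*\<^sup>* g k"
      using h'(1)[OF gk(1)] h'(1)[OF gk(2)] by simp
  qed
  have val: "h (c (h' (h x \<otimes> g))) \<otimes> inv (h (c (h' g))) = h (c (x \<otimes> h' g) \<otimes> inv (c (h' g)))"
    if "x \<in> X" "g \<in> carrier G" for x g
  proof -
    have x: "x \<in> carrier G" using that X by blast
    have cl: "h x \<in> carrier G" "h' g \<in> carrier G" "h' (h x) = x" using h'(1)[OF that(2)] h'(1)[OF x] hc[OF x] by auto
    have "h' (h x \<otimes> g) = x \<otimes> h' g" using h'm[OF cl(1) that(2)] cl(3) by simp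
    then show ?thesis
      using cc(2)[OF cl(2)] cc(2)[of "x \<otimes> h' g"] x cl by (simp add: hm hi)
  qed
  have one: "h u = \<one> \<longleftrightarrow> u = \<one>" if "u \<in> carrier G" for u
  proof -
    have "h \<one> = \<one>" "h' \<one> = \<one>" using hom_one[OF auto_hom[OF h(1)]] hom_one[OF h'(2)] is_group by auto
    then show ?thesis using h'(1)[OF that] by metis
  qed
  show "schreier_gens G (h ` X) ?c = h ` schreier_gens G X c"
  proof (intro equalityI subsetI)
    fix y assume "y \<in> schreier_gens G (h ` X) ?c"
    then obtain x g where x: "x \<in> X" "g \<in> carrier G" "y = h (c (h' (h x \<otimes> g))) \<otimes> inv (h (c (h' g)))" "y \<noteq> \<one>"
      unfolding schreier_gens_def by blast
    define u where "u = c (x \<otimes> h' g) \<otimes> inv (c (h' g))"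
    have "u \<in> carrier G" using x X h'(1)[of g] cc[of "x \<otimes> h' g"] cc[of "h' g"] by (auto simp: u_def)
    moreover have yu: "y = h u" using x(3) val[OF x(1,2)] by (simp add: u_def)
    ultimately have "u \<noteq> \<one>" using one x(4) by auto
    then have "u \<in> schreier_gens G X c"
      using x(1) h'(1)[OF x(2)] unfolding schreier_gens_def u_def by blast
    with yu show "y \<in> h ` schreier_gens G X c" by blast
  next
    fix y assume "y \<in> h ` schreier_gens G X c"
    then obtain x g where x: "x \<in> X" "g \<in> carrier G" "y = h (c (x \<otimes> g) \<otimes> inv (c g))" "c (x \<otimes> g) \<otimes> inv (c g) \<noteq> \<one>"
      unfolding schreier_gens_def by blast
    have "y = h (c (h' (h x \<otimes> h g))) \<otimes> inv (h (c (h' (h g))))"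
      using val[OF x(1) hc[OF x(2)]] x(3) h'(1)[OF x(2)] by simp
    moreover have "y \<noteq> \<one>" using x X one[of "c (x \<otimes> g) \<otimes> inv (c g)"] cc[of "x \<otimes> g"] cc[of g] by auto
    ultimately show "y \<in> schreier_gens G (h ` X) ?c"
      using x hc[OF x(2)] unfolding schreier_gens_def by blast
  qed
qed

end

section \<open>Markings\<close>

text \<open>\<open>X0\<close> may exceed \<open>Y\<close> by more than \<open>t\<close>: in corank
  one it does not, but the cyclic case takes a single element for \<open>Y\<close> inside a possibly
  larger basis. The element \<open>a\<close> gives the direction of the rays.\<close>

locale based_free_group = group G for G :: "('a, 'b) monoid_scheme" (structure) +
  fixes X0 Y :: "'a set" and t a :: 'a
  assumes basis0: "free_basis G X0" and fin0: "finite X0"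
    and YX: "Y \<subseteq> X0" and tX: "t \<in> X0" "t \<notin> Y" and aY: "a \<in> Y"
begin

definition A :: "'a set" where "A = generate G Y"

definition ray :: "bool \<Rightarrow> nat \<Rightarrow> 'a" where
  "ray e i = a [^] i \<otimes> letter_value G (t, e)"

text \<open>The rays \<open>ray e\<close> leave the minimal subtree of \<open>A\<close> in every Cayley tree of \<open>G\<close>, so \<open>c\<close> is
  eventually constant on them. One of the two limits normalizes \<open>c\<close>, the other one is the
  invariant that is recorded.\<close>

definition marking :: "'a set \<Rightarrow> ('a \<Rightarrow> 'a) \<Rightarrow> 'a \<Rightarrow> bool" where
  "marking X c b \<longleftrightarrow> schreier G A X c \<and> (\<forall>\<^sub>F i in sequentially. c (ray True i) = \<one>) \<and>
     (\<forall>\<^sub>F i in sequentially. c (ray False i) = b)"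

lemma X0c: "X0 \<subseteq> carrier G" and Yc: "Y \<subseteq> carrier G" and tc: "t \<in> carrier G" and ac: "a \<in> carrier G"
  using free_basisD(1)[OF basis0] YX tX aY by auto

lemma A_subgroup: "subgroup A G"
  unfolding A_def by (rule generate_is_subgroup[OF Yc])

lemma Ac: "x \<in> A \<Longrightarrow> x \<in> carrier G" "x \<in> A \<Longrightarrow> y \<in> A \<Longrightarrow> x \<otimes> y \<in> A" "x \<in> A \<Longrightarrow> inv x \<in> A" "\<one> \<in> A"
  using A_subgroup by (auto simp: subgroup.mem_carrier subgroup.m_closed subgroup.m_inv_closed subgroup.one_closed)

lemma YA: "Y \<subseteq> A"
  by (auto simp: A_def intro: generate.incl)

lemma aA: "a \<in> A" "a [^] (i :: nat) \<in> A"
proof -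
  show "a \<in> A" using aY YA by auto
  then show "a [^] i \<in> A" by (induction i) (auto simp: Ac)
qed

lemma tl: "letter_value G (t, e) \<in> carrier G"
  using tc by (auto simp: letter_value_def)

lemma inv_tl: "inv (letter_value G (t, e)) = letter_value G (t, \<not> e)"
  using tc by (auto simp: letter_value_def)

lemma A_word: "x \<in> A \<Longrightarrow> \<exists>v\<in>reduced_words Y. x = word_value G v"
  unfolding A_def generate_eq_reduced_words[OF Yc] by blast

lemma word_value_inj:
  "v \<in> reduced_words X0 \<Longrightarrow> w \<in> reduced_words X0 \<Longrightarrow> word_value G v = word_value G w \<Longrightarrow> v = w"
  using free_basisD(2)[OF basis0] by (auto dest: inj_onD)

lemma red_YX: "v \<in> reduced_words Y \<Longrightarrow> v \<in> reduced_words X0"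
  using reduced_words_mono[OF YX] by blast

lemma A_basis: "free_basis (G\<lparr>carrier := A\<rparr>) Y"
proof -
  have eq: "word_value (G\<lparr>carrier := A\<rparr>) w = word_value G w" if "w \<in> reduced_words Y" for w
    using word_value_sub[OF A_subgroup YA] that reduced_words_subset[of Y] by blast
  have "bij_betw (word_value G) (reduced_words Y) A"
    unfolding bij_betw_def A_def generate_eq_reduced_words[OF Yc]
    by (auto intro!: inj_onI word_value_inj red_YX)
  then have "bij_betw (word_value (G\<lparr>carrier := A\<rparr>)) (reduced_words Y) A"
    using eq by (subst bij_betw_cong[of _ _ "word_value G"]) auto
  then show ?thesis using YA by (simp add: free_basis_def)
qed

lemma finY: "finite Y"
  using fin0 YX finite_subset by blast

lemma gens:
  assumes "free_basis G X" "schreier G A X c"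
  shows "finite (schreier_gens G X c)" "card (schreier_gens G X c) = card Y"
proof -
  interpret A: group "G\<lparr>carrier := A\<rparr>" by (rule sub_group[OF A_subgroup])
  show "finite (schreier_gens G X c)" "card (schreier_gens G X c) = card Y"
    using A.free_basis_card[OF A_basis finY nielsen_schreier(1)[OF assms(1) A_subgroup assms(2)]] by auto
qed

lemma pow_ne_one: "0 < k \<Longrightarrow> a [^] (k :: nat) \<noteq> \<one>"
proof
  assume k: "0 < k" "a [^] k = \<one>"
  have "word_value G (replicate k (a, True)) = a [^] k" for k
  proof (induction k)
    case (Suc k)
    then show ?case using ac by (simp add: letter_value_def nat_pow_comm[of a 1 k, simplified])
  qed simp
  then have "word_value G (replicate k (a, True)) = word_value G []" using k by simp
  moreover have "replicate k (a, True) \<in> reduced_words X0" for k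
    by (induction k) (use aY YX in \<open>auto simp: reduced_words_Cons hd_replicate\<close>)
  ultimately have "replicate k (a, True) = []" by (intro word_value_inj) simp_all
  then show False using k by simp
qed

lemma t_not_A: "letter_value G (t, e) \<notin> A"
proof
  assume "letter_value G (t, e) \<in> A"
  then obtain v where v: "v \<in> reduced_words Y" "letter_value G (t, e) = word_value G v" using A_word by blast
  have "[(t, e)] = v"
    using v tX tl[of e] by (intro word_value_inj[OF _ red_YX[OF v(1)]]) (auto simp: reduced_words_Cons)
  then show False using v(1) tX by (auto simp: reduced_words_Cons)
qed

text \<open>A nonempty word in \<open>Y\<close> cannot cancel against the letters \<open>t\<close>
  around it. This is the fragment of malnormality of \<open>A\<close> that puts the points of a ray
  into different cosets.\<close>

lemma malnormal:
  assumes b: "b \<in> A" "b \<noteq> \<one>"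
  shows "letter_value G (t, \<not> e) \<otimes> b \<otimes> letter_value G (t, e) \<notin> A"
proof
  assume "letter_value G (t, \<not> e) \<otimes> b \<otimes> letter_value G (t, e) \<in> A"
  then obtain v where v: "v \<in> reduced_words Y" "letter_value G (t, \<not> e) \<otimes> b \<otimes> letter_value G (t, e) = word_value G v"
    using A_word by blast
  obtain u where u: "u \<in> reduced_words Y" "b = word_value G u" using A_word[OF b(1)] by blast
  have ne: "u \<noteq> []" using b u by auto
  have uw: "u \<in> words X0" "[(t, e)] \<in> words X0" using red_YX[OF u(1)] reduced_words_subset[of X0] tX by auto
  have hd: "fst (hd u) \<in> Y" "fst (last u) \<in> Y"
    using hd_in_set[OF ne] last_in_set[OF ne] subsetD[OF reduced_words_subset u(1)] by (auto simp: words_iff)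
  have "(t, \<not> e) # u @ [(t, e)] \<in> reduced_words X0"
    using red_YX[OF u(1)] ne hd tX by (auto simp: reduced_words_Cons reduced_words_append inv_letter_def)
  moreover have "word_value G ((t, \<not> e) # u @ [(t, e)]) = word_value G v"
    using v(2) u(2) word_value_append[OF X0c uw] tl b(1) Ac by (simp add: m_assoc)
  ultimately have "(t, \<not> e) # u @ [(t, e)] = v" using red_YX[OF v(1)] word_value_inj by blast
  then show False using v(1) tX by (auto simp: reduced_words_Cons)
qed

lemma ray_closed: "ray e i \<in> carrier G"
  using tl aA Ac by (simp add: ray_def)

lemma ray_Suc: "ray e (Suc i) = a \<otimes> ray e i"
  using ac tl nat_pow_comm[of a 1 i] by (simp add: ray_def m_assoc[symmetric])

text \<open>The freedom in \<open>b\<close> and \<open>u\<close> serves the images of rays under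
  automorphisms that preserve \<open>A\<close>, where \<open>a\<close> becomes another element of
  \<open>A\<close> and \<open>t\<close> acquires a left factor.\<close>

lemma twisted_ray_sep:
  assumes u: "u \<in> A" and b: "b \<in> A" "\<And>k::nat. 0 < k \<Longrightarrow> b [^] k \<noteq> \<one>" and ij: "i < j"
  shows "inv (b [^] i \<otimes> (u \<otimes> letter_value G (t, e))) \<otimes> (b [^] (j :: nat) \<otimes> (u \<otimes> letter_value G (t, e))) \<notin> A"
proof -
  have bk: "b [^] k \<in> A" for k :: nat using b(1) by (induction k) (auto simp: Ac)
  have "b [^] j = b [^] i \<otimes> b [^] (j - i)" using ij b(1) Ac by (simp add: nat_pow_mult)
  then have eq: "inv (b [^] i \<otimes> (u \<otimes> letter_value G (t, e))) \<otimes> (b [^] j \<otimes> (u \<otimes> letter_value G (t, e)))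
      = letter_value G (t, \<not> e) \<otimes> (inv u \<otimes> b [^] (j - i) \<otimes> u) \<otimes> letter_value G (t, e)"
    using tl u bk[of i] bk[of "j - i"] Ac by (simp add: inv_mult_group m_assoc inv_cancel inv_tl)
  have "inv u \<otimes> b [^] (j - i) \<otimes> u \<noteq> \<one>"
  proof
    assume "inv u \<otimes> b [^] (j - i) \<otimes> u = \<one>"
    then have "u \<otimes> (inv u \<otimes> b [^] (j - i) \<otimes> u) \<otimes> inv u = u \<otimes> \<one> \<otimes> inv u" by simp
    then have "b [^] (j - i) = \<one>" using u bk[of "j - i"] Ac by (simp add: m_assoc inv_cancel)
    then show False using b(2)[of "j - i"] ij by simp
  qed
  then show ?thesis unfolding eq using u bk Ac by (intro malnormal) auto
qed

lemma ray_sep: "i < j \<Longrightarrow> inv (ray e i) \<otimes> ray e j \<notin> A"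
  using twisted_ray_sep[OF Ac(4) aA(1) pow_ne_one, of i j e] tl by (simp add: ray_def)

lemma marking_exists:
  assumes "free_basis G X" "finite X"
  shows "\<exists>c b. marking X c b \<and> b \<in> A"
proof -
  obtain c where c: "schreier G A X c"
    using schreier_exists[OF A_subgroup free_basisD(1)[OF assms(1)] assms(2) free_basis_generate[OF assms(1)]] by blast
  have ev: thesis if "\<And>v. v \<in> A \<Longrightarrow> \<forall>\<^sub>F i in sequentially. c (ray e i) = v \<Longrightarrow> thesis" for e thesis
    by (rule eventually_const[where s = "ray e", OF assms(1) A_subgroup c gens(1)[OF assms(1) c]])
       (use ray_closed ray_sep ac ray_Suc that in auto)
  obtain u where u: "u \<in> A" "\<forall>\<^sub>F i in sequentially. c (ray True i) = u" by (rule ev)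
  obtain v where v: "v \<in> A" "\<forall>\<^sub>F i in sequentially. c (ray False i) = v" by (rule ev)
  have "marking X (\<lambda>g. inv u \<otimes> c g) (inv u \<otimes> v)"
    unfolding marking_def
  proof (intro conjI)
    show "schreier G A X (\<lambda>g. inv u \<otimes> c g)" using u(1) Ac by (intro schreier_left_mult[OF A_subgroup c]) auto
    show "\<forall>\<^sub>F i in sequentially. inv u \<otimes> c (ray True i) = \<one>"
      using u(2) by eventually_elim (use u Ac in simp)
    show "\<forall>\<^sub>F i in sequentially. inv u \<otimes> c (ray False i) = inv u \<otimes> v"
      using v(2) by eventually_elim simp
  qed
  then show ?thesis using u v Ac by blast
qed

lemma marking_b:
  assumes "marking X c b"
  shows "b \<in> A"
proof -
  have "\<forall>\<^sub>F i in sequentially. c (ray False i) = b" using assms by (simp add: marking_def)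
  then obtain i where "c (ray False i) = b" by (auto simp: eventually_sequentially)
  moreover have "c (ray False i) \<in> A"
    using assms coset_retractionD(1)[OF schreierD(1) ray_closed] by (auto simp: marking_def)
  ultimately show ?thesis by simp
qed

text \<open>The translated map has the same limits, since \<open>inv w\<close> displaces the points
  of a ray by a bounded distance. So the invariants of a basis belong to its conjugacy
  class.\<close>

lemma marking_conjugate:
  assumes X: "free_basis G X" and m: "marking X c b" and w: "w \<in> carrier G"
  shows "marking ((\<lambda>x. w \<otimes> x \<otimes> inv w) ` X) (\<lambda>g. c (inv w \<otimes> g)) b"
proof -
  have c: "schreier G A X c" using m by (simp add: marking_def)
  have ev: "\<forall>\<^sub>F i in sequentially. c (inv w \<otimes> ray e i) = c (ray e i)" for e
    using w by (intro eventually_translate[OF X A_subgroup c gens(1)[OF X c] ray_closed ray_sep]) auto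
  show ?thesis
    unfolding marking_def
  proof (intro conjI)
    show "schreier G A ((\<lambda>x. w \<otimes> x \<otimes> inv w) ` X) (\<lambda>g. c (inv w \<otimes> g))"
      using Ac by (intro schreier_conjugate(1)[OF free_basisD(1)[OF X] c _ w]) auto
    have "\<forall>\<^sub>F i in sequentially. c (ray True i) = \<one>" "\<forall>\<^sub>F i in sequentially. c (ray False i) = b"
      using m by (auto simp: marking_def)
    then show "\<forall>\<^sub>F i in sequentially. c (inv w \<otimes> ray True i) = \<one>" "\<forall>\<^sub>F i in sequentially. c (inv w \<otimes> ray False i) = b"
      using ev[of True] ev[of False] by (eventually_elim, simp)+
  qed
qed

text \<open>Far out on the first ray both maps are trivial, which provides the common base point for
  \<open>schreier_ratio\<close>; on the second ray the ratio is \<open>b' \<otimes> inv b\<close>. A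
  generator for \<open>X'\<close> is compared with \<open>c\<close> at both ends of its edge, at
  cost \<open>R\<close> each, and \<open>c\<close> itself changes by at most \<open>k\<close> along
  the edge.\<close>

theorem marking_close:
  assumes X: "free_basis G X" "finite X" and m: "marking X c b" and m': "marking X' c' b'"
    and ball: "X' \<subseteq> word_ball G X k"
  defines "R \<equiv> oscillation (card X) (card Y) k"
  shows "b' \<otimes> inv b \<in> word_ball G (schreier_gens G X c) R"
    and "schreier_gens G X' c' \<subseteq> word_ball G (schreier_gens G X c) (R + k + R)"
proof -
  let ?Y = "schreier_gens G X c"
  have c: "schreier G A X c" and c': "schreier G A X' c'" using m m' by (auto simp: marking_def)
  note Xc = free_basisD(1)[OF X(1)]
  have Yc': "?Y \<subseteq> carrier G" using schreier_gens_subset[OF A_subgroup Xc schreierD(1)[OF c]] Ac by blast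
  have evT: "\<forall>\<^sub>F i in sequentially. c (ray True i) = \<one> \<and> c' (ray True i) = \<one>"
    using m m' by (auto simp: marking_def intro: eventually_conj)
  have evF: "\<forall>\<^sub>F i in sequentially. c (ray False i) = b \<and> c' (ray False i) = b'"
    using m m' by (auto simp: marking_def intro: eventually_conj)
  obtain i where i: "c (ray True i) = \<one>" "c' (ray True i) = \<one>" using evT by (auto simp: eventually_sequentially)
  obtain j where j: "c (ray False j) = b" "c' (ray False j) = b'" using evF by (auto simp: eventually_sequentially)
  have ratio: "c' g \<otimes> inv (c g) \<in> word_ball G ?Y R" if "g \<in> carrier G" for g
    using schreier_ratio[OF X A_subgroup c gens(1)[OF X(1) c] c' ball ray_closed i that] gens(2)[OF X(1) c]
    by (simp add: R_def)
  show "b' \<otimes> inv b \<in> word_ball G ?Y R" using ratio[OF ray_closed, of False j] j by simp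
  have cc: "c g \<in> carrier G" "c' g \<in> carrier G" if "g \<in> carrier G" for g
    using coset_retractionD(1)[OF schreierD(1)[OF c] that] coset_retractionD(1)[OF schreierD(1)[OF c'] that] Ac by auto
  show "schreier_gens G X' c' \<subseteq> word_ball G ?Y (R + k + R)"
  proof
    fix y assume "y \<in> schreier_gens G X' c'"
    then obtain x g where x: "x \<in> X'" "g \<in> carrier G" "y = c' (x \<otimes> g) \<otimes> inv (c' g)"
      by (auto simp: schreier_gens_def)
    obtain w where w: "w \<in> words X" "length w \<le> k" "x = word_value G w"
      using x(1) ball by (auto simp: word_ball_def)
    have xc: "x \<in> carrier G" using w word_value_closed[OF Xc] by simp
    have 1: "c' (x \<otimes> g) \<otimes> inv (c (x \<otimes> g)) \<in> word_ball G ?Y R" using ratio x xc by simp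
    have 2: "c (x \<otimes> g) \<otimes> inv (c g) \<in> word_ball G ?Y k"
      using word_ball_mono[OF w(2) schreier_word_ball[OF A_subgroup Xc schreierD(1)[OF c] w(1) x(2)]] w(3) by simp
    have 3: "inv (c' g \<otimes> inv (c g)) \<in> word_ball G ?Y R" using word_ball_inv[OF Yc' ratio[OF x(2)]] .
    have "y = (c' (x \<otimes> g) \<otimes> inv (c (x \<otimes> g))) \<otimes> (c (x \<otimes> g) \<otimes> inv (c g)) \<otimes> inv (c' g \<otimes> inv (c g))"
      using x xc cc[of g] cc[of "x \<otimes> g"] by (simp add: inv_mult_group m_assoc inv_cancel)
    then show "y \<in> word_ball G ?Y (R + k + R)"
      using word_ball_mult[OF Yc' word_ball_mult[OF Yc' 1 2] 3] by simp
  qed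
qed

text \<open>The points \<open>u \<otimes> letter_value G (t, e)\<close> lie in pairwise different
  left cosets, so only finitely many \<open>Y\<close>-edges between them change \<open>c\<close>.
  The finite set of values makes the error in \<open>compat_identity\<close> independent of the
  automorphism.\<close>

lemma finite_values:
  assumes c: "schreier G A X0 c"
  shows "finite {c (u \<otimes> letter_value G (t, e)) | u. u \<in> A}"
proof -
  let ?l = "letter_value G (t, e)"
  note cr = schreierD(1)[OF c]
  define E where "E = {g \<in> carrier G. c g = \<one> \<and> (\<exists>s. fst s \<in> X0 \<and> c (letter_value G s \<otimes> g) \<noteq> \<one>)}"
  have E: "finite E" using crossing_points_finite(1)[OF basis0 A_subgroup c gens(1)[OF basis0 c]] by (simp add: E_def)
  define D where "D = {u \<in> A. \<exists>s. fst s \<in> Y \<and> c (letter_value G s \<otimes> (u \<otimes> ?l)) \<noteq> c (u \<otimes> ?l)}"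
  define p where "p u = u \<otimes> ?l \<otimes> inv (c (u \<otimes> ?l))" for u
  have ul: "u \<otimes> ?l \<in> carrier G" "c (u \<otimes> ?l) \<in> A" "c (u \<otimes> ?l) \<in> carrier G" if "u \<in> A" for u
    using that tl Ac coset_retractionD(1)[OF cr, of "u \<otimes> ?l"] by auto
  have "p u \<in> E" if uD: "u \<in> D" for u
  proof -
    obtain s where s: "fst s \<in> Y" "c (letter_value G s \<otimes> (u \<otimes> ?l)) \<noteq> c (u \<otimes> ?l)" and u: "u \<in> A"
      using uD unfolding D_def by blast
    define g where "g = u \<otimes> ?l"
    have lc: "letter_value G s \<in> carrier G" using letter_closed[OF Yc s(1)] .
    have g: "g \<in> carrier G" "c g \<in> A" "c g \<in> carrier G" using ul[OF u] by (auto simp: g_def)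
    have lg: "letter_value G s \<otimes> g \<in> carrier G" using lc g by simp
    have "c (letter_value G s \<otimes> p u) = c (letter_value G s \<otimes> g) \<otimes> inv (c g)"
      using coset_retractionD(2)[OF cr lg, of "inv (c g)"] g Ac lc by (simp add: p_def g_def[symmetric] m_assoc)
    moreover have ne: "c (letter_value G s \<otimes> g) \<otimes> inv (c g) \<noteq> \<one>"
    proof
      assume "c (letter_value G s \<otimes> g) \<otimes> inv (c g) = \<one>"
      moreover have "c (letter_value G s \<otimes> g) \<in> carrier G" using coset_retractionD(1)[OF cr lg] Ac by blast
      ultimately show False using inv_equality[of "c (letter_value G s \<otimes> g)" "inv (c g)"] g s(2) by (simp add: g_def)
    qed
    moreover have "c (p u) = \<one>" "p u \<in> carrier G"
      using coset_retractionD(2)[OF cr g(1), of "inv (c g)"] g Ac by (auto simp: p_def g_def[symmetric])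
    moreover have "fst s \<in> X0" using s(1) YX by blast
    ultimately have "p u \<in> carrier G \<and> c (p u) = \<one> \<and> fst s \<in> X0 \<and> c (letter_value G s \<otimes> p u) \<noteq> \<one>"
      by simp
    then show ?thesis unfolding E_def by blast
  qed
  moreover have "inj_on p A"
  proof (rule inj_onI, rule ccontr)
    fix u v assume u: "u \<in> A" "v \<in> A" "p u = p v" "u \<noteq> v"
    define d where "d = inv (c (u \<otimes> ?l)) \<otimes> c (v \<otimes> ?l)"
    have d: "d \<in> A" using ul[OF u(1)] ul[OF u(2)] Ac by (simp add: d_def)
    have "p u \<otimes> c (v \<otimes> ?l) = v \<otimes> ?l" using u(3) ul[OF u(2)] by (simp add: p_def m_assoc)
    then have "v \<otimes> ?l = u \<otimes> ?l \<otimes> d" using ul[OF u(1)] ul[OF u(2)] by (simp add: p_def d_def m_assoc)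
    then have "inv (u \<otimes> ?l) \<otimes> (v \<otimes> ?l) = d" using ul[OF u(1)] d Ac by (simp add: inv_cancel)
    then have "letter_value G (t, \<not> e) \<otimes> (inv u \<otimes> v) \<otimes> ?l = d"
      using tl u Ac by (simp add: inv_mult_group m_assoc inv_tl)
    moreover have "inv u \<otimes> v \<noteq> \<one>"
      using u Ac inv_equality[of "inv u" v] by (metis inv_closed inv_inv inv_equality)
    ultimately show False using malnormal[of "inv u \<otimes> v" e] d u Ac by simp
  qed
  ultimately have fD: "finite D"
    using finite_imageD[of p D] finite_subset[of "p ` D" E] E by (auto simp: D_def intro: inj_on_subset)
  \<comment> \<open>The value at the end of a path of letters from \<open>Y\<close> is the initial
    one or the one right after the last change.\<close>
  let ?V = "insert (c ?l) ((\<lambda>(s, u). c (letter_value G s \<otimes> (u \<otimes> ?l))) ` ((Y \<times> UNIV) \<times> D))"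
  have "c (word_value G w \<otimes> ?l) \<in> ?V" if "w \<in> words Y" for w
    using that
  proof (induction w)
    case (Cons s w)
    then have s: "fst s \<in> Y" "w \<in> words Y" by auto
    define u where "u = word_value G w"
    have u: "u \<in> A" using s(2) by (auto simp: u_def A_def generate_eq_words[OF Yc])
    have eq: "word_value G (s # w) \<otimes> ?l = letter_value G s \<otimes> (u \<otimes> ?l)"
      using letter_closed[OF Yc s(1)] u Ac tl by (simp add: u_def[symmetric] m_assoc)
    show ?case
    proof (cases "c (letter_value G s \<otimes> (u \<otimes> ?l)) = c (u \<otimes> ?l)")
      case True
      then show ?thesis unfolding eq using Cons.IH[OF s(2)] by (simp add: u_def)
    next
      case False
      then have "u \<in> D" using u s(1) unfolding D_def by blast
      moreover have "s \<in> Y \<times> UNIV" using s(1) by (simp add: mem_Times_iff)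
      ultimately show ?thesis unfolding eq by (intro insertI2 image_eqI[of _ _ "(s, u)"]) auto
    qed
  qed (use tl in simp)
  then have "{c (u \<otimes> ?l) | u. u \<in> A} \<subseteq> ?V"
    unfolding A_def generate_eq_words[OF Yc] by blast
  moreover have "finite ?V" using fD finY by simp
  ultimately show ?thesis using finite_subset by blast
qed

end


section \<open>Automorphisms that preserve a factor of corank one\<close>

text \<open>Products of elements of \<open>A\<close> and powers of \<open>g\<close> that end in a
  power of \<open>g\<close>. The index is the exponent of the last power; a trivial element of
  \<open>A\<close> is excluded only between opposite exponents, where the powers would
  cancel.\<close>

inductive alternating_product :: "('a, 'b) monoid_scheme \<Rightarrow> 'a set \<Rightarrow> 'a \<Rightarrow> bool option \<Rightarrow> 'a \<Rightarrow> bool"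
  for G A g where
  start: "alternating_product G A g None \<one>\<^bsub>G\<^esub>"
| step: "alternating_product G A g d f \<Longrightarrow> u \<in> A \<Longrightarrow> (d = Some (\<not> e) \<Longrightarrow> u \<noteq> \<one>\<^bsub>G\<^esub>) \<Longrightarrow>
    alternating_product G A g (Some e) (f \<otimes>\<^bsub>G\<^esub> u \<otimes>\<^bsub>G\<^esub> letter_value G (g, e))"

lemma cyclic_reduction:
  "w \<in> reduced_words X \<Longrightarrow> w \<noteq> [] \<Longrightarrow>
    \<exists>p q. w = p @ q @ inv_word p \<and> q \<noteq> [] \<and> hd q \<noteq> inv_letter (last q)"
proof (induction "length w" arbitrary: w rule: less_induct)
  case less
  show ?case
  proof (cases "hd w = inv_letter (last w)")
    case False
    then show ?thesis using less.prems by (intro exI[of _ "[]"] exI[of _ w]) auto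
  next
    case True
    obtain s v where w: "w = s # v" using less.prems by (cases w) auto
    then have "v \<noteq> []" using True by auto
    then obtain u z where v: "v = u @ [z]" by (cases v rule: rev_cases) auto
    have z: "z = inv_letter s" using True w v by simp
    have "u \<noteq> []" using less.prems w v z by (auto simp: reduced_words_Cons)
    moreover have "u \<in> reduced_words X" using less.prems w v by (auto simp: reduced_words_Cons reduced_words_append)
    ultimately obtain p q where "u = p @ q @ inv_word p" "q \<noteq> []" "hd q \<noteq> inv_letter (last q)"
      using less.hyps[of u] w v by auto
    then show ?thesis using w v z by (intro exI[of _ "s # p"] exI[of _ q]) auto
  qed
qed

context group
begin

lemma alternating_product_closed:
  "alternating_product G A g d f \<Longrightarrow> A \<subseteq> carrier G \<Longrightarrow> g \<in> carrier G \<Longrightarrow> f \<in> carrier G"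
  by (induction rule: alternating_product.induct) (auto simp: letter_value_def subset_iff)

lemma alternating_product_exists:
  assumes A: "subgroup A G" and g: "g \<in> carrier G" and f: "f \<in> generate G (insert g A)"
  shows "\<exists>d f' u. alternating_product G A g d f' \<and> u \<in> A \<and> f = f' \<otimes> u"
proof -
  note Ac = subgroup.mem_carrier[OF A] subgroup.m_closed[OF A] subgroup.m_inv_closed[OF A] subgroup.one_closed[OF A]
  have sub: "A \<subseteq> carrier G" using Ac by blast
  then have gA: "insert g A \<subseteq> carrier G" using g by simp
  obtain w where w: "w \<in> words (insert g A)" "f = word_value G w"
    using f generate_eq_words[OF gA] by auto
  have "\<exists>d f' u. alternating_product G A g d f' \<and> u \<in> A \<and> word_value G w = f' \<otimes> u"
    using w(1)
  proof (induction w rule: rev_induct)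
    case Nil
    then show ?case using alternating_product.start[of G A g] Ac(4) by force
  next
    case (snoc s w)
    then have s: "fst s \<in> insert g A" "w \<in> words (insert g A)" by auto
    then obtain d f' u where ap: "alternating_product G A g d f'" and u: "u \<in> A" and eq: "word_value G w = f' \<otimes> u"
      using snoc.IH by blast
    have f'c: "f' \<in> carrier G" using alternating_product_closed[OF ap sub g] .
    have lc: "letter_value G s \<in> carrier G" using letter_closed[OF gA s(1)] .
    have "[s] \<in> words (insert g A)" using s(1) by simp
    then have val: "word_value G (w @ [s]) = f' \<otimes> u \<otimes> letter_value G s"
      using word_value_append[OF gA s(2), of "[s]"] eq lc by simp
    show ?case
    proof (cases "fst s \<in> A")
      case True
      then have "letter_value G s \<in> A" using Ac by (simp add: letter_value_def)
      then have "u \<otimes> letter_value G s \<in> A" "word_value G (w @ [s]) = f' \<otimes> (u \<otimes> letter_value G s)"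
        using u Ac val f'c lc by (auto simp: m_assoc)
      then show ?thesis using ap by blast
    next
      case False
      then have sg: "s = (g, snd s)" using s(1) by (simp add: prod_eq_iff)
      show ?thesis
      proof (cases "d = Some (\<not> snd s) \<and> u = \<one>")
        case True
        then obtain d'' f'' u'' where ap'': "alternating_product G A g d'' f''" "u'' \<in> A"
          "f' = f'' \<otimes> u'' \<otimes> letter_value G (g, \<not> snd s)"
          using ap by (auto elim: alternating_product.cases)
        have f''c: "f'' \<in> carrier G" using alternating_product_closed[OF ap''(1) sub g] .
        have "letter_value G (g, \<not> snd s) = inv (letter_value G s)"
          using letter_inverse[of s] s(1) gA sg by (metis fst_conv g inv_letter_simps(5))
        then have "word_value G (w @ [s]) = f'' \<otimes> u''"
          using val ap'' f''c lc True Ac by (simp add: m_assoc)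
        then show ?thesis using ap'' by blast
      next
        case False
        then have "alternating_product G A g (Some (snd s)) (f' \<otimes> u \<otimes> letter_value G (g, snd s))"
          using ap u by (intro alternating_product.step) auto
        then have "alternating_product G A g (Some (snd s)) (word_value G (w @ [s]))"
          using val sg by metis
        moreover have "word_value G (w @ [s]) = word_value G (w @ [s]) \<otimes> \<one>"
          using val f'c lc u Ac by simp
        ultimately show ?thesis using Ac(4) by blast
      qed
    qed
  qed
  then show ?thesis using w by simp
qed

end

locale corank_one = based_free_group +
  assumes X0_eq: "X0 = insert t Y"
begin

text \<open>If the reduced word of \<open>h t\<close> is stripped of its letters from \<open>Y\<close> at both ends, then in an
  alternating product of the remaining element \<open>g = p q p\<inverse>\<close> and of elements of \<open>A\<close> cancellation
  occurs only between equal powers of \<open>g\<close> and never reaches the middle part \<open>q\<close>. As \<open>t\<close> is such a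
  product, \<open>g\<close> must be a single letter.\<close>

theorem auto_form:
  assumes h: "h \<in> auto G" "h ` A = A"
  shows "\<exists>u v e. u \<in> A \<and> v \<in> A \<and> h t = u \<otimes> letter_value G (t, e) \<otimes> v"
proof -
  define isY where "isY s \<longleftrightarrow> fst s \<in> Y" for s :: "'a \<times> bool"
  have ht: "h t \<in> carrier G" using auto_closed[OF h(1) tc] .
  have "t \<notin> A" using t_not_A[of True] by (simp add: letter_value_def)
  have htA: "h t \<notin> A"
  proof
    assume "h t \<in> A"
    then obtain b where "b \<in> A" "h t = h b" using h(2) by blast
    moreover have "inj_on h (carrier G)" using h(1) by (auto simp: auto_def Bij_def bij_betw_def)
    ultimately show False using \<open>t \<notin> A\<close> tc Ac(1) by (metis inj_onD)
  qed
  obtain w where w: "w \<in> reduced_words X0" "h t = word_value G w"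
    using ht free_basisD(3)[OF basis0] by blast
  define w1 w' where "w1 = takeWhile isY w" and "w' = dropWhile isY w"
  \<comment> \<open>The middle part \<open>w2\<close> begins and ends with a letter \<open>t\<close>
    or its inverse; its value \<open>g\<close> differs from \<open>h t\<close> by factors from
    \<open>A\<close> on both sides.\<close>
  define w3 w2 where "w3 = rev (takeWhile isY (rev w'))" and "w2 = rev (dropWhile isY (rev w'))"
  have w'_eq: "w' = w2 @ w3"
    by (metis rev_append rev_rev_ident takeWhile_dropWhile_id w2_def w3_def)
  have w_eq: "w = w1 @ w2 @ w3"
    using w'_eq takeWhile_dropWhile_id[of isY w] by (simp add: w1_def w'_def)
  have isYw: "\<forall>s\<in>set w1. isY s" "\<forall>s\<in>set w3. isY s"
    by (auto simp: w1_def w3_def dest: set_takeWhileD)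
  have Yw: "v \<in> words Y" if "\<forall>s\<in>set v. isY s" for v
    using that by (auto simp: words_iff isY_def)
  have A_val: "word_value G v \<in> A" if "v \<in> words Y" for v
    using that by (auto simp: A_def generate_eq_words[OF Yc])
  have "w' \<noteq> []"
  proof
    assume "w' = []"
    then have "w \<in> words Y" using w_eq w'_eq isYw by (intro Yw) auto
    then show False using A_val w htA by simp
  qed
  then have hdw': "\<not> isY (hd w')" unfolding w'_def by (rule hd_dropWhile)
  have "w2 \<noteq> []"
  proof
    assume "w2 = []"
    then have "\<forall>s\<in>set w'. isY s" using w'_eq isYw by simp
    then show False using hdw' \<open>w' \<noteq> []\<close> by simp
  qed
  have hd2: "\<not> isY (hd w2)" using hdw' w'_eq \<open>w2 \<noteq> []\<close> by simp
  have last2: "\<not> isY (last w2)"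
    using \<open>w2 \<noteq> []\<close> hd_dropWhile[of isY "rev w'"] unfolding w2_def by (simp add: last_rev)
  have red: "w1 \<in> reduced_words X0" "w2 \<in> reduced_words X0" "w3 \<in> reduced_words X0"
    using w(1) unfolding w_eq by (auto simp: reduced_words_append)
  have fst_t: "fst s = t" if "\<not> isY s" "s \<in> set v" "v \<in> reduced_words X0" for s v
    using that(1,2) subsetD[OF reduced_words_subset that(3)] X0_eq by (auto simp: words_iff isY_def)
  have t2: "fst (hd w2) = t" "fst (last w2) = t"
    using fst_t[OF hd2 hd_in_set red(2)] fst_t[OF last2 last_in_set red(2)] \<open>w2 \<noteq> []\<close> by auto
  define g where "g = word_value G w2"
  have ww: "w1 \<in> words X0" "w2 \<in> words X0" "w3 \<in> words X0" using red reduced_words_subset[of X0] by auto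
  have gc: "g \<in> carrier G" using word_value_closed[OF X0c ww(2)] by (simp add: g_def)
  define u1 u3 where "u1 = word_value G w1" and "u3 = word_value G w3"
  have u: "u1 \<in> A" "u3 \<in> A" using A_val Yw isYw by (auto simp: u1_def u3_def)
  have ht_eq: "h t = u1 \<otimes> g \<otimes> u3"
    using w(2) word_value_append[OF X0c ww(1), of "w2 @ w3"] word_value_append[OF X0c ww(2,3)] ww u gc Ac
    by (simp add: w_eq g_def u1_def u3_def m_assoc)
  obtain p q where pq: "w2 = p @ q @ inv_word p" "q \<noteq> []" "hd q \<noteq> inv_letter (last q)"
    using cyclic_reduction[OF red(2) \<open>w2 \<noteq> []\<close>] by blast
  \<comment> \<open>The middle part of the reduced word of \<open>g\<close> or its inverse; the
    conjugating part \<open>p\<close> is common to both signs.\<close>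
  define Q where "Q e = (if e then q else inv_word q)" for e
  have hd_inv: "hd (inv_word v) = inv_letter (last v)" "last (inv_word v) = inv_letter (hd v)" if "v \<noteq> []" for v :: "('a \<times> bool) list"
    using that by (simp_all add: inv_word_def hd_rev last_rev last_map hd_map)
  have Qne: "Q e \<noteq> []" for e using pq(2) by (simp add: Q_def)
  have Qcyc: "hd (Q e) \<noteq> inv_letter (last (Q e))" for e
    using pq(2,3) by (auto simp: Q_def hd_inv)
  have rW: "p @ Q e @ inv_word p \<in> reduced_words X0" for e
  proof (cases e)
    case True
    then show ?thesis using red(2) pq(1) by (simp add: Q_def)
  next
    case False
    have "inv_word w2 = p @ inv_word q @ inv_word p" by (simp add: pq(1))
    then show ?thesis using False red(2) inv_word_reduced[of w2 X0] by (simp add: Q_def)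
  qed
  have rQ: "Q e @ inv_word p \<in> reduced_words X0" for e
    using rW[of e] by (auto simp: reduced_words_append)
  have words: "p \<in> words X0" "Q e \<in> words X0" for e
    using rW[of e] reduced_words_subset[of X0] by auto
  have hdW: "fst (hd (p @ Q e @ inv_word p)) = t" for e
    using t2 pq(1,2) by (cases "p = []") (auto simp: Q_def hd_inv)
  have lastQ: "fst (last (Q e @ inv_word p)) = t" for e
    using t2 pq(1,2) by (cases "p = []") (auto simp: Q_def hd_inv)
  have valW: "word_value G (p @ Q e @ inv_word p) = letter_value G (g, e)" for e
  proof (cases e)
    case True
    then show ?thesis by (simp add: Q_def g_def pq(1) letter_value_def)
  next
    case False
    have "inv_word w2 = p @ inv_word q @ inv_word p" by (simp add: pq(1))
    then show ?thesis using False word_value_inverse[OF X0c ww(2)] by (simp add: Q_def g_def letter_value_def)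
  qed
  \<comment> \<open>The invariant: the final block \<open>Q e @ inv_word p\<close> of the last
    factor survives in the reduced word of the product.\<close>
  have inv_ap: "\<exists>u. u @ Q e @ inv_word p \<in> reduced_words X0 \<and> word_value G (u @ Q e @ inv_word p) = f"
    if "alternating_product G A g (Some e) f" for e f
    using that
  proof (induction "Some e" f arbitrary: e rule: alternating_product.induct)
    case (step d f b e)
    obtain v where v: "v \<in> reduced_words Y" "b = word_value G v" using A_word[OF step(3)] by blast
    have v0: "v \<in> reduced_words X0" "v \<in> words X0" using red_YX[OF v(1)] reduced_words_subset[of X0] by auto
    have lastv: "fst (last v) \<noteq> t" "fst (hd v) \<noteq> t" if "v \<noteq> []"
      using that v(1) reduced_words_subset[of Y] tX(2) by (force simp: words_iff)+
    have Wc: "p @ Q e @ inv_word p \<in> words X0" using words by simp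
    have vW: "v @ p @ Q e @ inv_word p \<in> reduced_words X0"
      unfolding reduced_words_append[of v] using v0 rW[of e] hdW[of e] lastv(1)
      by (metis inv_letter_simps(2))
    show ?case
    proof (cases d)
      case None
      then have "f = \<one>" using step(1) by (auto elim: alternating_product.cases)
      then have "word_value G ((v @ p) @ Q e @ inv_word p) = f \<otimes> b \<otimes> letter_value G (g, e)"
        using word_value_append[OF X0c v0(2) Wc] valW[of e] v(2) step(3) Ac by simp
      then show ?thesis using vW by (intro exI[of _ "v @ p"]) simp
    next
      case (Some e1)
      obtain u where u: "u @ Q e1 @ inv_word p \<in> reduced_words X0" "word_value G (u @ Q e1 @ inv_word p) = f"
        using step(2)[OF Some] by blast
      have uw: "u \<in> words X0" using u(1) reduced_words_subset[of X0] by auto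
      show ?thesis
      proof (cases "b = \<one>")
        \<comment> \<open>Two equal powers of \<open>g\<close> meet. The parts
          \<open>inv_word p\<close> and \<open>p\<close> between them cancel, and the middle parts
          do not, being cyclically reduced.\<close>
        case True
        then have e1: "e1 = e" using step(4) Some by auto
        have "Q e @ Q e @ inv_word p \<in> reduced_words X0"
          using rQ[of e] Qcyc[of e] Qne[of e] by (auto simp: reduced_words_append)
        then have "u @ Q e @ Q e @ inv_word p \<in> reduced_words X0"
          using u(1) Qne[of e] unfolding e1 by (auto simp: reduced_words_append)
        moreover have "word_value G (u @ Q e @ Q e @ inv_word p) = f \<otimes> b \<otimes> letter_value G (g, e)"
        proof -
          have ip: "inv_word p \<in> words X0" using words by simp
          have cl: "word_value G u \<in> carrier G" "word_value G (Q e) \<in> carrier G" "word_value G p \<in> carrier G"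
            using word_value_closed[OF X0c] uw words by auto
          have "f = word_value G u \<otimes> (word_value G (Q e) \<otimes> inv (word_value G p))"
            unfolding u(2)[symmetric] e1
            using word_value_append[OF X0c] uw words ip word_value_inverse[OF X0c words(1)] by simp
          moreover have "letter_value G (g, e) = word_value G p \<otimes> (word_value G (Q e) \<otimes> inv (word_value G p))"
            unfolding valW[symmetric]
            using word_value_append[OF X0c] words ip word_value_inverse[OF X0c words(1)] by simp
          moreover have "word_value G (u @ Q e @ Q e @ inv_word p) =
              word_value G u \<otimes> (word_value G (Q e) \<otimes> (word_value G (Q e) \<otimes> inv (word_value G p)))"
            using word_value_append[OF X0c] uw words ip word_value_inverse[OF X0c words(1)] by simp
          ultimately show ?thesis using cl True by (simp add: m_assoc inv_cancel)
        qed
        ultimately show ?thesis by (intro exI[of _ "u @ Q e"]) simp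
      next
        \<comment> \<open>A nonempty word in \<open>Y\<close> separates two powers of
          \<open>g\<close> whose adjacent letters are powers of \<open>t\<close>, so nothing
          cancels.\<close>
        case False
        then have ne: "v \<noteq> []" using v(2) by auto
        let ?u = "u @ Q e1 @ inv_word p"
        have lu: "fst (last ?u) = t" using lastQ[of e1] Qne[of e1] by (simp add: last_append)
        have "hd (v @ p @ Q e @ inv_word p) \<noteq> inv_letter (last ?u)"
          using lu lastv(2)[OF ne] ne by (metis hd_append2 inv_letter_simps(2))
        then have r: "?u @ v @ p @ Q e @ inv_word p \<in> reduced_words X0"
          unfolding reduced_words_append[of ?u] using u(1) vW by blast
        have "word_value G (?u @ v @ p @ Q e @ inv_word p) = f \<otimes> (b \<otimes> letter_value G (g, e))"
          using word_value_append[OF X0c, of ?u "v @ p @ Q e @ inv_word p"] word_value_append[OF X0c v0(2) Wc]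
            uw words v0 u(2) v(2) valW[of e] by simp
        moreover have "f \<in> carrier G" using u word_value_closed[OF X0c] reduced_words_subset[of X0] by blast
        moreover have "letter_value G (g, e) \<in> carrier G" "b \<in> carrier G"
          using gc step(3) Ac by (auto simp: letter_value_def)
        ultimately show ?thesis
          using r by (intro exI[of _ "?u @ v @ p"]) (simp add: m_assoc)
      qed
    qed
  qed
  \<comment> \<open>Since \<open>h\<close> is onto and maps \<open>A\<close> to itself,
    \<open>A\<close> and \<open>h t\<close> generate the group, and hence so do \<open>A\<close> and
    \<open>g\<close>.\<close>
  have "t \<in> generate G (insert g A)"
  proof -
    let ?K = "generate G (insert g A)"
    have gA: "insert g A \<subseteq> carrier G" using gc Ac by auto
    have K: "subgroup ?K G" by (rule generate_is_subgroup[OF gA])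
    have AK: "A \<subseteq> ?K" "g \<in> ?K" by (auto intro: generate.incl)
    have "h t \<in> ?K" unfolding ht_eq using AK u by (auto intro!: generate.eng)
    moreover have "h ` Y \<subseteq> ?K" using YA h(2) AK by blast
    ultimately have "h ` X0 \<subseteq> ?K" using X0_eq by simp
    then have "generate G (h ` X0) \<subseteq> ?K" using generate_subgroup_incl[OF _ K] by blast
    then show ?thesis
      using generate_image[OF auto_hom[OF h(1)] X0c] free_basis_generate[OF basis0] auto_surj[OF h(1)] tc by auto
  qed
  then obtain d f b where ap: "alternating_product G A g d f" "b \<in> A" "t = f \<otimes> b"
    using alternating_product_exists[OF A_subgroup gc] by blast
  have "d \<noteq> None"
  proof
    assume "d = None"
    then have "f = \<one>" using ap(1) by (auto elim: alternating_product.cases)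
    then show False using ap \<open>t \<notin> A\<close> Ac by simp
  qed
  then obtain e where d: "d = Some e" by blast
  obtain u' where u': "u' @ Q e @ inv_word p \<in> reduced_words X0" "word_value G (u' @ Q e @ inv_word p) = f"
    using inv_ap ap(1) d by blast
  obtain v where v: "v \<in> reduced_words Y" "b = word_value G v" using A_word[OF ap(2)] by blast
  let ?u = "u' @ Q e @ inv_word p"
  have lu: "fst (last ?u) = t" using lastQ[of e] Qne[of e] by (simp add: last_append)
  have "hd v \<noteq> inv_letter (last ?u)" if "v \<noteq> []"
  proof -
    have "fst (hd v) \<noteq> t"
      using that v(1) reduced_words_subset[of Y] tX(2) by (force simp: words_iff)
    then show ?thesis using lu by auto
  qed
  then have "?u @ v \<in> reduced_words X0"
    unfolding reduced_words_append[of ?u] using u'(1) red_YX[OF v(1)] by blast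
  moreover have "word_value G (?u @ v) = word_value G [(t, True)]"
    using word_value_append[OF X0c subsetD[OF reduced_words_subset u'(1)] subsetD[OF reduced_words_subset red_YX[OF v(1)]]]
      u'(2) v(2) ap(3) tc by (simp add: letter_value_def)
  moreover have "[(t, True)] \<in> reduced_words X0" using tX by (simp add: reduced_words_Cons)
  \<comment> \<open>A single letter must contain the nonempty block \<open>Q e\<close> together with
    \<open>inv_word p\<close>. So \<open>p\<close> is empty and \<open>q\<close> is one
    letter.\<close>
  ultimately have "?u @ v = [(t, True)]" using word_value_inj by blast
  then have "p = []" "Q e = [(t, True)]"
    using Qne[of e] by (cases u'; cases "Q e"; auto simp: append_eq_Cons_conv)+
  then have "q = [(t, e)]"
    by (cases e) (auto simp: Q_def inv_word_def)
  then have "g = letter_value G (t, e)"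
    using \<open>p = []\<close> tl by (simp add: g_def pq(1))
  then show ?thesis using ht_eq u by blast
qed

end

section \<open>Word metrics\<close>

context group
begin

lemma word_length_le: "w \<in> words S \<Longrightarrow> word_value G w = g \<Longrightarrow> word_length G S g \<le> length w"
  unfolding word_length_def by (rule Least_le) blast

lemma word_length_word:
  assumes "S \<subseteq> carrier G" "g \<in> generate G S"
  obtains w where "w \<in> words S" "word_value G w = g" "length w = word_length G S g"
proof -
  have "g \<in> word_value G ` words S" using assms(2) generate_eq_words[OF assms(1)] by simp
  then obtain w where "w \<in> words S" "word_value G w = g" by auto
  then have "\<exists>w'\<in>words S. length w' = length w \<and> word_value G w' = g" by auto
  then have "\<exists>w\<in>words S. length w = word_length G S g \<and> word_value G w = g"
    unfolding word_length_def by (rule LeastI)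
  then obtain w where "w \<in> words S" "length w = word_length G S g" "word_value G w = g" by auto
  then show ?thesis by (intro that)
qed

lemma word_length_one [simp]: "word_length G S \<one> = 0"
  using word_length_le[of "[]" S \<one>] by simp

lemma word_length_mult:
  assumes S: "S \<subseteq> carrier G" and gh: "g \<in> generate G S" "h \<in> generate G S"
  shows "word_length G S (g \<otimes> h) \<le> word_length G S g + word_length G S h"
proof -
  obtain v where v: "v \<in> words S" "word_value G v = g" "length v = word_length G S g"
    by (rule word_length_word[OF S gh(1)])
  obtain w where w: "w \<in> words S" "word_value G w = h" "length w = word_length G S h"
    by (rule word_length_word[OF S gh(2)])
  have "word_length G S (g \<otimes> h) \<le> length (v @ w)"
    using v w word_value_append[OF S v(1) w(1)] by (intro word_length_le) auto
  then show ?thesis using v w by simp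
qed

lemma finite_word_length_bound: "finite D \<Longrightarrow> \<exists>K. \<forall>d\<in>D. word_length G S d \<le> K"
  by (meson finite_imageI finite_nat_set_iff_bounded_le imageI)

lemma word_length_lipschitz:
  assumes H: "subgroup H G" and S: "S \<subseteq> carrier G" "generate G S = carrier G"
    and T: "T \<subseteq> H" "finite T" "generate (G\<lparr>carrier := H\<rparr>) T = H"
  obtains K where "\<And>h. h \<in> H \<Longrightarrow> word_length G S h \<le> K * word_length (G\<lparr>carrier := H\<rparr>) T h"
proof -
  interpret H: group "G\<lparr>carrier := H\<rparr>" by (rule sub_group[OF H])
  have "finite (letter_value G ` (T \<times> UNIV))" using T(2) by simp
  then obtain K where K: "\<And>s. s \<in> T \<times> UNIV \<Longrightarrow> word_length G S (letter_value G s) \<le> K"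
    using finite_word_length_bound by (metis imageI)
  have Tc: "T \<subseteq> carrier G" using T(1) subgroup.subset[OF H] by blast
  have word: "word_length G S (word_value G w) \<le> K * length w" if "w \<in> words T" for w
    using that
  proof (induction w)
    case (Cons s w)
    then have s: "fst s \<in> T" "w \<in> words T" by auto
    have "word_length G S (word_value G (s # w)) \<le> word_length G S (letter_value G s) + word_length G S (word_value G w)"
      using word_length_mult[OF S(1)] S(2) letter_closed[OF Tc s(1)] word_value_closed[OF Tc s(2)] by simp
    also have "\<dots> \<le> K + K * length w"
      using K[of s] Cons.IH[OF s(2)] s(1) by (intro add_mono) (auto simp: mem_Times_iff)
    finally show ?case by simp
  qed simp
  have "word_length G S h \<le> K * word_length (G\<lparr>carrier := H\<rparr>) T h" if h: "h \<in> H" for h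
  proof -
    obtain w where w: "w \<in> words T" "word_value (G\<lparr>carrier := H\<rparr>) w = h" "length w = word_length (G\<lparr>carrier := H\<rparr>) T h"
      using H.word_length_word[of T h] T h by auto
    then show ?thesis using word[OF w(1)] word_value_sub[OF H T(1) w(1)] by simp
  qed
  then show ?thesis using that by blast
qed

text \<open>The retraction bounds the metric of \<open>H\<close> by that of \<open>G\<close>; the
  converse bound holds because the finitely many elements of \<open>T\<close> have bounded length in
  \<open>S\<close>. The additive constant can be taken to be \<open>0\<close>.\<close>

lemma retract_undistorted:
  assumes H: "subgroup H G" and S: "finite_generating_set G S" and T: "finite_generating_set (G\<lparr>carrier := H\<rparr>) T"
    and r: "lipschitz_retract G S H T"
  shows "undistorted G S H T"
proof -
  obtain \<pi> K where \<pi>: "\<And>h. h \<in> H \<Longrightarrow> \<pi> h = h" and K: "K \<ge> 1"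
    and lip: "\<And>a b. a \<in> carrier G \<Longrightarrow> b \<in> carrier G \<Longrightarrow>
      word_dist (G\<lparr>carrier := H\<rparr>) T (\<pi> a) (\<pi> b) \<le> K * word_dist G S a b"
    using r unfolding lipschitz_retract_def by blast
  note Hc = subgroup.mem_carrier[OF H] subgroup.m_closed[OF H] subgroup.m_inv_closed[OF H]
  obtain K' where K': "\<And>h. h \<in> H \<Longrightarrow> word_length G S h \<le> K' * word_length (G\<lparr>carrier := H\<rparr>) T h"
    using word_length_lipschitz[OF H, of S T] S T by (auto simp: finite_generating_set_def)
  define L where "L = max K (real K')"
  have "word_dist (G\<lparr>carrier := H\<rparr>) T x y / L - 0 \<le> word_dist G S x y \<and>
        word_dist G S x y \<le> L * word_dist (G\<lparr>carrier := H\<rparr>) T x y + 0" if xy: "x \<in> H" "y \<in> H" for x y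
  proof -
    have eq: "inv\<^bsub>G\<lparr>carrier := H\<rparr>\<^esub> x \<otimes>\<^bsub>G\<lparr>carrier := H\<rparr>\<^esub> y = inv x \<otimes> y" using xy H by simp
    have "word_dist (G\<lparr>carrier := H\<rparr>) T x y \<le> K * word_dist G S x y"
      using lip[of x y] \<pi> xy Hc by simp
    also have "\<dots> \<le> L * word_dist G S x y"
      by (intro mult_right_mono) (auto simp: L_def word_dist_def)
    finally have 1: "word_dist (G\<lparr>carrier := H\<rparr>) T x y \<le> L * word_dist G S x y" .
    have "real (word_length G S (inv x \<otimes> y)) \<le> real (K' * word_length (G\<lparr>carrier := H\<rparr>) T (inv x \<otimes> y))"
      using K'[of "inv x \<otimes> y"] xy Hc by (simp only: of_nat_le_iff)
    then have "word_dist G S x y \<le> real K' * word_dist (G\<lparr>carrier := H\<rparr>) T x y"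
      unfolding word_dist_def eq by simp
    also have "\<dots> \<le> L * word_dist (G\<lparr>carrier := H\<rparr>) T x y"
      by (intro mult_right_mono) (auto simp: L_def word_dist_def)
    finally have 2: "word_dist G S x y \<le> L * word_dist (G\<lparr>carrier := H\<rparr>) T x y" .
    have "L > 0" using K by (simp add: L_def)
    then show ?thesis using 1 2 by (simp add: divide_le_eq mult.commute)
  qed
  moreover have "L \<ge> 1" using K by (simp add: L_def)
  ultimately show ?thesis
    unfolding undistorted_def quasi_isometric_embedding_def by (intro exI[of _ L] exI[of _ 0]) auto
qed

text \<open>It suffices to define the retraction up to bounded error, as a relation.\<close>

lemma lipschitz_retractI:
  assumes H: "subgroup H G" and S: "finite_generating_set G S" and T: "finite_generating_set (G\<lparr>carrier := H\<rparr>) T"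
    and ex: "\<And>g. g \<in> carrier G \<Longrightarrow> \<exists>h\<in>H. R g h" and id: "\<And>h. h \<in> H \<Longrightarrow> R h h"
    and W: "finite W"
    and step: "\<And>g s h h'. g \<in> carrier G \<Longrightarrow> fst s \<in> S \<Longrightarrow> h \<in> H \<Longrightarrow> h' \<in> H \<Longrightarrow> R g h \<Longrightarrow>
      R (g \<otimes> letter_value G s) h' \<Longrightarrow> inv h \<otimes> h' \<in> W"
  shows "lipschitz_retract G S H T"
proof -
  let ?H = "G\<lparr>carrier := H\<rparr>"
  interpret H: group ?H by (rule sub_group[OF H])
  note Hc = subgroup.mem_carrier[OF H] subgroup.m_closed[OF H] subgroup.m_inv_closed[OF H]
  have Sc: "S \<subseteq> carrier G" "generate G S = carrier G" and Tc: "T \<subseteq> H" "generate ?H T = H"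
    using S T by (auto simp: finite_generating_set_def)
  obtain K where K: "\<And>w. w \<in> W \<Longrightarrow> word_length ?H T w \<le> K" using H.finite_word_length_bound[OF W] by blast
  \<comment> \<open>On \<open>H\<close> the value is forced, and \<open>id\<close> makes the forced
    value an admissible one. Elsewhere any related element will do.\<close>
  define \<pi> where "\<pi> g = (if g \<in> H then g else SOME h. h \<in> H \<and> R g h)" for g
  have \<pi>: "\<pi> g \<in> H" "R g (\<pi> g)" if "g \<in> carrier G" for g
  proof -
    have "\<pi> g \<in> H \<and> R g (\<pi> g)"
      using someI_ex[of "\<lambda>h. h \<in> H \<and> R g h"] ex[OF that] id by (auto simp: \<pi>_def)
    then show "\<pi> g \<in> H" "R g (\<pi> g)" by auto
  qed
  have bound: "word_length ?H T (inv (\<pi> g) \<otimes> \<pi> (g \<otimes> word_value G w)) \<le> K * length w"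
    if g: "g \<in> carrier G" and "w \<in> words S" for g w
    using that(2)
  proof (induction w rule: rev_induct)
    case Nil
    then show ?case using g \<pi>(1)[OF g] Hc H.word_length_one[of T] by simp
  next
    case (snoc s w)
    then have s: "fst s \<in> S" "w \<in> words S" "[s] \<in> words S" by auto
    define k where "k = g \<otimes> word_value G w"
    have k: "k \<in> carrier G" using g word_value_closed[OF Sc(1) s(2)] by (simp add: k_def)
    have lc: "letter_value G s \<in> carrier G" using letter_closed[OF Sc(1) s(1)] .
    have kl: "g \<otimes> word_value G (w @ [s]) = k \<otimes> letter_value G s"
      using g word_value_closed[OF Sc(1) s(2)] word_value_append[OF Sc(1) s(2,3)] lc by (simp add: k_def m_assoc)
    have klc: "k \<otimes> letter_value G s \<in> carrier G" using k lc by simp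
    define x where "x = inv (\<pi> g) \<otimes> \<pi> k"
    define y where "y = inv (\<pi> k) \<otimes> \<pi> (k \<otimes> letter_value G s)"
    have xy: "x \<in> H" "y \<in> H" using \<pi>(1) g k klc Hc by (auto simp: x_def y_def)
    have "y \<in> W" unfolding y_def by (rule step[OF k s(1) \<pi>(1)[OF k] \<pi>(1)[OF klc] \<pi>(2)[OF k] \<pi>(2)[OF klc]])
    then have y: "word_length ?H T y \<le> K" by (rule K)
    have x: "word_length ?H T x \<le> K * length w" using snoc.IH[OF s(2)] by (simp add: x_def k_def)
    have "inv (\<pi> g) \<otimes> \<pi> (k \<otimes> letter_value G s) = x \<otimes> y"
      using \<pi>(1)[OF g] \<pi>(1)[OF k] \<pi>(1)[OF klc] Hc by (simp add: x_def y_def m_assoc inv_cancel)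
    moreover have "word_length ?H T (x \<otimes> y) \<le> word_length ?H T x + word_length ?H T y"
      using H.word_length_mult[of T x y] Tc xy by simp
    ultimately show ?case using x y unfolding kl by simp
  qed
  show ?thesis
    unfolding lipschitz_retract_def
  proof (intro exI conjI ballI)
    show "\<pi> \<in> carrier G \<rightarrow> H" using \<pi>(1) by blast
    show "\<pi> h = h" if "h \<in> H" for h using that by (simp add: \<pi>_def)
    show "1 \<le> max 1 (real K)" by simp
    fix a b assume ab: "a \<in> carrier G" "b \<in> carrier G"
    have g: "inv a \<otimes> b \<in> generate G S" using ab Sc by simp
    obtain w where w: "w \<in> words S" "word_value G w = inv a \<otimes> b" "length w = word_length G S (inv a \<otimes> b)"
      by (rule word_length_word[OF Sc(1) g])
    have "word_length ?H T (inv (\<pi> a) \<otimes> \<pi> b) \<le> K * word_length G S (inv a \<otimes> b)"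
      using bound[OF ab(1) w(1)] w(2,3) ab by (simp add: inv_cancel)
    then have "real (word_length ?H T (inv (\<pi> a) \<otimes> \<pi> b)) \<le> real K * real (word_length G S (inv a \<otimes> b))"
      by (metis of_nat_le_iff of_nat_mult)
    also have "\<dots> \<le> max 1 (real K) * real (word_length G S (inv a \<otimes> b))"
      by (intro mult_right_mono) auto
    finally show "word_dist ?H T (\<pi> a) (\<pi> b) \<le> max 1 (real K) * word_dist G S a b"
      using \<pi>(1)[OF ab(1)] H by (simp add: word_dist_def)
  qed
qed

end


section \<open>Outer automorphisms and stabilizers\<close>

definition cls :: "('a, 'b) monoid_scheme \<Rightarrow> ('a \<Rightarrow> 'a) \<Rightarrow> ('a \<Rightarrow> 'a) set" where
  "cls G f = Inn G #>\<^bsub>AutoGroup G\<^esub> f"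

context group
begin

lemma auto_compose: "f \<in> auto G \<Longrightarrow> g \<in> auto G \<Longrightarrow> compose (carrier G) f g \<in> auto G"
  using monoid.m_closed[OF group.is_monoid[OF AutoGroup], of f g] by (simp add: AutoGroup_simps)

lemma cls_carrier: "f \<in> auto G \<Longrightarrow> cls G f \<in> carrier (Out G)"
  by (auto simp: Out_def FactGroup_def RCOSETS_def cls_def AutoGroup_simps)

lemma cls_surj: "\<Phi> \<in> carrier (Out G) \<Longrightarrow> \<exists>f\<in>auto G. \<Phi> = cls G f"
  by (auto simp: Out_def FactGroup_def RCOSETS_def cls_def AutoGroup_simps)

lemma cls_mult:
  "f \<in> auto G \<Longrightarrow> g \<in> auto G \<Longrightarrow> cls G f \<otimes>\<^bsub>Out G\<^esub> cls G g = cls G (compose (carrier G) f g)"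
  using normal.rcos_sum[OF normal_Inn, of f g] by (simp add: Out_def FactGroup_def cls_def AutoGroup_simps)

lemma cls_cong:
  assumes fg: "f \<in> auto G" "g \<in> auto G" and w: "w \<in> carrier G"
    and eq: "\<And>x. x \<in> carrier G \<Longrightarrow> f x = w \<otimes> g x \<otimes> inv w"
  shows "cls G f = cls G g"
proof -
  interpret Aut: group "AutoGroup G" by (rule AutoGroup)
  let ?i = "\<lambda>x\<in>carrier G. w \<otimes> x \<otimes> inv w"
  have i: "?i \<in> Inn G" using w unfolding Inn_def by blast
  have "f = ?i \<otimes>\<^bsub>AutoGroup G\<^esub> g"
  proof (rule extensionalityI[of _ "carrier G"])
    show "f \<in> extensional (carrier G)" using fg by (simp add: auto_def Bij_def)
    show "?i \<otimes>\<^bsub>AutoGroup G\<^esub> g \<in> extensional (carrier G)"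
      using fg inner_auto[OF w] by (simp add: AutoGroup_simps compose_def)
    show "f x = (?i \<otimes>\<^bsub>AutoGroup G\<^esub> g) x" if "x \<in> carrier G" for x
      using fg inner_auto[OF w] that eq auto_closed[OF fg(2) that] by (simp add: AutoGroup_simps compose_def)
  qed
  then have "f \<in> Inn G #>\<^bsub>AutoGroup G\<^esub> g" using i by (auto simp: r_coset_def)
  then show ?thesis
    using Aut.repr_independence[OF _ _ subgroup_Inn, of f g] fg by (simp add: cls_def AutoGroup_simps)
qed

lemma cls_eqD:
  assumes fg: "f \<in> auto G" "g \<in> auto G" and eq: "cls G f = cls G g"
  shows "\<exists>w\<in>carrier G. \<forall>x\<in>carrier G. f x = w \<otimes> g x \<otimes> inv w"
proof -
  interpret Aut: group "AutoGroup G" by (rule AutoGroup)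
  have "f \<in> cls G f" unfolding cls_def using Aut.rcos_self[OF _ subgroup_Inn, of f] fg by (simp add: AutoGroup_simps)
  then obtain w where w: "w \<in> carrier G" "f = (\<lambda>x\<in>carrier G. w \<otimes> x \<otimes> inv w) \<otimes>\<^bsub>AutoGroup G\<^esub> g"
    unfolding eq by (auto simp: cls_def r_coset_def Inn_def)
  have "f x = w \<otimes> g x \<otimes> inv w" if "x \<in> carrier G" for x
    using w fg(2) inner_auto[OF w(1)] that auto_closed[OF fg(2) that] by (simp add: AutoGroup_simps compose_def)
  then show ?thesis using w(1) by blast
qed

lemma cls_one: "cls G (\<lambda>x\<in>carrier G. x) = \<one>\<^bsub>Out G\<^esub>"
proof -
  interpret Aut: group "AutoGroup G" by (rule AutoGroup)
  show ?thesis
    using Aut.coset_mult_one[of "Inn G"] Inn_subset_auto by (simp add: cls_def Out_def FactGroup_def AutoGroup_simps)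
qed

lemma id_auto: "(\<lambda>x\<in>carrier G. x) \<in> auto G"
  using monoid.one_closed[OF group.is_monoid[OF AutoGroup]] by (simp add: AutoGroup_simps)

lemma cls_inv:
  assumes f: "f \<in> auto G" "f' \<in> auto G" and inv: "\<And>x. x \<in> carrier G \<Longrightarrow> f' (f x) = x"
  shows "inv\<^bsub>Out G\<^esub> (cls G f) = cls G f'"
proof -
  interpret Out: group "Out G" by (rule group_Out)
  have "compose (carrier G) f' f = (\<lambda>x\<in>carrier G. x)"
    using inv by (auto simp: compose_def)
  then have "cls G f' \<otimes>\<^bsub>Out G\<^esub> cls G f = \<one>\<^bsub>Out G\<^esub>"
    using cls_mult[OF f(2,1)] cls_one by simp
  then show ?thesis using cls_carrier f by (intro Out.inv_equality) auto
qed

lemma Stab_cls: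
  assumes A: "A \<subseteq> carrier G" and f: "f \<in> auto G" "f ` A = A"
  shows "cls G f \<in> Stab G A"
  using out_action_coset[OF f(1) A] cls_carrier[OF f(1)] f(2)
  by (simp add: Stab_def stabilizer_def cls_def)

text \<open>A representative sends \<open>A\<close> to one of its conjugates; composing with an
  inner automorphism brings \<open>A\<close> back to itself within the same outer class.\<close>

lemma Stab_rep:
  assumes A: "A \<subseteq> carrier G" and \<Phi>: "\<Phi> \<in> Stab G A"
  shows "\<exists>f\<in>auto G. f ` A = A \<and> \<Phi> = cls G f"
proof -
  have \<Phi>c: "\<Phi> \<in> carrier (Out G)" "out_action \<Phi> (conj_class G A) = conj_class G A"
    using \<Phi> by (auto simp: Stab_def stabilizer_def)
  obtain f where f: "f \<in> auto G" "\<Phi> = cls G f" using cls_surj[OF \<Phi>c(1)] by blast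
  have "conj_class G (f ` A) = conj_class G A"
    using out_action_coset[OF f(1) A] \<Phi>c(2) f(2) by (simp add: cls_def)
  moreover have fA: "f ` A \<subseteq> carrier G" using A f(1) auto_closed by blast
  then have "(\<lambda>x. \<one> \<otimes> x \<otimes> inv \<one>) ` (f ` A) = f ` A" by (force simp: image_iff)
  then have "f ` A \<in> conj_class G (f ` A)" unfolding conj_class_eq by blast
  ultimately have "f ` A \<in> conj_class G A" by simp
  then have "\<exists>g\<in>carrier G. f ` A = (\<lambda>x. g \<otimes> x \<otimes> inv g) ` A"
    unfolding conj_class_eq by blast
  then obtain g where g: "g \<in> carrier G" "f ` A = (\<lambda>x. g \<otimes> x \<otimes> inv g) ` A" by (rule bexE)
  let ?i = "\<lambda>x\<in>carrier G. inv g \<otimes> x \<otimes> inv (inv g)"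
  have i: "?i \<in> auto G" using inner_auto[of "inv g"] g by simp
  define h where "h = compose (carrier G) ?i f"
  have h: "h \<in> auto G" unfolding h_def by (rule auto_compose[OF i f(1)])
  have hx: "h x = inv g \<otimes> f x \<otimes> g" if "x \<in> carrier G" for x
    using that g auto_closed[OF f(1) that] by (simp add: h_def compose_def)
  have "h ` A = (\<lambda>x. inv g \<otimes> x \<otimes> g) ` (f ` A)"
    unfolding image_image using hx A by (intro image_cong) auto
  also have "\<dots> = A"
  proof -
    have "(\<lambda>x. inv g \<otimes> (g \<otimes> x \<otimes> inv g) \<otimes> g) ` A = (\<lambda>x. x) ` A"
      using g(1) A by (intro image_cong) (auto simp: m_assoc inv_cancel subset_iff)
    then show ?thesis unfolding g(2) image_image by simp
  qed
  finally have hA: "h ` A = A" .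
  have "cls G h = cls G f"
    using hx g by (intro cls_cong[OF h f(1), of "inv g"]) auto
  then show ?thesis using h hA f by auto
qed

lemma auto_inverse_image:
  assumes f': "\<And>x. x \<in> carrier G \<Longrightarrow> f' (f x) = x" and A: "A \<subseteq> carrier G" "f ` A = A"
  shows "f' ` A = A"
proof -
  have "f' ` f ` A = (\<lambda>x. x) ` A"
    unfolding image_image using f' A(1) by (intro image_cong) auto
  then show ?thesis using A(2) by simp
qed

lemma Stab_subgroup:
  assumes A: "A \<subseteq> carrier G"
  shows "subgroup (Stab G A) (Out G)"
proof (rule group.subgroupI[OF group_Out])
  show "Stab G A \<subseteq> carrier (Out G)" by (auto simp: Stab_def stabilizer_def)
  have "(\<lambda>x\<in>carrier G. x) ` A = (\<lambda>x. x) ` A" using A by (intro image_cong) auto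
  then have "(\<lambda>x\<in>carrier G. x) ` A = A" by simp
  then show "Stab G A \<noteq> {}" using Stab_cls[OF A id_auto] by blast
  show "inv\<^bsub>Out G\<^esub> \<Phi> \<in> Stab G A" if \<Phi>: "\<Phi> \<in> Stab G A" for \<Phi>
  proof -
    obtain f where f: "f \<in> auto G" "f ` A = A" "\<Phi> = cls G f" using Stab_rep[OF A \<Phi>] by blast
    obtain f' where f': "f' \<in> auto G" "\<And>x. x \<in> carrier G \<Longrightarrow> f' (f x) = x" using auto_inverse[OF f(1)] by metis
    show ?thesis
      using cls_inv[OF f(1) f'] Stab_cls[OF A f'(1) auto_inverse_image[OF f'(2) A f(2)]] f(3) by simp
  qed
  show "\<Phi> \<otimes>\<^bsub>Out G\<^esub> \<Psi> \<in> Stab G A" if \<Phi>\<Psi>: "\<Phi> \<in> Stab G A" "\<Psi> \<in> Stab G A" for \<Phi> \<Psi>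
  proof -
    obtain f where f: "f \<in> auto G" "f ` A = A" "\<Phi> = cls G f" using Stab_rep[OF A \<Phi>\<Psi>(1)] by blast
    obtain g where g: "g \<in> auto G" "g ` A = A" "\<Psi> = cls G g" using Stab_rep[OF A \<Phi>\<Psi>(2)] by blast
    have "compose (carrier G) f g ` A = f ` g ` A"
      unfolding image_image using A by (intro image_cong) (auto simp: compose_def)
    then have "cls G (compose (carrier G) f g) \<in> Stab G A"
      using f g by (intro Stab_cls[OF A auto_compose]) auto
    then show ?thesis using cls_mult f g by simp
  qed
qed

section \<open>Balls, finiteness of sets of automorphisms, and conjugated Schreier
  generators\<close>

lemma hom_word_ball:
  assumes X: "X \<subseteq> carrier G" and \<phi>: "\<phi> \<in> hom G G" and g: "g \<in> word_ball G X k"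
  shows "\<phi> g \<in> word_ball G (\<phi> ` X) k"
proof -
  obtain w where w: "w \<in> words X" "length w \<le> k" "g = word_value G w" using g by (auto simp: word_ball_def)
  have "\<phi> g = word_value G (map (apfst \<phi>) w)" using hom_word_value[OF X \<phi> is_group w(1)] w(3) by simp
  moreover have "map (apfst \<phi>) w \<in> words (\<phi> ` X)" using w(1) by (auto simp: words_iff)
  ultimately show ?thesis using w(2) unfolding word_ball_def by (intro image_eqI) auto
qed

lemma word_ball_subset: "X \<subseteq> X' \<Longrightarrow> word_ball G X k \<subseteq> word_ball G X' k"
  by (force simp: word_ball_def words_iff)

lemma finite_word_ball:
  assumes "finite X"
  shows "finite (word_ball G X k)"
proof -
  have "{w \<in> words X. length w \<le> k} = {w. set w \<subseteq> X \<times> UNIV \<and> length w \<le> k}"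
    by (auto simp: words_def)
  then show ?thesis
    using assms finite_lists_length_le[of "X \<times> (UNIV :: bool set)" k] by (simp add: word_ball_def)
qed

lemma finite_autos:
  assumes X: "X \<subseteq> carrier G" "generate G X = carrier G" "finite X" and B: "finite B"
  shows "finite {d \<in> auto G. \<forall>x\<in>X. d x \<in> B}" (is "finite ?D")
proof -
  have "inj_on (\<lambda>d. restrict d X) ?D"
  proof (rule inj_onI)
    fix d d' assume d: "d \<in> ?D" "d' \<in> ?D" "restrict d X = restrict d' X"
    have eq: "d x = d' x" if "x \<in> X" for x using d(3) that by (metis restrict_apply')
    show "d = d'"
    proof (rule extensionalityI[of _ "carrier G"])
      show "d \<in> extensional (carrier G)" "d' \<in> extensional (carrier G)" using d by (auto simp: auto_def Bij_def)
      show "d x = d' x" if "x \<in> carrier G" for x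
        using hom_eqI[OF X(1), of x d G d'] that X(2) d(1,2) eq auto_hom is_group by blast
    qed
  qed
  moreover have "(\<lambda>d. restrict d X) ` ?D \<subseteq> X \<rightarrow>\<^sub>E B" by auto
  moreover have "finite (X \<rightarrow>\<^sub>E B)" using X(3) B by (intro finite_PiE) auto
  ultimately show ?thesis by (meson finite_imageD finite_subset)
qed

lemma common_ball:
  assumes X: "X \<subseteq> carrier G" "generate G X = carrier G" and D: "finite D" "D \<subseteq> carrier G"
  shows "\<exists>k. D \<subseteq> word_ball G X k"
  using D
proof (induction D rule: finite_induct)
  case (insert d D)
  then obtain k where k: "D \<subseteq> word_ball G X k" by auto
  have "d \<in> word_value G ` words X" using insert.prems X generate_eq_words[OF X(1)] by simp
  then obtain w where w: "w \<in> words X" "d = word_value G w" by blast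
  have "d \<in> word_ball G X (max k (length w))"
    using w by (auto simp: word_ball_def)
  moreover have "D \<subseteq> word_ball G X (max k (length w))"
    using k word_ball_mono[of k "max k (length w)"] by auto
  ultimately show ?case by blast
qed simp

lemma schreier_gens_left_mult:
  assumes X: "X \<subseteq> carrier G" and c: "\<And>g. g \<in> carrier G \<Longrightarrow> c g \<in> carrier G" and u: "u \<in> carrier G"
  shows "schreier_gens G X (\<lambda>g. u \<otimes> c g) = (\<lambda>y. u \<otimes> y \<otimes> inv u) ` schreier_gens G X c"
proof -
  have val: "(u \<otimes> c (x \<otimes> g)) \<otimes> inv (u \<otimes> c g) = u \<otimes> (c (x \<otimes> g) \<otimes> inv (c g)) \<otimes> inv u"
    if "x \<in> X" "g \<in> carrier G" for x g
    using that X c[of g] c[of "x \<otimes> g"] u by (auto simp: inv_mult_group m_assoc)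
  have one: "u \<otimes> y \<otimes> inv u = \<one> \<longleftrightarrow> y = \<one>" if "y \<in> carrier G" for y
  proof
    assume "u \<otimes> y \<otimes> inv u = \<one>"
    then have "inv u \<otimes> (u \<otimes> y \<otimes> inv u) \<otimes> u = inv u \<otimes> \<one> \<otimes> u" by simp
    then show "y = \<one>" using u that by (simp add: m_assoc inv_cancel)
  qed (use u in simp)
  have cl: "c (x \<otimes> g) \<otimes> inv (c g) \<in> carrier G" if "x \<in> X" "g \<in> carrier G" for x g
    using that X c[of g] c[of "x \<otimes> g"] by auto
  show ?thesis
  proof (intro equalityI subsetI)
    fix y assume "y \<in> schreier_gens G X (\<lambda>g. u \<otimes> c g)"
    then obtain x g where x: "x \<in> X" "g \<in> carrier G" "y = (u \<otimes> c (x \<otimes> g)) \<otimes> inv (u \<otimes> c g)" "y \<noteq> \<one>"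
      unfolding schreier_gens_def by blast
    define z where "z = c (x \<otimes> g) \<otimes> inv (c g)"
    have "y = u \<otimes> z \<otimes> inv u" using x val by (simp add: z_def)
    moreover have "z \<noteq> \<one>" using x one[OF cl[OF x(1,2)]] calculation by (simp add: z_def)
    ultimately show "y \<in> (\<lambda>y. u \<otimes> y \<otimes> inv u) ` schreier_gens G X c"
      using x unfolding schreier_gens_def z_def by blast
  next
    fix y assume "y \<in> (\<lambda>y. u \<otimes> y \<otimes> inv u) ` schreier_gens G X c"
    then obtain x g where x: "x \<in> X" "g \<in> carrier G" "y = u \<otimes> (c (x \<otimes> g) \<otimes> inv (c g)) \<otimes> inv u" "c (x \<otimes> g) \<otimes> inv (c g) \<noteq> \<one>"
      unfolding schreier_gens_def by blast
    have "y = (u \<otimes> c (x \<otimes> g)) \<otimes> inv (u \<otimes> c g)" "y \<noteq> \<one>"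
      using x val one[OF cl[OF x(1,2)]] by simp_all
    then show "y \<in> schreier_gens G X (\<lambda>g. u \<otimes> c g)"
      using x unfolding schreier_gens_def by blast
  qed
qed

end

section \<open>The retraction in corank one\<close>

context corank_one
begin

lemma sub_hom: "f \<in> hom G H \<Longrightarrow> f \<in> hom (G\<lparr>carrier := A\<rparr>) H"
  using Ac by (auto simp: hom_def)

text \<open>The Schreier generators form a basis of \<open>A\<close> of the same size as
  \<open>Y\<close>, so some automorphism of \<open>A\<close> carries \<open>Y\<close> to them. It
  extends to the whole group for any choice of the left factor \<open>b\<close> of
  \<open>t\<close>.\<close>

lemma marking_auto:
  assumes X: "free_basis G X" and c: "schreier G A X c" and b: "b \<in> A"
  shows "\<exists>h\<in>auto G. h ` Y = schreier_gens G X c \<and> h t = b \<otimes> t"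
proof -
  let ?S = "G\<lparr>carrier := A\<rparr>" and ?Z = "schreier_gens G X c"
  interpret A: group ?S by (rule sub_group[OF A_subgroup])
  have Z: "free_basis ?S ?Z" by (rule nielsen_schreier(1)[OF X A_subgroup c])
  have ZA: "?Z \<subseteq> A" using A.free_basisD(1)[OF Z] by simp
  obtain \<sigma> where \<sigma>: "bij_betw \<sigma> Y ?Z"
    using finite_same_card_bij[OF finY gens(1)[OF X c]] gens(2)[OF X c] by auto
  obtain \<theta> where \<theta>: "\<theta> \<in> auto ?S" "\<And>y. y \<in> Y \<Longrightarrow> \<theta> y = \<sigma> y"
    using A.free_bases_auto[OF A_basis Z \<sigma>] by metis
  obtain \<theta>' where \<theta>': "\<theta>' \<in> auto ?S" "\<And>x. x \<in> A \<Longrightarrow> \<theta>' (\<theta> x) = x" "\<And>x. x \<in> A \<Longrightarrow> \<theta> (\<theta>' x) = x"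
    using A.auto_inverse[OF \<theta>(1)] by auto
  have \<theta>A: "\<theta> x \<in> A" "\<theta>' x \<in> A" if "x \<in> A" for x
    using A.auto_closed[OF \<theta>(1)] A.auto_closed[OF \<theta>'(1)] that by auto
  have \<theta>hom: "\<theta> \<in> hom ?S G" "\<theta>' \<in> hom ?S G"
    using A.auto_mult[OF \<theta>(1)] A.auto_mult[OF \<theta>'(1)] by (auto intro!: homI Ac(1) \<theta>A)
  have tY: "y \<noteq> t" if "y \<in> Y" for y using that tX by auto
  have "(\<lambda>x. if x = t then b \<otimes> t else \<theta> x) \<in> X0 \<rightarrow> carrier G"
    using X0_eq b tc Ac \<theta>A YA by auto
  then obtain \<phi> where \<phi>: "\<phi> \<in> hom G G" "\<And>x. x \<in> X0 \<Longrightarrow> \<phi> x = (if x = t then b \<otimes> t else \<theta> x)"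
    using free_basis_extend[OF basis0 is_group] by blast
  \<comment> \<open>The inverse has to undo \<open>b\<close> after it has been moved by
    \<open>\<theta>'\<close>.\<close>
  have "(\<lambda>x. if x = t then inv (\<theta>' b) \<otimes> t else \<theta>' x) \<in> X0 \<rightarrow> carrier G"
    using X0_eq b tc Ac \<theta>A YA by auto
  then obtain \<psi> where \<psi>: "\<psi> \<in> hom G G" "\<And>x. x \<in> X0 \<Longrightarrow> \<psi> x = (if x = t then inv (\<theta>' b) \<otimes> t else \<theta>' x)"
    using free_basis_extend[OF basis0 is_group] by blast
  have YS: "Y \<subseteq> carrier ?S" using YA by simp
  have genA: "generate ?S Y = A" using A.free_basis_generate[OF A_basis] by simp
  have on_A: "\<phi> x = \<theta> x" "\<psi> x = \<theta>' x" if "x \<in> A" for x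
  proof -
    have x: "x \<in> generate ?S Y" using that genA by simp
    show "\<phi> x = \<theta> x"
      by (rule A.hom_eqI[OF YS x sub_hom[OF \<phi>(1)] \<theta>hom(1) is_group]) (use \<phi>(2) YX tY in auto)
    show "\<psi> x = \<theta>' x"
      by (rule A.hom_eqI[OF YS x sub_hom[OF \<psi>(1)] \<theta>hom(2) is_group]) (use \<psi>(2) YX tY in auto)
  qed
  interpret p: group_hom G G \<phi> using \<phi>(1) is_group by (simp add: group_hom_def group_hom_axioms_def)
  interpret q: group_hom G G \<psi> using \<psi>(1) is_group by (simp add: group_hom_def group_hom_axioms_def)
  have gen0: "carrier G \<subseteq> generate G X0" using free_basis_generate[OF basis0] by simp
  have "\<psi> (\<phi> x) = x" "\<phi> (\<psi> x) = x" if "x \<in> X0" for x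
  proof -
    have bc: "b \<in> carrier G" "\<theta>' b \<in> A" "\<theta>' b \<in> carrier G" using b \<theta>A Ac by auto
    show "\<psi> (\<phi> x) = x"
    proof (cases "x = t")
      case True
      have "\<psi> (\<phi> t) = \<psi> (b \<otimes> t)" using \<phi>(2)[OF tX(1)] by simp
      also have "\<dots> = \<theta>' b \<otimes> (inv (\<theta>' b) \<otimes> t)"
        using bc tc on_A(2)[OF b] \<psi>(2)[OF tX(1)] by simp
      also have "\<dots> = t" using bc tc by (simp add: inv_cancel)
      finally show ?thesis using True by simp
    next
      case False
      then have "x \<in> Y" using that X0_eq by simp
      then show ?thesis using \<phi>(2)[OF that] False on_A(2)[OF \<theta>A(1)] \<theta>'(2) YA by auto
    qed
    show "\<phi> (\<psi> x) = x"
    proof (cases "x = t")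
      case True
      have "\<phi> (\<psi> t) = \<phi> (inv (\<theta>' b) \<otimes> t)" using \<psi>(2)[OF tX(1)] by simp
      also have "\<dots> = inv b \<otimes> (b \<otimes> t)"
        using bc tc on_A(1)[OF bc(2)] \<theta>'(3)[OF b] \<phi>(2)[OF tX(1)] by simp
      also have "\<dots> = t" using bc tc by (simp add: inv_cancel)
      finally show ?thesis using True by simp
    next
      case False
      then have "x \<in> Y" using that X0_eq by simp
      then show ?thesis using \<psi>(2)[OF that] False on_A(1)[OF \<theta>A(2)] \<theta>'(3) YA by auto
    qed
  qed
  then have "restrict \<phi> (carrier G) \<in> auto G"
    by (intro auto_of_inverse_homs[OF X0c gen0 X0c gen0 \<phi>(1) \<psi>(1)])
  moreover have "restrict \<phi> (carrier G) ` Y = \<sigma> ` Y"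
    using Yc \<phi>(2) YX tY \<theta>(2) by (intro image_cong) auto
  then have "restrict \<phi> (carrier G) ` Y = ?Z" using \<sigma> by (simp add: bij_betw_def)
  moreover have "restrict \<phi> (carrier G) t = b \<otimes> t" using tc \<phi>(2)[OF tX(1)] by simp
  ultimately show ?thesis by blast
qed

text \<open>A relation, since the map \<open>c\<close> and the bijection from \<open>Y\<close> to
  the generators are choices; \<open>compat_step\<close> bounds the ambiguity together with the
  effect of a change of basis.\<close>

definition compat :: "('a \<Rightarrow> 'a) \<Rightarrow> ('a \<Rightarrow> 'a) \<Rightarrow> bool" where
  "compat \<phi> h \<longleftrightarrow> \<phi> \<in> auto G \<and> h \<in> auto G \<and>
     (\<exists>c b. marking (\<phi> ` X0) c b \<and> h ` Y = schreier_gens G (\<phi> ` X0) c \<and> h t = b \<otimes> t)"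

lemma basis_image: "\<phi> \<in> auto G \<Longrightarrow> free_basis G (\<phi> ` X0)" "finite (\<phi> ` X0)"
  using free_basis_auto_image[OF basis0] fin0 by auto

lemma card_image_X0: "\<phi> \<in> auto G \<Longrightarrow> card (\<phi> ` X0) = card X0"
  using free_basis_card(2)[OF basis0 fin0 basis_image(1)] .

lemma compat_exists:
  assumes \<phi>: "\<phi> \<in> auto G"
  shows "\<exists>h. compat \<phi> h"
proof -
  obtain c b where m: "marking (\<phi> ` X0) c b" "b \<in> A"
    using marking_exists[OF basis_image(1)[OF \<phi>] basis_image(2)] by blast
  then have "schreier G A (\<phi> ` X0) c" by (simp add: marking_def)
  then show ?thesis
    using marking_auto[OF basis_image(1)[OF \<phi>] _ m(2)] m(1) \<phi> unfolding compat_def by blast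
qed

lemma compat_image:
  assumes "compat \<phi> h"
  shows "h ` A = A"
proof -
  obtain c b where cb: "\<phi> \<in> auto G" "h \<in> auto G" "marking (\<phi> ` X0) c b" "h ` Y = schreier_gens G (\<phi> ` X0) c"
    using assms unfolding compat_def by blast
  note basis = basis_image(1)[OF cb(1)]
  note X = free_basisD(1)[OF basis]
  have c: "coset_retraction G A c" using cb(3) by (auto simp: marking_def schreier_def)
  have sub: "schreier_gens G (\<phi> ` X0) c \<subseteq> A" by (rule schreier_gens_subset[OF A_subgroup X c])
  have "h ` A = generate G (schreier_gens G (\<phi> ` X0) c)"
    unfolding A_def generate_image[OF auto_hom[OF cb(2)] Yc] cb(4) ..
  also have "\<dots> = A"
    using schreier_gens_generate[OF A_subgroup X free_basis_generate[OF basis] c]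
      generate_subgroup_incl[OF sub A_subgroup] by blast
  finally show ?thesis .
qed

lemma compat_conjugate:
  assumes c: "compat \<phi> h" and \<phi>': "\<phi>' \<in> auto G" and w: "w \<in> carrier G"
    and eq: "\<And>x. x \<in> carrier G \<Longrightarrow> \<phi>' x = w \<otimes> \<phi> x \<otimes> inv w"
  shows "compat \<phi>' h"
proof -
  obtain c b where cb: "\<phi> \<in> auto G" "h \<in> auto G" "marking (\<phi> ` X0) c b"
    "h ` Y = schreier_gens G (\<phi> ` X0) c" "h t = b \<otimes> t"
    using c unfolding compat_def by blast
  note basis = basis_image(1)[OF cb(1)]
  have im: "\<phi>' ` X0 = (\<lambda>x. w \<otimes> x \<otimes> inv w) ` (\<phi> ` X0)"
    unfolding image_image using eq X0c by (intro image_cong) auto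
  have sch: "schreier G A (\<phi> ` X0) c" using cb(3) by (simp add: marking_def)
  have "A \<subseteq> carrier G" using Ac by blast
  then have "schreier_gens G (\<phi>' ` X0) (\<lambda>g. c (inv w \<otimes> g)) = schreier_gens G (\<phi> ` X0) c"
    unfolding im using schreier_conjugate(2)[OF free_basisD(1)[OF basis] sch _ w] by blast
  then show ?thesis
    unfolding compat_def using \<phi>' cb marking_conjugate[OF basis cb(3) w] unfolding im[symmetric] by metis
qed

text \<open>By \<open>marking_close\<close> the elements \<open>h' x\<close> are short words in the
  basis given by \<open>h\<close>. Applying the inverse of \<open>h\<close> turns this into a bound
  for the quotient of \<open>h\<close> and \<open>h'\<close> that mentions only \<open>X0\<close>.
  The final \<open>1\<close> in the radius is the factor \<open>h t\<close> of
  \<open>h' t\<close>.\<close>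

lemma compat_step:
  assumes c: "compat \<phi> h" and c': "compat \<phi>' h'" and ball: "\<phi>' ` X0 \<subseteq> word_ball G (\<phi> ` X0) k"
  defines "R \<equiv> oscillation (card X0) (card Y) k"
  shows "inv\<^bsub>Out G\<^esub> cls G h \<otimes>\<^bsub>Out G\<^esub> cls G h' \<in>
    cls G ` {d \<in> auto G. \<forall>x\<in>X0. d x \<in> word_ball G X0 (R + k + R + 1)}"
proof -
  obtain c b where cb: "\<phi> \<in> auto G" "h \<in> auto G" "marking (\<phi> ` X0) c b"
    "h ` Y = schreier_gens G (\<phi> ` X0) c" "h t = b \<otimes> t"
    using c unfolding compat_def by blast
  obtain c' b' where cb': "\<phi>' \<in> auto G" "h' \<in> auto G" "marking (\<phi>' ` X0) c' b'"
    "h' ` Y = schreier_gens G (\<phi>' ` X0) c'" "h' t = b' \<otimes> t"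
    using c' unfolding compat_def by blast
  note close = marking_close[OF basis_image(1)[OF cb(1)] basis_image(2) cb(3) cb'(3) ball,
      unfolded card_image_X0[OF cb(1)] R_def[symmetric] cb(4)[symmetric] cb'(4)[symmetric]]
  have hX: "h ` X0 \<subseteq> carrier G" using X0c cb(2) auto_closed by blast
  have sub: "word_ball G (h ` Y) l \<subseteq> word_ball G (h ` X0) l" for l
    using YX by (intro word_ball_subset) auto
  have near: "h' x \<in> word_ball G (h ` X0) (R + k + R + 1)" if "x \<in> X0" for x
  proof (cases "x = t")
    case True
    have bc: "b \<in> carrier G" "b' \<in> carrier G" using marking_b cb(3) cb'(3) Ac by blast+
    have eq: "h' t = (b' \<otimes> inv b) \<otimes> h t" using cb(5) cb'(5) bc tc by (simp add: m_assoc inv_cancel)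
    have 1: "b' \<otimes> inv b \<in> word_ball G (h ` X0) R" using close(1) sub by blast
    have 2: "h t \<in> word_ball G (h ` X0) 1" using tX by (intro word_ball_base[OF hX]) auto
    have "h' t \<in> word_ball G (h ` X0) (R + 1)" unfolding eq by (rule word_ball_mult[OF hX 1 2])
    then show ?thesis using True word_ball_mono[of "R + 1" "R + k + R + 1"] by simp
  next
    case False
    then have "h' x \<in> word_ball G (h ` X0) (R + k + R)" using that X0_eq close(2) sub by blast
    then show ?thesis using word_ball_mono[of "R + k + R" "R + k + R + 1"] by simp
  qed
  obtain g where g: "g \<in> auto G" "\<And>x. x \<in> carrier G \<Longrightarrow> g (h x) = x" using auto_inverse[OF cb(2)] by metis
  define d where "d = compose (carrier G) g h'"
  have d: "d \<in> auto G" unfolding d_def by (rule auto_compose[OF g(1) cb'(2)])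
  have "d x \<in> word_ball G X0 (R + k + R + 1)" if "x \<in> X0" for x
  proof -
    have "g ` h ` X0 = (\<lambda>x. x) ` X0" unfolding image_image using g(2) X0c by (intro image_cong) auto
    then show ?thesis
      using hom_word_ball[OF hX auto_hom[OF g(1)] near[OF that]] that X0c by (auto simp: d_def compose_def)
  qed
  moreover have "inv\<^bsub>Out G\<^esub> cls G h \<otimes>\<^bsub>Out G\<^esub> cls G h' = cls G d"
    using cls_inv[OF cb(2) g] cls_mult[OF g(1) cb'(2)] by (simp add: d_def)
  ultimately show ?thesis using d by blast
qed

text \<open>For the basis given by \<open>h\<close> the map \<open>c0\<close> of the standard basis
  can be transported by \<open>h\<close>. Its limits are limits of \<open>c0\<close> along the rays
  pulled back by the inverse of \<open>h\<close>; by \<open>auto_form\<close> these run through a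
  coset of \<open>t\<close> or its inverse, where \<open>c0\<close> takes finitely many
  values.\<close>

lemma compat_identity:
  "\<exists>D. finite D \<and> D \<subseteq> auto G \<and> (\<forall>h\<in>auto G. h ` A = A \<longrightarrow>
    (\<exists>k. compat h k \<and> inv\<^bsub>Out G\<^esub> cls G h \<otimes>\<^bsub>Out G\<^esub> cls G k \<in> cls G ` D))"
proof -
  obtain c0 where c0: "schreier G A X0 c0"
    using schreier_exists[OF A_subgroup X0c fin0 free_basis_generate[OF basis0]] by blast
  define V where "V = (\<Union>e. {c0 (u \<otimes> letter_value G (t, e)) | u. u \<in> A})"
  have finV: "finite V" unfolding V_def by (rule finite_UN_I[OF finite finite_values[OF c0]])
  have VI: "c0 (u \<otimes> letter_value G (t, e)) \<in> V" if "u \<in> A" for u e using that unfolding V_def by blast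
  \<comment> \<open>The possible images of a basis element under the error \<open>d\<close>: a
    Schreier generator of \<open>c0\<close> for elements of \<open>Y\<close>, and a power of
    \<open>t\<close> between two values from \<open>V\<close> for \<open>t\<close>.\<close>
  define B where "B = schreier_gens G X0 c0 \<union>
    (\<lambda>(v, v', e). v \<otimes> letter_value G (t, e) \<otimes> inv v') ` (V \<times> V \<times> UNIV)"
  have finB: "finite B" unfolding B_def using finV gens(1)[OF basis0 c0]
    by (intro finite_UnI finite_imageI finite_cartesian_product finite)
  define D where "D = {d \<in> auto G. \<forall>x\<in>X0. d x \<in> B}"
  have finD: "finite D"
    unfolding D_def by (rule finite_autos[OF X0c free_basis_generate[OF basis0] fin0 finB])
  have "\<exists>k. compat h k \<and> inv\<^bsub>Out G\<^esub> cls G h \<otimes>\<^bsub>Out G\<^esub> cls G k \<in> cls G ` D"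
    if h: "h \<in> auto G" "h ` A = A" for h
  proof -
    obtain h' where h': "h' \<in> auto G" "\<And>x. x \<in> carrier G \<Longrightarrow> h' (h x) = x" "\<And>x. x \<in> carrier G \<Longrightarrow> h (h' x) = x"
      using auto_inverse[OF h(1)] by metis
    have AG: "A \<subseteq> carrier G" using Ac by blast
    have h'A: "h' ` A = A" by (rule auto_inverse_image[OF h'(2) AG h(2)])
    have h'c: "h' x \<in> carrier G \<and> h (h' x) = x \<and> h' (h x) = x" if "x \<in> carrier G" for x
      using auto_closed[OF h'(1) that] h'(2,3)[OF that] by simp
    note hm = auto_mult[OF h(1)] and hi = auto_inv[OF h(1)] and hc = auto_closed[OF h(1)]
    note h'm = auto_mult[OF h'(1)] and h'i = auto_inv[OF h'(1)]
    \<comment> \<open>The rays are pulled back by \<open>h'\<close>, so it is the form of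
      \<open>h' t\<close> that matters.\<close>
    obtain u v e where uv: "u \<in> A" "v \<in> A" "h' t = u \<otimes> letter_value G (t, e) \<otimes> v"
      using auto_form[OF h'(1) h'A] by blast
    define L where "L = letter_value G (t, e)"
    define c where "c g = h (c0 (h' g))" for g
    have c: "schreier G A (h ` X0) c" "schreier_gens G (h ` X0) c = h ` schreier_gens G X0 c0"
      using schreier_transport[OF X0c c0 AG h h'c auto_hom[OF h'(1)]] unfolding c_def by simp_all
    have cc0: "c0 g \<in> A" "c0 g \<in> carrier G" if "g \<in> carrier G" for g
      using coset_retractionD(1)[OF schreierD(1)[OF c0] that] Ac by auto
    have c0m: "c0 (g \<otimes> x) = c0 g \<otimes> x" if "g \<in> carrier G" "x \<in> A" for g x
      using coset_retractionD(2)[OF schreierD(1)[OF c0] that] .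
    define a1 where "a1 = h' a"
    have a1: "a1 \<in> A" "a1 [^] (i :: nat) \<in> A" for i
    proof -
      show "a1 \<in> A" using aA h'A by (auto simp: a1_def)
      then show "a1 [^] i \<in> A" by (induction i) (auto simp: Ac)
    qed
    have h'pow: "h' (a [^] (i :: nat)) = a1 [^] i" for i
    proof (induction i)
      case 0
      show ?case using hom_one[OF auto_hom[OF h'(1)] is_group is_group] by simp
    next
      case (Suc i)
      then show ?case using h'm ac by (simp add: a1_def)
    qed
    have a1_pow: "a1 [^] k \<noteq> \<one>" if "0 < k" for k :: nat
    proof
      assume "a1 [^] k = \<one>"
      then have "h (h' (a [^] k)) = h \<one>" by (simp add: h'pow)
      then have "a [^] k = \<one>" using h'c[of "a [^] k"] ac hom_one[OF auto_hom[OF h(1)] is_group is_group] by simp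
      then show False using pow_ne_one[OF that] by simp
    qed
    \<comment> \<open>The limit is attained, so it is a value of \<open>c0\<close> at a product of
      an element of \<open>A\<close> and a power of \<open>t\<close>, and belongs to the set
      \<open>V\<close>, which does not depend on \<open>h\<close>.\<close>
    have lim: thesis
      if x: "x \<in> A" and thesis: "\<And>z. z \<in> V \<Longrightarrow> z \<in> A \<Longrightarrow>
        \<forall>\<^sub>F i in sequentially. c0 (a1 [^] i \<otimes> (x \<otimes> letter_value G (t, f))) = z \<Longrightarrow> thesis" for x f thesis
    proof -
      define s where "s i = a1 [^] i \<otimes> (x \<otimes> letter_value G (t, f))" for i :: nat
      have sc: "s i \<in> carrier G" for i using a1(2)[of i] x tl Ac by (simp add: s_def)
      have a1c: "a1 \<in> carrier G" using a1 Ac by blast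
      have sSuc: "s (Suc i) = a1 \<otimes> s i" for i
        using a1(2)[of i] a1c x tl Ac nat_pow_comm[OF a1c, of 1 i] by (simp add: s_def m_assoc[symmetric])
      have ssep: "inv (s i) \<otimes> s j \<notin> A" if "i < j" for i j
        unfolding s_def by (rule twisted_ray_sep[OF x a1(1) a1_pow that])
      obtain z where z: "z \<in> A" "\<forall>\<^sub>F i in sequentially. c0 (s i) = z"
        by (rule eventually_const[where s = s, OF basis0 A_subgroup c0 gens(1)[OF basis0 c0] sc ssep a1c sSuc])
      then obtain i where "c0 (s i) = z" by (auto simp: eventually_sequentially)
      moreover have "s i = (a1 [^] i \<otimes> x) \<otimes> letter_value G (t, f)"
        using a1(2)[of i] x tl Ac by (simp add: s_def m_assoc)
      ultimately have "z \<in> V" using VI[of "a1 [^] i \<otimes> x" f] a1(2)[of i] x Ac by metis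
      then show thesis using z thesis unfolding s_def by blast
    qed
    obtain v1 where v1: "v1 \<in> V" "v1 \<in> A" "\<forall>\<^sub>F i in sequentially. c0 (a1 [^] i \<otimes> (u \<otimes> L)) = v1"
      unfolding L_def by (rule lim[OF uv(1), of e])
    obtain v2 where v2: "v2 \<in> V" "v2 \<in> A"
      "\<forall>\<^sub>F i in sequentially. c0 (a1 [^] i \<otimes> (inv v \<otimes> letter_value G (t, \<not> e))) = v2"
      by (rule lim[OF Ac(3)[OF uv(2)], of "\<not> e"])
    have Lc: "L \<in> carrier G" "inv L = letter_value G (t, \<not> e)" using tl inv_tl by (auto simp: L_def)
    have uvc: "u \<in> carrier G" "v \<in> carrier G" "v1 \<in> carrier G" "v2 \<in> carrier G" using uv v1 v2 Ac by auto
    have rT: "h' (ray True i) = (a1 [^] i \<otimes> (u \<otimes> L)) \<otimes> v" for i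
    proof -
      have "ray True i = a [^] i \<otimes> t" by (simp add: ray_def letter_value_def)
      then show ?thesis
        using uv(3)[folded L_def] h'm ac tc h'pow a1(2)[of i] uvc Lc(1) Ac by (simp add: m_assoc)
    qed
    have rF: "h' (ray False i) = (a1 [^] i \<otimes> (inv v \<otimes> letter_value G (t, \<not> e))) \<otimes> inv u" for i
    proof -
      have "h' (ray False i) = a1 [^] i \<otimes> inv (h' t)"
        using h'm h'i ac tc h'pow by (simp add: ray_def letter_value_def)
      also have "inv (h' t) = inv v \<otimes> (inv L \<otimes> inv u)"
        unfolding uv(3) L_def[symmetric] using uvc Lc(1) by (simp add: inv_mult_group m_assoc)
      finally show ?thesis using uvc Lc(1) a1(2)[of i] Ac unfolding Lc(2)[symmetric] by (simp add: m_assoc)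
    qed
    \<comment> \<open>The limits of \<open>c\<close> on the two rays; the trailing factors
      \<open>v\<close> and \<open>inv u\<close> of the pulled back rays come out by
      equivariance.\<close>
    define \<alpha> where "\<alpha> = h (v1 \<otimes> v)"
    define \<beta> where "\<beta> = h (v2 \<otimes> inv u)"
    have \<alpha>A: "\<alpha> \<in> A" "\<beta> \<in> A" using h(2) uv v1 v2 Ac by (auto simp: \<alpha>_def \<beta>_def)
    have \<alpha>c: "\<alpha> \<in> carrier G" "\<beta> \<in> carrier G" using \<alpha>A Ac by auto
    have evT: "\<forall>\<^sub>F i in sequentially. c (ray True i) = \<alpha>"
      using v1(3)
    proof eventually_elim
      case (elim i)
      have "c0 (h' (ray True i)) = v1 \<otimes> v"
        unfolding rT using elim c0m[of "a1 [^] i \<otimes> (u \<otimes> L)" v] uv(2) uvc Lc a1(2)[of i] Ac by simp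
      then show ?case by (simp add: c_def \<alpha>_def)
    qed
    have evF: "\<forall>\<^sub>F i in sequentially. c (ray False i) = \<beta>"
      using v2(3)
    proof eventually_elim
      case (elim i)
      have "c0 (h' (ray False i)) = v2 \<otimes> inv u"
        unfolding rF using elim c0m[of "a1 [^] i \<otimes> (inv v \<otimes> letter_value G (t, \<not> e))" "inv u"] uv uvc tl a1(2)[of i] Ac
        by simp
      then show ?case by (simp add: c_def \<beta>_def)
    qed
    have mark: "marking (h ` X0) (\<lambda>g. inv \<alpha> \<otimes> c g) (inv \<alpha> \<otimes> \<beta>)"
      unfolding marking_def
    proof (intro conjI)
      show "schreier G A (h ` X0) (\<lambda>g. inv \<alpha> \<otimes> c g)" using \<alpha>A Ac by (intro schreier_left_mult[OF A_subgroup c(1)]) auto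
      show "\<forall>\<^sub>F i in sequentially. inv \<alpha> \<otimes> c (ray True i) = \<one>"
        using evT by eventually_elim (use \<alpha>c in simp)
      show "\<forall>\<^sub>F i in sequentially. inv \<alpha> \<otimes> c (ray False i) = inv \<alpha> \<otimes> \<beta>"
        using evF by eventually_elim simp
    qed
    note bas = basis_image(1)[OF h(1)]
    have cc: "c g \<in> carrier G" if "g \<in> carrier G" for g
      using coset_retractionD(1)[OF schreierD(1)[OF c(1)] that] Ac by blast
    have gens_eq: "schreier_gens G (h ` X0) (\<lambda>g. inv \<alpha> \<otimes> c g) = (\<lambda>y. inv \<alpha> \<otimes> h y \<otimes> \<alpha>) ` schreier_gens G X0 c0"
      using schreier_gens_left_mult[of "h ` X0" c "inv \<alpha>"] free_basisD(1)[OF bas] cc \<alpha>c c(2) by (simp add: image_image)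
    have "schreier G A (h ` X0) (\<lambda>g. inv \<alpha> \<otimes> c g)" using mark by (simp add: marking_def)
    then obtain k where k: "k \<in> auto G" "k ` Y = schreier_gens G (h ` X0) (\<lambda>g. inv \<alpha> \<otimes> c g)" "k t = inv \<alpha> \<otimes> \<beta> \<otimes> t"
      using marking_auto[OF bas] marking_b[OF mark] by blast
    have compat: "compat h k"
      unfolding compat_def using h(1) k mark by blast
    let ?i = "\<lambda>x\<in>carrier G. \<alpha> \<otimes> x \<otimes> inv \<alpha>"
    have i: "?i \<in> auto G" by (rule inner_auto[OF \<alpha>c(1)])
    \<comment> \<open>Normalizing \<open>c\<close> by \<open>inv \<alpha>\<close> has conjugated its
      generators. The inner automorphism by \<open>\<alpha>\<close> undoes this without changing the
      outer class.\<close>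
    define d where "d = compose (carrier G) h' (compose (carrier G) ?i k)"
    have d: "d \<in> auto G" unfolding d_def by (intro auto_compose h'(1) i k(1))
    have kc: "k x \<in> carrier G" if "x \<in> carrier G" for x using auto_closed[OF k(1) that] .
    have dx: "d x = h' (\<alpha> \<otimes> k x \<otimes> inv \<alpha>)" if "x \<in> carrier G" for x
      using that kc[OF that] by (simp add: d_def compose_def)
    have "d x \<in> B" if "x \<in> X0" for x
    proof (cases "x = t")
      case True
      have "\<alpha> \<otimes> k t \<otimes> inv \<alpha> = \<beta> \<otimes> t \<otimes> inv \<alpha>" using k(3) \<alpha>c tc by (simp add: m_assoc inv_cancel)
      moreover have "h' \<beta> = v2 \<otimes> inv u" "h' \<alpha> = v1 \<otimes> v"
        unfolding \<beta>_def \<alpha>_def using h'(2) uvc by simp_all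
      ultimately have "d t = v2 \<otimes> inv u \<otimes> (u \<otimes> L \<otimes> v) \<otimes> inv (v1 \<otimes> v)"
        using dx[OF tc] h'm h'i \<alpha>c tc uv(3) by (simp add: L_def)
      \<comment> \<open>The unbounded factors \<open>u\<close> and \<open>v\<close> cancel, and
        values from \<open>V\<close> remain.\<close>
      also have "\<dots> = v2 \<otimes> L \<otimes> inv v1"
        using uvc Lc by (simp add: m_assoc inv_mult_group inv_cancel)
      finally have "d t = v2 \<otimes> L \<otimes> inv v1" .
      then show ?thesis
        unfolding True B_def L_def using v1(1) v2(1) by (intro UnI2 image_eqI[of _ _ "(v2, v1, e)"]) auto
    next
      case False
      then have "k x \<in> (\<lambda>y. inv \<alpha> \<otimes> h y \<otimes> \<alpha>) ` schreier_gens G X0 c0"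
        using that X0_eq k(2) gens_eq by blast
      then obtain y where y: "y \<in> schreier_gens G X0 c0" "k x = inv \<alpha> \<otimes> h y \<otimes> \<alpha>" by blast
      have yc: "y \<in> carrier G" using y(1) schreier_gens_subset[OF A_subgroup X0c schreierD(1)[OF c0]] Ac by blast
      have xc: "x \<in> carrier G" using that X0c by blast
      have "\<alpha> \<otimes> k x \<otimes> inv \<alpha> = h y" using y(2) \<alpha>c hc[OF yc] by (simp add: m_assoc inv_cancel)
      then have "d x = y" using dx[OF xc] h'(2)[OF yc] by simp
      then show ?thesis using y(1) by (simp add: B_def)
    qed
    then have "d \<in> D" using d by (simp add: D_def)
    moreover have "cls G (compose (carrier G) ?i k) = cls G k"
      using kc by (intro cls_cong[OF auto_compose[OF i k(1)] k(1) \<alpha>c(1)]) (simp add: compose_def)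
    then have "inv\<^bsub>Out G\<^esub> cls G h \<otimes>\<^bsub>Out G\<^esub> cls G k = cls G d"
      using cls_inv[OF h(1) h'(1,2)] cls_mult[OF h'(1) auto_compose[OF i k(1)]] by (simp add: d_def)
    ultimately show ?thesis using compat by blast
  qed
  moreover have "D \<subseteq> auto G" by (auto simp: D_def)
  ultimately show ?thesis using finD by blast
qed

theorem Stab_lipschitz_retract:
  assumes S: "finite_generating_set (Out G) S" and T: "finite_generating_set ((Out G)\<lparr>carrier := Stab G A\<rparr>) T"
  shows "lipschitz_retract (Out G) S (Stab G A) T"
proof -
  interpret Out: group "Out G" by (rule group_Out)
  have AG: "A \<subseteq> carrier G" using Ac by blast
  note H = Stab_subgroup[OF AG]
  note Hc = subgroup.mem_carrier[OF H] subgroup.m_closed[OF H] subgroup.m_inv_closed[OF H] subgroup.one_closed[OF H]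
  have Sc: "S \<subseteq> carrier (Out G)" "finite S" using S by (auto simp: finite_generating_set_def)
  have "\<exists>f\<in>auto G. letter_value (Out G) s = cls G f" if "s \<in> S \<times> UNIV" for s
    using cls_surj[OF Out.letter_closed[OF Sc(1), of s]] that by (auto simp: mem_Times_iff)
  then obtain r where r: "\<And>s. s \<in> S \<times> UNIV \<Longrightarrow> r s \<in> auto G \<and> letter_value (Out G) s = cls G (r s)" by metis
  have "finite ((\<lambda>(s, x). r s x) ` ((S \<times> UNIV) \<times> X0))" using Sc(2) fin0 by simp
  moreover have "(\<lambda>(s, x). r s x) ` ((S \<times> UNIV) \<times> X0) \<subseteq> carrier G"
    using r X0c auto_closed by (auto simp: subset_iff)
  ultimately obtain k where k: "(\<lambda>(s, x). r s x) ` ((S \<times> UNIV) \<times> X0) \<subseteq> word_ball G X0 k"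
    using common_ball[OF X0c free_basis_generate[OF basis0]] by blast
  define R where "R = oscillation (card X0) (card Y) k"
  define N where "N = cls G ` {d \<in> auto G. \<forall>x\<in>X0. d x \<in> word_ball G X0 (R + k + R + 1)}"
  have finN: "finite N"
    unfolding N_def by (intro finite_imageI finite_autos[OF X0c free_basis_generate[OF basis0] fin0] finite_word_ball fin0)
  from compat_identity obtain D where D: "finite D" "D \<subseteq> auto G"
    and D': "\<forall>h\<in>auto G. h ` A = A \<longrightarrow>
      (\<exists>k. compat h k \<and> inv\<^bsub>Out G\<^esub> cls G h \<otimes>\<^bsub>Out G\<^esub> cls G k \<in> cls G ` D)"
    by (elim exE conjE)
  \<comment> \<open>The identity serves the existence of related elements; the inverse errors relate
    every element of the stabilizer to itself.\<close>
  define \<Delta> where "\<Delta> = insert \<one>\<^bsub>Out G\<^esub> ((\<lambda>d. inv\<^bsub>Out G\<^esub> cls G d) ` D)"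
  have \<Delta>: "finite \<Delta>" "\<Delta> \<subseteq> carrier (Out G)" using D cls_carrier by (auto simp: \<Delta>_def)
  define rel where "rel \<Phi> \<Psi> \<longleftrightarrow> (\<exists>\<phi> h \<delta>. \<Phi> = cls G \<phi> \<and> compat \<phi> h \<and> \<delta> \<in> \<Delta> \<and> \<Psi> = cls G h \<otimes>\<^bsub>Out G\<^esub> \<delta>)" for \<Phi> \<Psi>
  define W where "W = (\<lambda>(\<delta>, \<nu>, \<delta>'). inv\<^bsub>Out G\<^esub> \<delta> \<otimes>\<^bsub>Out G\<^esub> \<nu> \<otimes>\<^bsub>Out G\<^esub> \<delta>') ` (\<Delta> \<times> N \<times> \<Delta>)"
  show ?thesis
  proof (rule Out.lipschitz_retractI[OF H S T, of rel W])
    fix \<Phi> assume "\<Phi> \<in> carrier (Out G)"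
    then obtain \<phi> where \<phi>: "\<phi> \<in> auto G" "\<Phi> = cls G \<phi>" using cls_surj by blast
    obtain h where h: "compat \<phi> h" using compat_exists[OF \<phi>(1)] by blast
    have ha: "h \<in> auto G" using h by (simp add: compat_def)
    have "rel \<Phi> (cls G h)"
      unfolding rel_def using \<phi> h cls_carrier[OF ha] by (intro exI[of _ \<phi>] exI[of _ h] exI[of _ "\<one>\<^bsub>Out G\<^esub>"]) (simp add: \<Delta>_def)
    moreover have "cls G h \<in> Stab G A" by (rule Stab_cls[OF AG ha compat_image[OF h]])
    ultimately show "\<exists>\<Psi>\<in>Stab G A. rel \<Phi> \<Psi>" by blast
  next
    fix \<Psi> assume "\<Psi> \<in> Stab G A"
    then obtain h where h: "h \<in> auto G" "h ` A = A" "\<Psi> = cls G h" using Stab_rep[OF AG] by blast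
    obtain m d where m: "compat h m" and d: "d \<in> D" "inv\<^bsub>Out G\<^esub> cls G h \<otimes>\<^bsub>Out G\<^esub> cls G m = cls G d"
      using D'[rule_format, OF h(1,2)] by blast
    have mc: "cls G m \<in> carrier (Out G)" "cls G h \<in> carrier (Out G)" "cls G d \<in> carrier (Out G)"
      using m h d D cls_carrier by (auto simp: compat_def)
    have "cls G h = cls G m \<otimes>\<^bsub>Out G\<^esub> inv\<^bsub>Out G\<^esub> cls G d"
      unfolding d(2)[symmetric] using mc by (simp add: Out.inv_mult_group Out.inv_cancel)
    then show "rel \<Psi> \<Psi>"
      unfolding rel_def h(3) using m d(1) by (intro exI[of _ h] exI[of _ m] exI[of _ "inv\<^bsub>Out G\<^esub> cls G d"]) (simp add: \<Delta>_def)
  next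
    show "finite W" unfolding W_def using \<Delta>(1) finN by blast
  next
    fix \<Phi> s \<Psi> \<Psi>'
    assume s: "fst s \<in> S" and \<Psi>: "rel \<Phi> \<Psi>" and \<Psi>': "rel (\<Phi> \<otimes>\<^bsub>Out G\<^esub> letter_value (Out G) s) \<Psi>'"
    obtain \<phi> h \<delta> where 1: "\<Phi> = cls G \<phi>" "compat \<phi> h" "\<delta> \<in> \<Delta>" "\<Psi> = cls G h \<otimes>\<^bsub>Out G\<^esub> \<delta>"
      using \<Psi> unfolding rel_def by blast
    obtain \<phi>' h' \<delta>' where 2: "\<Phi> \<otimes>\<^bsub>Out G\<^esub> letter_value (Out G) s = cls G \<phi>'" "compat \<phi>' h'" "\<delta>' \<in> \<Delta>"
      "\<Psi>' = cls G h' \<otimes>\<^bsub>Out G\<^esub> \<delta>'"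
      using \<Psi>' unfolding rel_def by blast
    have au: "\<phi> \<in> auto G" "\<phi>' \<in> auto G" "h \<in> auto G" "h' \<in> auto G" using 1(2) 2(2) by (auto simp: compat_def)
    have sS: "s \<in> S \<times> UNIV" using s by (simp add: mem_Times_iff)
    have rs: "r s \<in> auto G" "letter_value (Out G) s = cls G (r s)" using r[OF sS] by auto
    \<comment> \<open>Right multiplication by a generator precomposes with \<open>r s\<close>, so
      the new basis consists of words of length at most \<open>k\<close> in the old one. The given
      representative \<open>\<phi>'\<close> of the same class differs by a conjugation, to which
      \<open>compat\<close> is insensitive.\<close>
    define \<chi> where "\<chi> = compose (carrier G) \<phi> (r s)"
    have \<chi>: "\<chi> \<in> auto G" unfolding \<chi>_def by (rule auto_compose[OF au(1) rs(1)])
    have "cls G \<chi> = cls G \<phi>'"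
      using 2(1) 1(1) rs(2) cls_mult[OF au(1) rs(1)] by (simp add: \<chi>_def)
    then obtain w where "w \<in> carrier G" "\<And>x. x \<in> carrier G \<Longrightarrow> \<chi> x = w \<otimes> \<phi>' x \<otimes> inv w"
      using cls_eqD[OF \<chi> au(2)] by blast
    then have comp: "compat \<chi> h'" by (rule compat_conjugate[OF 2(2) \<chi>])
    have "\<chi> x \<in> word_ball G (\<phi> ` X0) k" if "x \<in> X0" for x
    proof -
      have "r s x \<in> word_ball G X0 k" using k sS that by auto
      then show ?thesis using hom_word_ball[OF X0c auto_hom[OF au(1)]] that X0c by (auto simp: \<chi>_def compose_def)
    qed
    then have "\<chi> ` X0 \<subseteq> word_ball G (\<phi> ` X0) k" by blast
    then have \<nu>: "inv\<^bsub>Out G\<^esub> cls G h \<otimes>\<^bsub>Out G\<^esub> cls G h' \<in> N"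
      using compat_step[OF 1(2) comp] unfolding N_def R_def by blast
    have "inv\<^bsub>Out G\<^esub> \<Psi> \<otimes>\<^bsub>Out G\<^esub> \<Psi>' = inv\<^bsub>Out G\<^esub> \<delta> \<otimes>\<^bsub>Out G\<^esub> (inv\<^bsub>Out G\<^esub> cls G h \<otimes>\<^bsub>Out G\<^esub> cls G h') \<otimes>\<^bsub>Out G\<^esub> \<delta>'"
      unfolding 1(4) 2(4) using 1(3) 2(3) \<Delta>(2) au cls_carrier by (simp add: Out.inv_mult_group Out.m_assoc subset_iff)
    then show "inv\<^bsub>Out G\<^esub> \<Psi> \<otimes>\<^bsub>Out G\<^esub> \<Psi>' \<in> W"
      unfolding W_def using 1(3) 2(3) \<nu> by (intro image_eqI[of _ _ "(\<delta>, inv\<^bsub>Out G\<^esub> cls G h \<otimes>\<^bsub>Out G\<^esub> cls G h', \<delta>')"]) auto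
  qed
qed

end

section \<open>Twisting along a cyclic subgroup\<close>

definition Zgroup :: "int monoid" where
  "Zgroup = \<lparr>carrier = UNIV, mult = (+), one = 0\<rparr>"

lemma group_Zgroup: "group Zgroup"
  by (rule groupI) (auto simp: Zgroup_def intro: exI[of _ "- x" for x])

locale cyclic_marking = based_free_group +
  assumes Y_eq: "Y = {a}"
begin

definition expo :: "'a \<Rightarrow> int" where
  "expo = (SOME \<chi>. \<chi> \<in> hom (G\<lparr>carrier := A\<rparr>) Zgroup \<and> \<chi> a = 1)"

lemma expo_hom: "expo \<in> hom (G\<lparr>carrier := A\<rparr>) Zgroup" and expo_a: "expo a = 1"
proof -
  interpret A: group "G\<lparr>carrier := A\<rparr>" by (rule sub_group[OF A_subgroup])
  have "(\<lambda>_. 1) \<in> Y \<rightarrow> carrier Zgroup" by (simp add: Zgroup_def)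
  then have "\<exists>\<chi>. \<chi> \<in> hom (G\<lparr>carrier := A\<rparr>) Zgroup \<and> \<chi> a = 1"
    using A.free_basis_extend[OF A_basis group_Zgroup] aY by blast
  from someI_ex[OF this] show "expo \<in> hom (G\<lparr>carrier := A\<rparr>) Zgroup" "expo a = 1"
    by (simp_all add: expo_def)
qed

lemma expo_mult: "x \<in> A \<Longrightarrow> y \<in> A \<Longrightarrow> expo (x \<otimes> y) = expo x + expo y"
  using expo_hom by (auto simp: hom_def Zgroup_def)

lemma expo_one: "expo \<one> = 0"
  using expo_mult[of \<one> \<one>] Ac(4) by simp

lemma expo_inv: "x \<in> A \<Longrightarrow> expo (inv x) = - expo x"
  using expo_mult[of x "inv x"] expo_one Ac by simp

lemma expo_pow: "expo (a [^] (k :: nat)) = int k"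
proof (induction k)
  case (Suc k)
  then show ?case using expo_mult[of "a [^] k" a] aA expo_a by simp
qed (simp add: expo_one)

text \<open>The homomorphism to the integers that takes \<open>y\<close> to 1 is a multiple of
  \<open>expo\<close>, so \<open>expo y\<close> divides 1. Hence exponents bound word lengths from
  below uniformly in all Schreier bases of \<open>A\<close>.\<close>

lemma expo_basis:
  assumes Z: "free_basis (G\<lparr>carrier := A\<rparr>) Z" and y: "y \<in> Z"
  shows "\<bar>expo y\<bar> = 1"
proof -
  interpret A: group "G\<lparr>carrier := A\<rparr>" by (rule sub_group[OF A_subgroup])
  have "(\<lambda>_. 1) \<in> Z \<rightarrow> carrier Zgroup" by (simp add: Zgroup_def)
  then obtain \<chi> where \<chi>: "\<chi> \<in> hom (G\<lparr>carrier := A\<rparr>) Zgroup" "\<chi> y = 1"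
    using A.free_basis_extend[OF Z group_Zgroup] y by blast
  define \<eta> where "\<eta> x = \<chi> a * expo x" for x
  have \<eta>: "\<eta> \<in> hom (G\<lparr>carrier := A\<rparr>) Zgroup"
    by (rule homI) (simp_all add: \<eta>_def Zgroup_def expo_mult distrib_left)
  have gen: "y \<in> generate (G\<lparr>carrier := A\<rparr>) Y"
    using A.free_basis_generate[OF A_basis] A.free_basisD(1)[OF Z] y by auto
  have "\<chi> y = \<eta> y"
  proof (rule A.hom_eqI[OF _ gen \<chi>(1) \<eta> group_Zgroup])
    show "Y \<subseteq> carrier (G\<lparr>carrier := A\<rparr>)" using YA by simp
    show "\<chi> x = \<eta> x" if "x \<in> Y" for x using that Y_eq expo_a by (simp add: \<eta>_def)
  qed
  then have "\<chi> y = \<chi> a * expo y" by (simp add: \<eta>_def)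
  then have "\<chi> a * expo y = 1" using \<chi>(2) by simp
  then show ?thesis by (auto simp: zmult_eq_1_iff)
qed

lemma expo_ball:
  assumes X: "free_basis G X" and c: "schreier G A X c" and g: "g \<in> word_ball G (schreier_gens G X c) k"
  shows "\<bar>expo g\<bar> \<le> int k"
proof -
  let ?Z = "schreier_gens G X c"
  have Z: "free_basis (G\<lparr>carrier := A\<rparr>) ?Z" by (rule nielsen_schreier(1)[OF X A_subgroup c])
  have ZA: "?Z \<subseteq> A" by (rule schreier_gens_subset[OF A_subgroup free_basisD(1)[OF X] schreierD(1)[OF c]])
  obtain w where w: "w \<in> words ?Z" "length w \<le> k" "g = word_value G w" using g by (auto simp: word_ball_def)
  have "word_value G w \<in> A \<and> \<bar>expo (word_value G w)\<bar> \<le> int (length w)" using w(1)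
  proof (induction w)
    case (Cons s w)
    then have s: "fst s \<in> ?Z" "word_value G w \<in> A" "\<bar>expo (word_value G w)\<bar> \<le> int (length w)" by auto
    have "fst s \<in> A" using s(1) ZA by blast
    then have "letter_value G s \<in> A" "\<bar>expo (letter_value G s)\<bar> = 1"
      using expo_basis[OF Z s(1)] expo_inv Ac by (auto simp: letter_value_def)
    then show ?case using s expo_mult Ac by simp
  qed (simp add: Ac expo_one)
  then show ?thesis using w(2) unfolding w(3) by linarith
qed

lemma twist_close:
  assumes X: "free_basis G X" "finite X" and m: "marking X c b" and m': "marking X' c' b'"
    and ball: "X' \<subseteq> word_ball G X k"
  shows "\<bar>expo b' - expo b\<bar> \<le> int (oscillation (card X) 1 k)"
proof -
  have c: "schreier G A X c" using m by (simp add: marking_def)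
  have "card Y = 1" using Y_eq by simp
  then have "b' \<otimes> inv b \<in> word_ball G (schreier_gens G X c) (oscillation (card X) 1 k)"
    using marking_close(1)[OF X m m' ball] by simp
  moreover have "expo (b' \<otimes> inv b) = expo b' - expo b"
    using expo_mult expo_inv marking_b[OF m] marking_b[OF m'] Ac by simp
  ultimately show ?thesis using expo_ball[OF X(1) c] by metis
qed

text \<open>The inverse of \<open>\<tau>\<close> fixes \<open>A\<close> and shifts the first ray by
  \<open>N\<close> steps, which keeps its limit. On the second ray it becomes right multiplication
  by \<open>a [^] N\<close>, so the limit is multiplied by this power.\<close>

lemma marking_twist:
  assumes m: "marking X0 c b" and \<tau>: "\<tau> \<in> auto G" and others: "\<And>x. x \<in> X0 - {t} \<Longrightarrow> \<tau> x = x"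
    and t: "\<tau> t = a [^] (N :: nat) \<otimes> t"
  shows "\<exists>c'. marking (\<tau> ` X0) c' (b \<otimes> a [^] N)"
proof -
  have c: "schreier G A X0 c" using m by (simp add: marking_def)
  have AG: "A \<subseteq> carrier G" using Ac by blast
  have id: "(\<lambda>x. x) \<in> hom G G" by (simp add: hom_def)
  have \<tau>A: "\<tau> x = x" if "x \<in> A" for x
    using hom_eqI[OF Yc that[unfolded A_def] auto_hom[OF \<tau>] id is_group] others YX tX by auto
  then have im: "\<tau> ` A = A" by auto
  obtain \<tau>' where \<tau>': "\<tau>' \<in> auto G" "\<And>x. x \<in> carrier G \<Longrightarrow> \<tau>' (\<tau> x) = x" "\<And>x. x \<in> carrier G \<Longrightarrow> \<tau> (\<tau>' x) = x"
    using auto_inverse[OF \<tau>] by metis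
  have \<tau>'c: "\<tau>' x \<in> carrier G \<and> \<tau> (\<tau>' x) = x \<and> \<tau>' (\<tau> x) = x" if "x \<in> carrier G" for x
    using auto_closed[OF \<tau>'(1) that] \<tau>'(2,3)[OF that] by simp
  note hm = auto_mult[OF \<tau>'(1)] and hi = auto_inv[OF \<tau>'(1)]
  have \<tau>'A: "\<tau>' x = x" if "x \<in> A" for x using \<tau>A[OF that] \<tau>'(2)[of x] that Ac by simp
  let ?p = "a [^] N"
  have p: "?p \<in> A" "?p \<in> carrier G" using aA Ac by auto
  have "\<tau>' (\<tau> t) = ?p \<otimes> \<tau>' t" unfolding t using hm[OF p(2) tc] \<tau>'A[OF p(1)] by simp
  then have \<tau>'t: "\<tau>' t = inv ?p \<otimes> t" using \<tau>'(2)[OF tc] p tc \<tau>'c[OF tc] by (metis inv_cancel(1))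
  define c' where "c' g = \<tau> (c (\<tau>' g))" for g
  have c': "schreier G A (\<tau> ` X0) c'"
    using schreier_transport(1)[OF X0c c AG \<tau> im \<tau>'c auto_hom[OF \<tau>'(1)]] unfolding c'_def by simp
  have cA: "c g \<in> A" if "g \<in> carrier G" for g using coset_retractionD(1)[OF schreierD(1)[OF c] that] .
  have c'_eq: "c' g = c (\<tau>' g)" if "g \<in> carrier G" for g
    using \<tau>A cA \<tau>'c[OF that] by (simp add: c'_def)
  have rT: "\<tau>' (ray True i) = ray True (i - N)" if "N \<le> i" for i
  proof -
    have "a [^] i = a [^] (i - N) \<otimes> ?p" using that ac by (simp add: nat_pow_mult)
    then have "\<tau>' (ray True i) = a [^] (i - N) \<otimes> ?p \<otimes> (inv ?p \<otimes> t)"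
      using hm aA(2)[of i] \<tau>'A[OF aA(2)[of i]] Ac tc \<tau>'t by (simp add: ray_def letter_value_def)
    then show ?thesis using p ac tc by (simp add: ray_def letter_value_def m_assoc inv_cancel)
  qed
  have rF: "\<tau>' (ray False i) = ray False i \<otimes> ?p" for i
    using hm hi aA(2)[of i] \<tau>'A[OF aA(2)[of i]] Ac tc \<tau>'t p
    by (simp add: ray_def letter_value_def inv_mult_group m_assoc)
  have "marking (\<tau> ` X0) c' (b \<otimes> ?p)"
    unfolding marking_def
  proof (intro conjI c')
    obtain M where M: "\<And>i. M \<le> i \<Longrightarrow> c (ray True i) = \<one>"
      using m by (auto simp: marking_def eventually_sequentially)
    show "\<forall>\<^sub>F i in sequentially. c' (ray True i) = \<one>"
    proof (rule eventually_sequentiallyI)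
      fix i assume "M + N \<le> i"
      then show "c' (ray True i) = \<one>" using c'_eq[OF ray_closed] rT[of i] M[of "i - N"] by simp
    qed
    have "\<forall>\<^sub>F i in sequentially. c (ray False i) = b" using m by (simp add: marking_def)
    then show "\<forall>\<^sub>F i in sequentially. c' (ray False i) = b \<otimes> ?p"
    proof eventually_elim
      case (elim i)
      then show ?case
        using c'_eq[OF ray_closed] rF[of i] coset_retractionD(2)[OF schreierD(1)[OF c] ray_closed p(1)] by simp
    qed
  qed
  then show ?thesis by blast
qed

end

section \<open>Distortion in corank at least two\<close>

lemma fib_exponential: "2 ^ m \<le> fib (Suc (2 * m))"
proof (induction m)
  case (Suc m)
  have "fib (Suc (2 * Suc m)) = fib (Suc (Suc (2 * m))) + fib (Suc (2 * m))" by simp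
  moreover have "fib (Suc (Suc (2 * m))) \<ge> fib (Suc (2 * m))" by simp
  ultimately show ?case using Suc by simp
qed simp

lemma exponential_exceeds_linear:
  fixes \<alpha> \<beta> :: real
  shows "\<exists>m. \<alpha> + \<beta> * real m < 2 ^ m"
proof -
  \<comment> \<open>The summand \<open>4\<close> makes \<open>m * m \<le> 2 ^ m\<close> available;
    the rest makes \<open>m * m\<close> exceed the linear term.\<close>
  obtain m :: nat where m: "\<bar>\<alpha>\<bar> + \<bar>\<beta>\<bar> + 4 < real m" using reals_Archimedean2 by blast
  have "m \<ge> 4 \<Longrightarrow> m * m \<le> 2 ^ m" for m :: nat
  proof (induction m rule: dec_induct)
    case (step n)
    have "Suc n * Suc n \<le> 2 * (n * n)"
    proof -
      have "4 * n \<le> n * n" using step(1) by (intro mult_right_mono) auto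
      moreover have "2 * n + 1 \<le> 4 * n" using step(1) by simp
      moreover have "Suc n * Suc n = n * n + (2 * n + 1)" by simp
      ultimately show ?thesis by linarith
    qed
    then show ?case using step by simp
  qed simp
  from this[of m] have "m * m \<le> 2 ^ m" using m by simp
  then have sq: "real m * real m \<le> 2 ^ m" by (metis of_nat_le_iff of_nat_mult of_nat_numeral of_nat_power)
  have m1: "1 \<le> real m" using m by simp
  have "\<alpha> + \<beta> * real m \<le> \<bar>\<alpha>\<bar> * real m + \<bar>\<beta>\<bar> * real m"
  proof (rule add_mono)
    have "\<bar>\<alpha>\<bar> * 1 \<le> \<bar>\<alpha>\<bar> * real m" using m1 by (intro mult_left_mono) auto
    then show "\<alpha> \<le> \<bar>\<alpha>\<bar> * real m" by simp
    show "\<beta> * real m \<le> \<bar>\<beta>\<bar> * real m" by (intro mult_right_mono) auto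
  qed
  also have "\<dots> = (\<bar>\<alpha>\<bar> + \<bar>\<beta>\<bar>) * real m" by (simp add: distrib_right)
  also have "\<dots> < real m * real m" using m m1 by (intro mult_strict_right_mono) auto
  finally show ?thesis using sq by (meson less_le_trans)
qed

locale corank_two = group F for F :: "('a, 'b) monoid_scheme" (structure) +
  fixes A B Y Z :: "'a set" and a z t :: 'a
  assumes prod: "internal_free_product F A B"
    and Yb: "free_basis (F\<lparr>carrier := A\<rparr>) Y" and finY: "finite Y"
    and Zb: "free_basis (F\<lparr>carrier := B\<rparr>) Z" and finZ: "finite Z"
    and aY: "a \<in> Y" and zZ: "z \<in> Z" and tZ: "t \<in> Z" and zt: "z \<noteq> t"
begin

lemma subA: "subgroup A F" and subB: "subgroup B F"
  using prod by (auto simp: internal_free_product_def)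

sublocale BG: group "F\<lparr>carrier := B\<rparr>"
  by (rule sub_group[OF subB])

sublocale C: cyclic_marking "F\<lparr>carrier := B\<rparr>" Z "{z}" t z
  by unfold_locales (use Zb finZ zZ tZ zt in auto)

abbreviation "X \<equiv> Y \<union> Z"

lemma X_basis: "free_basis F X" and YZ: "Y \<inter> Z = {}" and finX: "finite X"
  using free_product_basis[OF prod Yb Zb] finY finZ by auto

lemma Xc: "X \<subseteq> carrier F" by (rule free_basisD(1)[OF X_basis])

lemma YA: "Y \<subseteq> A" and ZB: "Z \<subseteq> B"
proof -
  interpret AG: group "F\<lparr>carrier := A\<rparr>" by (rule sub_group[OF subA])
  show "Y \<subseteq> A" using AG.free_basisD(1)[OF Yb] by simp
  show "Z \<subseteq> B" using BG.free_basisD(1)[OF Zb] by simp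
qed

lemma genA: "generate F Y = A" and genB: "generate F Z = B"
proof -
  interpret AG: group "F\<lparr>carrier := A\<rparr>" by (rule sub_group[OF subA])
  show "generate F Y = A"
    using AG.free_basis_generate[OF Yb] generate_consistent[OF YA subA] by simp
  show "generate F Z = B"
    using BG.free_basis_generate[OF Zb] generate_consistent[OF ZB subB] by simp
qed

lemma Bc: "x \<in> B \<Longrightarrow> x \<in> carrier F" and AF: "x \<in> A \<Longrightarrow> x \<in> carrier F"
  using subgroup.mem_carrier[OF subB] subgroup.mem_carrier[OF subA] by auto

text \<open>The quotient by the normal closure of \<open>A\<close>, realized as a retraction onto
  the complementary factor \<open>B\<close>.\<close>

definition proj :: "'a \<Rightarrow> 'a" where
  "proj = (SOME \<rho>. \<rho> \<in> hom F (F\<lparr>carrier := B\<rparr>) \<and> (\<forall>x\<in>X. \<rho> x = (if x \<in> Z then x else \<one>)))"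

lemma proj_hom: "proj \<in> hom F (F\<lparr>carrier := B\<rparr>)"
  and proj_basis: "x \<in> X \<Longrightarrow> proj x = (if x \<in> Z then x else \<one>)"
proof -
  have "(\<lambda>x. if x \<in> Z then x else \<one>) \<in> X \<rightarrow> carrier (F\<lparr>carrier := B\<rparr>)"
    using ZB subgroup.one_closed[OF subB] by auto
  then have "\<exists>\<rho>. \<rho> \<in> hom F (F\<lparr>carrier := B\<rparr>) \<and> (\<forall>x\<in>X. \<rho> x = (if x \<in> Z then x else \<one>))"
    using free_basis_extend[OF X_basis BG.is_group] by blast
  from someI_ex[OF this] show "proj \<in> hom F (F\<lparr>carrier := B\<rparr>)"
    "x \<in> X \<Longrightarrow> proj x = (if x \<in> Z then x else \<one>)"
    unfolding proj_def by blast+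
qed

lemma proj_closed: "x \<in> carrier F \<Longrightarrow> proj x \<in> B"
  using hom_in_carrier[OF proj_hom] by simp

lemma proj_mult: "x \<in> carrier F \<Longrightarrow> y \<in> carrier F \<Longrightarrow> proj (x \<otimes> y) = proj x \<otimes> proj y"
  using hom_mult[OF proj_hom] by simp

lemma proj_one: "proj \<one> = \<one>"
  using hom_one[OF proj_hom is_group BG.is_group] by simp

lemma proj_inv: "x \<in> carrier F \<Longrightarrow> proj (inv x) = inv (proj x)"
proof -
  assume x: "x \<in> carrier F"
  have "proj (inv x) \<otimes> proj x = \<one>" using proj_mult[of "inv x" x] x proj_one by simp
  then show ?thesis using proj_closed x Bc by (intro inv_equality[symmetric]) auto
qed

lemma proj_A: "x \<in> A \<Longrightarrow> proj x = \<one>"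
proof -
  assume "x \<in> A"
  then have x: "x \<in> generate F Y" by (simp add: genA)
  have one: "(\<lambda>_. \<one>) \<in> hom F (F\<lparr>carrier := B\<rparr>)"
    using subgroup.one_closed[OF subB] by (simp add: hom_def)
  have Yc: "Y \<subseteq> carrier F" using Xc by blast
  show ?thesis
  proof (rule hom_eqI[OF Yc x proj_hom one BG.is_group])
    show "proj y = \<one>" if "y \<in> Y" for y using proj_basis[of y] YZ that by auto
  qed
qed

lemma proj_B: "x \<in> B \<Longrightarrow> proj x = x"
proof -
  assume "x \<in> B"
  then have x: "x \<in> generate (F\<lparr>carrier := B\<rparr>) Z" using BG.free_basis_generate[OF Zb] by simp
  have id: "(\<lambda>x. x) \<in> hom (F\<lparr>carrier := B\<rparr>) (F\<lparr>carrier := B\<rparr>)" by (simp add: hom_def)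
  have p: "proj \<in> hom (F\<lparr>carrier := B\<rparr>) (F\<lparr>carrier := B\<rparr>)"
    using proj_mult proj_closed Bc by (auto simp: hom_def)
  have Zc: "Z \<subseteq> carrier (F\<lparr>carrier := B\<rparr>)" using ZB by simp
  show ?thesis
  proof (rule BG.hom_eqI[OF Zc x p id BG.is_group])
    show "proj y = y" if "y \<in> Z" for y using proj_basis[of y] that by auto
  qed
qed

definition bar :: "('a \<Rightarrow> 'a) \<Rightarrow> 'a \<Rightarrow> 'a" where
  "bar f = (\<lambda>b\<in>B. proj (f b))"

text \<open>As \<open>f\<close> maps \<open>A\<close> to itself, \<open>proj\<close> after
  \<open>f\<close> still kills \<open>A\<close> and factors through \<open>proj\<close>. This makes
  \<open>bar\<close> multiplicative on automorphisms that preserve \<open>A\<close>.\<close>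

lemma proj_auto:
  assumes f: "f \<in> auto F" "f ` A = A" and x: "x \<in> carrier F"
  shows "proj (f x) = bar f (proj x)"
proof -
  let ?B = "F\<lparr>carrier := B\<rparr>"
  have xg: "x \<in> generate F X" using x free_basis_generate[OF X_basis] by simp
  have fc: "f y \<in> carrier F" if "y \<in> carrier F" for y using auto_closed[OF f(1) that] .
  have h1: "(\<lambda>y. proj (f y)) \<in> hom F ?B"
    by (rule homI) (simp_all add: fc proj_closed auto_mult[OF f(1)] proj_mult)
  have h2: "(\<lambda>y. proj (f (proj y))) \<in> hom F ?B"
    by (rule homI) (simp_all add: fc proj_closed auto_mult[OF f(1)] proj_mult Bc)
  have "proj (f x) = proj (f (proj x))"
  proof (rule hom_eqI[OF Xc xg h1 h2 BG.is_group])
    fix y assume y: "y \<in> X"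
    show "proj (f y) = proj (f (proj y))"
    proof (cases "y \<in> Z")
      case True
      then show ?thesis using proj_basis[OF y] by simp
    next
      case False
      then have "y \<in> A" using y YA by auto
      then have "f y \<in> A" using f(2) by blast
      moreover have "f \<one> = \<one>" using hom_one[OF auto_hom[OF f(1)] is_group is_group] .
      ultimately show ?thesis using proj_basis[OF y] False proj_A proj_one by simp
    qed
  qed
  then show ?thesis using proj_closed[OF x] by (simp add: bar_def)
qed

lemma bar_compose:
  assumes f: "f \<in> auto F" "f ` A = A" and g: "g \<in> auto F"
  shows "b \<in> B \<Longrightarrow> bar (compose (carrier F) f g) b = bar f (bar g b)"
  using proj_auto[OF f, of "g b"] auto_closed[OF g] Bc by (simp add: bar_def compose_def)

lemma bar_closed: "f \<in> auto F \<Longrightarrow> b \<in> B \<Longrightarrow> bar f b \<in> B"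
  using auto_closed Bc proj_closed by (simp add: bar_def)

lemma A_sub: "A \<subseteq> carrier F"
  using AF by blast

lemma bar_auto:
  assumes f: "f \<in> auto F" "f ` A = A"
  shows "bar f \<in> auto (F\<lparr>carrier := B\<rparr>)"
proof -
  let ?B = "F\<lparr>carrier := B\<rparr>"
  obtain f' where f': "f' \<in> auto F" "\<And>x. x \<in> carrier F \<Longrightarrow> f' (f x) = x" "\<And>x. x \<in> carrier F \<Longrightarrow> f (f' x) = x"
    using auto_inverse[OF f(1)] by metis
  have f'A: "f' ` A = A" by (rule auto_inverse_image[OF f'(2) A_sub f(2)])
  have "bar f' (bar f b) = b" "bar f (bar f' b) = b" if "b \<in> B" for b
    using that Bc[OF that] proj_auto[OF f'(1) f'A, of "f b"] proj_auto[OF f, of "f' b"]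
      auto_closed[OF f(1), of b] auto_closed[OF f'(1), of b] f'(2)[of b] f'(3)[of b] proj_B
    by (simp_all add: bar_def)
  then have "bij_betw (bar f) B B"
    using bar_closed[OF f(1)] bar_closed[OF f'(1)] by (intro bij_betw_byWitness[where f' = "bar f'"]) auto
  moreover have "bar f \<in> hom ?B ?B"
  proof (rule homI)
    fix x y assume "x \<in> carrier ?B" "y \<in> carrier ?B"
    then have xy: "x \<in> B" "y \<in> B" by auto
    then show "bar f (x \<otimes>\<^bsub>?B\<^esub> y) = bar f x \<otimes>\<^bsub>?B\<^esub> bar f y"
      using subgroup.m_closed[OF subB xy] auto_mult[OF f(1)] auto_closed[OF f(1)] Bc proj_mult by (simp add: bar_def)
  qed (use bar_closed[OF f(1)] in auto)
  ultimately show ?thesis by (auto simp: auto_def Bij_def bar_def)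
qed

text \<open>Along a word in \<open>T\<close> the induced basis of \<open>B\<close> changes by words
  of bounded length at each letter, so the exponent recorded by a marking moves by at most
  \<open>R1\<close> per letter. For the twist that exponent has moved by \<open>N\<close>.\<close>

lemma twist_lower_bound:
  assumes T: "finite_generating_set ((Out F)\<lparr>carrier := Stab F A\<rparr>) T"
  obtains R :: nat where "\<And>\<tau> N. \<tau> \<in> auto F \<Longrightarrow> \<tau> ` A = A \<Longrightarrow> (\<And>x. x \<in> Z - {t} \<Longrightarrow> bar \<tau> x = x) \<Longrightarrow>
    bar \<tau> t = z [^]\<^bsub>F\<lparr>carrier := B\<rparr>\<^esub> (N :: nat) \<otimes> t \<Longrightarrow>
    N \<le> R * (word_length ((Out F)\<lparr>carrier := Stab F A\<rparr>) T (cls F \<tau>) + 1)"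
proof -
  let ?B = "F\<lparr>carrier := B\<rparr>" and ?H = "(Out F)\<lparr>carrier := Stab F A\<rparr>"
  interpret Out: group "Out F" by (rule group_Out)
  note H = Stab_subgroup[OF A_sub]
  interpret H: group ?H by (rule Out.sub_group[OF H])
  have Tc: "T \<subseteq> Stab F A" "finite T" "generate ?H T = Stab F A" using T by (auto simp: finite_generating_set_def)
  have Tc': "T \<subseteq> carrier ?H" using Tc by simp
  \<comment> \<open>Representatives are chosen to preserve \<open>A\<close> itself, not just its
    conjugacy class, so that \<open>bar\<close> applies to them.\<close>
  have "\<exists>f\<in>auto F. f ` A = A \<and> letter_value ?H s = cls F f" if "s \<in> T \<times> UNIV" for s
    using Stab_rep[OF A_sub, of "letter_value ?H s"] H.letter_closed[OF Tc', of s] that by (auto simp: mem_Times_iff)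
  then obtain r where r: "\<And>s. s \<in> T \<times> UNIV \<Longrightarrow> r s \<in> auto F \<and> r s ` A = A \<and> letter_value ?H s = cls F (r s)" by metis
  define D where "D = (\<lambda>(s, x). bar (r s) x) ` ((T \<times> UNIV) \<times> Z)"
  have "finite D" unfolding D_def using Tc(2) finZ by simp
  moreover have "D \<subseteq> carrier ?B" unfolding D_def using r ZB bar_closed by (auto simp: subset_iff)
  ultimately obtain k where k: "D \<subseteq> word_ball ?B Z k"
    using BG.common_ball[OF C.X0c BG.free_basis_generate[OF Zb]] by blast
  obtain c0 b0 where m0: "C.marking Z c0 b0" using C.marking_exists[OF Zb finZ] by blast
  define R1 where "R1 = oscillation (card Z) 1 k"
  \<comment> \<open>Two markings of the same basis need not agree; \<open>R2\<close> bounds their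
    difference, with \<open>k = 1\<close>.\<close>
  define R2 where "R2 = oscillation (card Z) 1 1"
  have chain: "\<exists>f\<in>auto F. f ` A = A \<and> cls F f = word_value ?H w \<and>
      (\<exists>c b. C.marking (bar f ` Z) c b \<and> \<bar>C.expo b - C.expo b0\<bar> \<le> int (R1 * length w))" if "w \<in> words T" for w
    using that
  proof (induction w rule: rev_induct)
    case Nil
    define i where "i = (\<lambda>x\<in>carrier F. x)"
    have "i ` A = (\<lambda>x. x) ` A" using AF by (intro image_cong) (auto simp: i_def)
    moreover have "bar i ` Z = (\<lambda>x. x) ` Z" using ZB Bc proj_B by (intro image_cong) (auto simp: bar_def i_def)
    moreover have "i \<in> auto F" "cls F i = \<one>\<^bsub>Out F\<^esub>" unfolding i_def by (rule id_auto, rule cls_one)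
    ultimately show ?case using m0 by (intro bexI[of _ i]) auto
  next
    case (snoc s w)
    then have s: "fst s \<in> T" "w \<in> words T" "[s] \<in> words T" "s \<in> T \<times> UNIV" by (auto simp: mem_Times_iff)
    obtain f c b where f: "f \<in> auto F" "f ` A = A" "cls F f = word_value ?H w"
      and m: "C.marking (bar f ` Z) c b" "\<bar>C.expo b - C.expo b0\<bar> \<le> int (R1 * length w)"
      using snoc.IH[OF s(2)] by blast
    have rs: "r s \<in> auto F" "r s ` A = A" "letter_value ?H s = cls F (r s)" using r[OF s(4)] by auto
    define g where "g = compose (carrier F) f (r s)"
    have g: "g \<in> auto F" unfolding g_def by (rule auto_compose[OF f(1) rs(1)])
    have "g ` A = f ` r s ` A" unfolding image_image g_def using AF by (intro image_cong) (auto simp: compose_def)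
    then have gA: "g ` A = A" using f rs by simp
    have val: "cls F g = word_value ?H (w @ [s])"
      using H.word_value_append[OF Tc' s(2,3)] H.letter_closed[OF Tc' s(1)] f(3) rs(3) cls_mult[OF f(1) rs(1)]
        cls_carrier[OF rs(1)]
      by (simp add: g_def)
    note bg = bar_auto[OF g gA] and bf = bar_auto[OF f(1,2)]
    have X': "free_basis ?B (bar g ` Z)" "finite (bar g ` Z)" and X: "free_basis ?B (bar f ` Z)" "finite (bar f ` Z)"
      using BG.free_basis_auto_image[OF Zb] bg bf finZ by auto
    obtain c' b' where m': "C.marking (bar g ` Z) c' b'" using C.marking_exists[OF X'] by blast
    have "bar g ` Z \<subseteq> word_ball ?B (bar f ` Z) k"
    proof (intro image_subsetI)
      fix x assume x: "x \<in> Z"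
      then have "bar (r s) x \<in> word_ball ?B Z k" using k s(4) by (auto simp: D_def)
      moreover have "bar g x = bar f (bar (r s) x)" unfolding g_def using x ZB by (intro bar_compose f rs) auto
      ultimately show "bar g x \<in> word_ball ?B (bar f ` Z) k"
        using BG.hom_word_ball[OF C.X0c BG.auto_hom[OF bf]] by simp
    qed
    then have "\<bar>C.expo b' - C.expo b\<bar> \<le> int (oscillation (card (bar f ` Z)) 1 k)"
      by (rule C.twist_close[OF X m(1) m'])
    then have "\<bar>C.expo b' - C.expo b\<bar> \<le> int R1"
      unfolding R1_def using BG.free_basis_card(2)[OF Zb finZ X(1)] by simp
    then have "\<bar>C.expo b' - C.expo b0\<bar> \<le> int (R1 * length (w @ [s]))" using m(2) by simp
    then show ?case using g gA val m' by blast
  qed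
  have "N \<le> (R1 + R2) * (word_length ?H T (cls F \<tau>) + 1)"
    if \<tau>: "\<tau> \<in> auto F" "\<tau> ` A = A" "\<And>x. x \<in> Z - {t} \<Longrightarrow> bar \<tau> x = x"
      and t: "bar \<tau> t = z [^]\<^bsub>?B\<^esub> (N :: nat) \<otimes> t" for \<tau> N
  proof -
    have "cls F \<tau> \<in> generate ?H T" using Stab_cls[OF A_sub \<tau>(1,2)] Tc by simp
    then obtain w where w: "w \<in> words T" "word_value ?H w = cls F \<tau>" "length w = word_length ?H T (cls F \<tau>)"
      by (rule H.word_length_word[OF Tc'])
    obtain f c b where f: "f \<in> auto F" "f ` A = A" "cls F f = cls F \<tau>"
      and m: "C.marking (bar f ` Z) c b" "\<bar>C.expo b - C.expo b0\<bar> \<le> int (R1 * length w)"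
      using chain[OF w(1)] w(2) by auto
    \<comment> \<open>The representative spelled by \<open>w\<close> agrees with the twist only up
      to conjugation, which in \<open>B\<close> becomes conjugation by \<open>proj v\<close> and
      does not affect the recorded element.\<close>
    obtain v where v: "v \<in> carrier F" "\<And>x. x \<in> carrier F \<Longrightarrow> f x = v \<otimes> \<tau> x \<otimes> inv v"
      using cls_eqD[OF f(1) \<tau>(1) f(3)] by blast
    note b\<tau> = bar_auto[OF \<tau>(1,2)] and bf = bar_auto[OF f(1,2)]
    have pv: "proj v \<in> B" using proj_closed[OF v(1)] .
    have "bar f x = proj v \<otimes> bar \<tau> x \<otimes> inv (proj v)" if "x \<in> B" for x
      using that v Bc[OF that] auto_closed[OF \<tau>(1), of x] proj_mult proj_inv by (simp add: bar_def)
    then have im: "bar f ` Z = (\<lambda>x. proj v \<otimes>\<^bsub>?B\<^esub> x \<otimes>\<^bsub>?B\<^esub> inv\<^bsub>?B\<^esub> (proj v)) ` (bar \<tau> ` Z)"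
      unfolding image_image using ZB pv subB by (intro image_cong) auto
    obtain c1 where "C.marking (bar \<tau> ` Z) c1 (b0 \<otimes>\<^bsub>?B\<^esub> z [^]\<^bsub>?B\<^esub> N)"
      using C.marking_twist[OF m0 b\<tau> \<tau>(3), of N] t by auto
    then have "C.marking (bar f ` Z) (\<lambda>g. c1 (inv\<^bsub>?B\<^esub> (proj v) \<otimes>\<^bsub>?B\<^esub> g)) (b0 \<otimes>\<^bsub>?B\<^esub> z [^]\<^bsub>?B\<^esub> N)"
      unfolding im using pv by (intro C.marking_conjugate BG.free_basis_auto_image[OF Zb b\<tau>]) auto
    then obtain c2 where m2: "C.marking (bar f ` Z) c2 (b0 \<otimes>\<^bsub>?B\<^esub> z [^]\<^bsub>?B\<^esub> N)" by blast
    have X: "free_basis ?B (bar f ` Z)" "finite (bar f ` Z)"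
      using BG.free_basis_auto_image[OF Zb bf] finZ by auto
    have "bar f ` Z \<subseteq> word_ball ?B (bar f ` Z) 1"
      using BG.word_ball_base[OF BG.free_basisD(1)[OF X(1)]] by blast
    then have "\<bar>C.expo (b0 \<otimes>\<^bsub>?B\<^esub> z [^]\<^bsub>?B\<^esub> N) - C.expo b\<bar> \<le> int (oscillation (card (bar f ` Z)) 1 1)"
      by (rule C.twist_close[OF X m(1) m2])
    moreover have "C.expo (b0 \<otimes>\<^bsub>?B\<^esub> z [^]\<^bsub>?B\<^esub> N) = C.expo b0 + int N"
      using C.expo_mult[OF C.marking_b[OF m0] C.aA(2)[of N]] C.expo_pow[of N] by simp
    ultimately have "int N \<le> int (R1 * length w) + int R2"
      using m(2) BG.free_basis_card(2)[OF Zb finZ X(1)] unfolding R2_def by simp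
    then have "N \<le> R1 * length w + R2" by linarith
    also have "\<dots> \<le> (R1 + R2) * (length w + 1)" by (simp add: algebra_simps)
    finally show ?thesis using w(3) by simp
  qed
  then show ?thesis by (rule that)
qed

text \<open>The elements below are the twists of \<open>t\<close> by \<open>u = \<psi>\<^sup>m z\<close>, where \<open>\<psi>\<close> mixes \<open>a\<close> and \<open>z\<close>.
  Outside the stabilizer of \<open>A\<close> they are conjugates of a single twist by \<open>\<psi>\<^sup>m\<close>, whereas after killing
  \<open>A\<close> they become twists by a Fibonacci power of \<open>z\<close>.\<close>

lemma fibonacci_twists:
  assumes S: "finite_generating_set (Out F) S"
  shows "\<exists>\<tau> p q. \<forall>m. \<tau> m \<in> auto F \<and> (\<forall>x\<in>X - {t}. \<tau> m x = x) \<and>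
    (\<exists>u\<in>carrier F. \<tau> m t = u \<otimes> t \<and> proj u = z [^] fib (Suc m)) \<and>
    word_length (Out F) S (cls F (\<tau> m)) \<le> p + q * m"
proof -
  interpret Out: group "Out F" by (rule group_Out)
  have Sc: "S \<subseteq> carrier (Out F)" "generate (Out F) S = carrier (Out F)" using S by (auto simp: finite_generating_set_def)
  have c: "a \<in> carrier F" "z \<in> carrier F" "t \<in> carrier F" using Xc aY zZ tZ by auto
  have ne: "a \<noteq> z" "a \<noteq> t" "z \<noteq> t" using YZ aY zZ tZ zt by auto
  have inX: "a \<in> X" "z \<in> X" "t \<in> X" using aY zZ tZ by auto
  have gen: "carrier F \<subseteq> generate F X" using free_basis_generate[OF X_basis] by simp
  have ext: "\<exists>\<phi>. \<phi> \<in> hom F F \<and> (\<forall>x\<in>X. \<phi> x = f x)" if "\<And>x. x \<in> X \<Longrightarrow> f x \<in> carrier F" for f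
  proof -
    have "f \<in> X \<rightarrow> carrier F" using that by blast
    from free_basis_extend[OF X_basis is_group this] show ?thesis by blast
  qed
  have Xm: "x \<in> carrier F" if "x \<in> X" for x using that Xc by blast
  have hm: "\<phi> (x \<otimes> y) = \<phi> x \<otimes> \<phi> y" if "\<phi> \<in> hom F F" "x \<in> carrier F" "y \<in> carrier F" for \<phi> x y
    using that by (rule hom_mult)
  have hi: "\<phi> (inv x) = inv (\<phi> x)" if "\<phi> \<in> hom F F" "x \<in> carrier F" for \<phi> x
  proof -
    interpret h: group_hom F F \<phi> using that is_group by (simp add: group_hom_def group_hom_axioms_def)
    show ?thesis using that by simp
  qed
  \<comment> \<open>The Fibonacci substitution, which replaces \<open>a\<close> by \<open>z\<close>
    and \<open>z\<close> by \<open>a \<otimes> z\<close>; \<open>p2\<close> will be its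
    inverse.\<close>
  have "(if x = a then z else if x = z then a \<otimes> z else x) \<in> carrier F" if "x \<in> X" for x using c Xm[OF that] by simp
  then obtain p1 where p1: "p1 \<in> hom F F" "\<forall>x\<in>X. p1 x = (if x = a then z else if x = z then a \<otimes> z else x)"
    using ext[of "\<lambda>x. if x = a then z else if x = z then a \<otimes> z else x"] by blast
  have "(if x = z then a else if x = a then z \<otimes> inv a else x) \<in> carrier F" if "x \<in> X" for x using c Xm[OF that] by simp
  then obtain p2 where p2: "p2 \<in> hom F F" "\<forall>x\<in>X. p2 x = (if x = z then a else if x = a then z \<otimes> inv a else x)"
    using ext[of "\<lambda>x. if x = z then a else if x = a then z \<otimes> inv a else x"] by blast
  have "(if x = t then z \<otimes> t else x) \<in> carrier F" if "x \<in> X" for x using c Xm[OF that] by simp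
  then obtain q1 where q1: "q1 \<in> hom F F" "\<forall>x\<in>X. q1 x = (if x = t then z \<otimes> t else x)"
    using ext[of "\<lambda>x. if x = t then z \<otimes> t else x"] by blast
  have "(if x = t then inv z \<otimes> t else x) \<in> carrier F" if "x \<in> X" for x using c Xm[OF that] by simp
  then obtain q2 where q2: "q2 \<in> hom F F" "\<forall>x\<in>X. q2 x = (if x = t then inv z \<otimes> t else x)"
    using ext[of "\<lambda>x. if x = t then inv z \<otimes> t else x"] by blast
  have p21: "p2 (p1 x) = x" and p12: "p1 (p2 x) = x" if "x \<in> X" for x
    using that p1(2) p2(2) inX ne c hm[OF p1(1)] hm[OF p2(1)] hi[OF p1(1)] hi[OF p2(1)]
    by (auto simp: m_assoc)
  have q21: "q2 (q1 x) = x" and q12: "q1 (q2 x) = x" if "x \<in> X" for x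
    using that q1(2) q2(2) inX ne c hm[OF q1(1)] hm[OF q2(1)] hi[OF q1(1)] hi[OF q2(1)]
    by (auto simp: inv_cancel)
  define \<psi> where "\<psi> = restrict p1 (carrier F)"
  define \<psi>' where "\<psi>' = restrict p2 (carrier F)"
  define \<tau>0 where "\<tau>0 = restrict q1 (carrier F)"
  have au: "\<psi> \<in> auto F" "\<psi>' \<in> auto F" "\<tau>0 \<in> auto F"
    unfolding \<psi>_def \<psi>'_def \<tau>0_def
    using auto_of_inverse_homs[OF Xc gen Xc gen p1(1) p2(1) p21 p12]
      auto_of_inverse_homs[OF Xc gen Xc gen p2(1) p1(1) p12 p21]
      auto_of_inverse_homs[OF Xc gen Xc gen q1(1) q2(1) q21 q12] by auto
  have \<psi>X: "\<psi> x = (if x = a then z else if x = z then a \<otimes> z else x)" if "x \<in> X" for x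
    using that Xc p1(2) by (auto simp: \<psi>_def)
  have \<psi>'X: "\<psi>' x = (if x = z then a else if x = a then z \<otimes> inv a else x)" if "x \<in> X" for x
    using that Xc p2(2) by (auto simp: \<psi>'_def)
  have \<tau>0X: "\<tau>0 x = (if x = t then z \<otimes> t else x)" if "x \<in> X" for x
    using that Xc q1(2) by (auto simp: \<tau>0_def)
  have \<psi>\<psi>': "\<psi> (\<psi>' x) = x" if "x \<in> X" for x
  proof -
    have "p2 x \<in> carrier F" "x \<in> carrier F" using hom_in_carrier[OF p2(1)] that Xc by auto
    then show ?thesis using p12[OF that] by (simp add: \<psi>_def \<psi>'_def)
  qed
  \<comment> \<open>Repeated conjugation of the twist by \<open>z\<close>. Each conjugation adds a
    constant to the length in \<open>Out F\<close>.\<close>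
  define \<tau> where "\<tau> m = ((\<lambda>g. compose (carrier F) \<psi> (compose (carrier F) g \<psi>')) ^^ m) \<tau>0" for m
  have \<tau>_Suc: "\<tau> (Suc m) = compose (carrier F) \<psi> (compose (carrier F) (\<tau> m) \<psi>')" for m
    by (simp add: \<tau>_def)
  have \<tau>au: "\<tau> m \<in> auto F" for m
    by (induction m) (use au in \<open>simp_all add: \<tau>_Suc auto_compose\<close>, simp add: \<tau>_def)
  have \<tau>app: "\<tau> (Suc m) x = \<psi> (\<tau> m (\<psi>' x))" if "x \<in> carrier F" for m x
    using that by (simp add: \<tau>_Suc compose_def)
  let ?Q = "generate F (X - {t})"
  have QX: "X - {t} \<subseteq> carrier F" using Xc by blast
  have Qc: "x \<in> carrier F" if "x \<in> ?Q" for x using generate_in_carrier[OF QX that] .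
  have id: "(\<lambda>x. x) \<in> hom F F" by (simp add: hom_def)
  have fix_Q: "g x = x" if g: "g \<in> auto F" "\<forall>x\<in>X - {t}. g x = x" and x: "x \<in> ?Q" for g x
    by (rule hom_eqI[OF QX x auto_hom[OF g(1)] id is_group]) (use g in auto)
  have \<psi>'Q: "\<psi>' x \<in> ?Q" if x: "x \<in> X - {t}" for x
  proof -
    have "a \<in> X - {t}" "z \<in> X - {t}" using inX ne by auto
    then have "a \<in> ?Q" "z \<otimes> inv a \<in> ?Q" "x \<in> ?Q" using x by (auto intro: generate.intros)
    then show ?thesis using \<psi>'X[of x] x by auto
  qed
  have fixed: "\<forall>x\<in>X - {t}. \<tau> m x = x" for m
  proof (induction m)
    case 0
    then show ?case using \<tau>0X by (auto simp: \<tau>_def)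
  next
    case (Suc m)
    show ?case
    proof
      fix x assume x: "x \<in> X - {t}"
      then show "\<tau> (Suc m) x = x"
        using \<tau>app[of x m] fix_Q[OF \<tau>au Suc \<psi>'Q[OF x]] \<psi>\<psi>'[of x] Xc by auto
    qed
  qed
  \<comment> \<open>The iterates of the substitution on \<open>z\<close> and on \<open>a\<close>.
    Their exponents after \<open>proj\<close> obey the Fibonacci recursion, starting from
    \<open>fib 0\<close> for \<open>a\<close>, which \<open>proj\<close> kills, and from
    \<open>fib 1\<close> for \<open>z\<close>.\<close>
  define u where "u m = (\<psi> ^^ m) z" for m
  define v where "v m = (\<psi> ^^ m) a" for m
  have pow_auto: "(\<psi> ^^ m) x \<in> carrier F" if "x \<in> carrier F" for m x
    by (induction m) (use that auto_closed[OF au(1)] in auto)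
  have pow_mult: "(\<psi> ^^ m) (x \<otimes> y) = (\<psi> ^^ m) x \<otimes> (\<psi> ^^ m) y" if "x \<in> carrier F" "y \<in> carrier F" for m x y
    by (induction m) (use that auto_mult[OF au(1)] pow_auto in auto)
  have uvc: "u m \<in> carrier F" "v m \<in> carrier F" for m using pow_auto c by (auto simp: u_def v_def)
  have v_Suc: "v (Suc m) = u m" for m
    using \<psi>X[OF inX(1)] by (simp add: u_def v_def funpow_swap1)
  have u_Suc: "u (Suc m) = v m \<otimes> u m" for m
    using \<psi>X[OF inX(2)] ne pow_mult[OF c(1,2)] by (simp add: u_def v_def funpow_swap1)
  have \<tau>t: "\<tau> m t = u m \<otimes> t" for m
  proof (induction m)
    case 0
    then show ?case using \<tau>0X[OF inX(3)] by (simp add: \<tau>_def u_def)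
  next
    case (Suc m)
    have "\<psi>' t = t" "\<psi> t = t" using \<psi>'X[OF inX(3)] \<psi>X[OF inX(3)] ne by auto
    then show ?case
      using \<tau>app[OF c(3), of m] Suc auto_mult[OF au(1) uvc(1)[of m] c(3)] by (simp add: u_def)
  qed
  have proj_uv: "proj (v m) = z [^] fib m \<and> proj (u m) = z [^] fib (Suc m)" for m
  proof (induction m)
    case 0
    have "proj a = \<one>" "proj z = z" using proj_A proj_B aY YA zZ ZB by auto
    then show ?case using c by (simp add: u_def v_def)
  next
    case (Suc m)
    then show ?case
      using proj_mult[OF uvc(2)[of m] uvc(1)[of m]] c
      by (simp add: v_Suc u_Suc nat_pow_mult add.commute)
  qed
  define q where "q = word_length (Out F) S (cls F \<psi>) + word_length (Out F) S (cls F \<psi>')"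
  have len: "word_length (Out F) S (cls F (\<tau> m)) \<le> word_length (Out F) S (cls F \<tau>0) + q * m" for m
  proof (induction m)
    case 0
    then show ?case by (simp add: \<tau>_def)
  next
    case (Suc m)
    have cc: "cls F \<psi> \<in> carrier (Out F)" "cls F \<psi>' \<in> carrier (Out F)" "cls F (\<tau> m) \<in> carrier (Out F)"
      using au \<tau>au cls_carrier by auto
    have "cls F (\<tau> (Suc m)) = cls F \<psi> \<otimes>\<^bsub>Out F\<^esub> (cls F (\<tau> m) \<otimes>\<^bsub>Out F\<^esub> cls F \<psi>')"
      using cls_mult[OF \<tau>au au(2)] cls_mult[OF au(1) auto_compose[OF \<tau>au au(2)]] by (simp add: \<tau>_Suc)
    then have "word_length (Out F) S (cls F (\<tau> (Suc m))) \<le>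
        word_length (Out F) S (cls F \<psi>) + (word_length (Out F) S (cls F (\<tau> m)) + word_length (Out F) S (cls F \<psi>'))"
      using Out.word_length_mult[OF Sc(1), of "cls F \<psi>" "cls F (\<tau> m) \<otimes>\<^bsub>Out F\<^esub> cls F \<psi>'"]
        Out.word_length_mult[OF Sc(1), of "cls F (\<tau> m)" "cls F \<psi>'"] Sc(2) cc by simp
    then show ?case using Suc by (simp add: q_def)
  qed
  have "\<exists>u'\<in>carrier F. \<tau> m t = u' \<otimes> t \<and> proj u' = z [^] fib (Suc m)" for m
    using \<tau>t proj_uv uvc by blast
  then show ?thesis using \<tau>au fixed len by blast
qed

theorem Stab_distorted:
  assumes S: "finite_generating_set (Out F) S" and T: "finite_generating_set ((Out F)\<lparr>carrier := Stab F A\<rparr>) T"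
  shows "distorted (Out F) S (Stab F A) T"
  unfolding distorted_def
proof
  let ?H = "(Out F)\<lparr>carrier := Stab F A\<rparr>"
  interpret Out: group "Out F" by (rule group_Out)
  note H = Stab_subgroup[OF A_sub]
  interpret H: group ?H by (rule Out.sub_group[OF H])
  assume "undistorted (Out F) S (Stab F A) T"
  then obtain K C where K: "K \<ge> 1" "C \<ge> 0" and qi: "\<And>x y. x \<in> Stab F A \<Longrightarrow> y \<in> Stab F A \<Longrightarrow>
      word_dist ?H T x y / K - C \<le> word_dist (Out F) S x y"
    unfolding undistorted_def quasi_isometric_embedding_def by blast
  obtain R where R: "\<And>\<tau> N. \<tau> \<in> auto F \<Longrightarrow> \<tau> ` A = A \<Longrightarrow> (\<And>x. x \<in> Z - {t} \<Longrightarrow> bar \<tau> x = x) \<Longrightarrow>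
    bar \<tau> t = z [^]\<^bsub>F\<lparr>carrier := B\<rparr>\<^esub> (N :: nat) \<otimes> t \<Longrightarrow> N \<le> R * (word_length ?H T (cls F \<tau>) + 1)"
    using twist_lower_bound[OF T] by blast
  obtain \<tau> p q where \<tau>: "\<And>m. \<tau> m \<in> auto F" "\<And>m x. x \<in> X - {t} \<Longrightarrow> \<tau> m x = x"
    and \<tau>t: "\<And>m. \<exists>u\<in>carrier F. \<tau> m t = u \<otimes> t \<and> proj u = z [^] fib (Suc m)"
    and len: "\<And>m. word_length (Out F) S (cls F (\<tau> m)) \<le> p + q * m"
    using fibonacci_twists[OF S] by blast
  \<comment> \<open>The lower inequality of the embedding, applied to \<open>\<one>\<close> and the
    twist, turns the linear bound in \<open>Out F\<close> into a linear bound in the stabilizer,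
    where \<open>R\<close> converts length into exponent.\<close>
  have bound: "real (fib (Suc m)) \<le> real R * (K * (real p + real q * real m + C) + 1)" for m
  proof -
    have id: "(\<lambda>x. x) \<in> hom F F" by (simp add: hom_def)
    have Yc: "Y \<subseteq> carrier F" using Xc by blast
    have "\<tau> m x = x" if "x \<in> A" for x
    proof (rule hom_eqI[OF Yc _ auto_hom[OF \<tau>(1)] id is_group])
      show "x \<in> generate F Y" using that by (simp add: genA)
      show "\<tau> m y = y" if "y \<in> Y" for y using that YZ tZ by (intro \<tau>(2)) auto
    qed
    then have im: "\<tau> m ` A = A" by auto
    obtain u where u: "u \<in> carrier F" "\<tau> m t = u \<otimes> t" "proj u = z [^] fib (Suc m)" using \<tau>t by blast
    have "bar (\<tau> m) x = x" if "x \<in> Z - {t}" for x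
      using that \<tau>(2)[of x m] ZB proj_B by (auto simp: bar_def)
    moreover have "bar (\<tau> m) t = z [^]\<^bsub>F\<lparr>carrier := B\<rparr>\<^esub> fib (Suc m) \<otimes> t"
      using tZ ZB u proj_mult[OF u(1) Bc] proj_B by (auto simp: bar_def nat_pow_consistent[symmetric])
    ultimately have "fib (Suc m) \<le> R * (word_length ?H T (cls F (\<tau> m)) + 1)"
      by (intro R \<tau>(1) im) auto
    then have "real (fib (Suc m)) \<le> real (R * (word_length ?H T (cls F (\<tau> m)) + 1))"
      by (simp only: of_nat_le_iff)
    then have 1: "real (fib (Suc m)) \<le> real R * (real (word_length ?H T (cls F (\<tau> m))) + 1)"
      by (simp only: of_nat_mult of_nat_add of_nat_1)
    have st: "cls F (\<tau> m) \<in> Stab F A" by (rule Stab_cls[OF A_sub \<tau>(1) im])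
    have one: "\<one>\<^bsub>Out F\<^esub> \<in> Stab F A" by (rule subgroup.one_closed[OF H])
    have cc: "cls F (\<tau> m) \<in> carrier (Out F)" by (rule cls_carrier[OF \<tau>(1)])
    have "inv\<^bsub>?H\<^esub> \<one>\<^bsub>Out F\<^esub> = \<one>\<^bsub>Out F\<^esub>" using H.inv_one by simp
    then have "real (word_length ?H T (cls F (\<tau> m))) / K - C \<le> real (word_length (Out F) S (cls F (\<tau> m)))"
      using qi[OF one st] cc by (simp add: word_dist_def)
    also have "\<dots> \<le> real (p + q * m)"
      using len[of m] by (simp only: of_nat_le_iff)
    also have "\<dots> = real p + real q * real m" by simp
    finally have 2: "real (word_length ?H T (cls F (\<tau> m))) \<le> K * (real p + real q * real m + C)"
      using K by (simp add: field_simps)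
    have "real R * (real (word_length ?H T (cls F (\<tau> m))) + 1) \<le> real R * (K * (real p + real q * real m + C) + 1)"
      using 2 by (intro mult_left_mono) auto
    with 1 show ?thesis by linarith
  qed
  define \<alpha> where "\<alpha> = real R * (K * (real p + C) + 1)"
  \<comment> \<open>The factor \<open>2\<close> is there because the bound is used at
    \<open>2 * m\<close>, where \<open>fib_exponential\<close> applies.\<close>
  define \<beta> where "\<beta> = real R * K * real q * 2"
  obtain m where m: "\<alpha> + \<beta> * real m < 2 ^ m" using exponential_exceeds_linear by blast
  have "(2::real) ^ m \<le> real (fib (Suc (2 * m)))"
  proof -
    have "real (2 ^ m) \<le> real (fib (Suc (2 * m)))" using fib_exponential[of m] by (simp only: of_nat_le_iff)
    then show ?thesis by simp
  qed
  also have "\<dots> \<le> \<alpha> + \<beta> * real m"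
    using bound[of "2 * m"] by (simp add: \<alpha>_def \<beta>_def algebra_simps)
  finally show False using m by simp
qed

end

theorem theorem1:
  fixes F :: "('a, 'b) monoid_scheme"
    and A :: "'a set"
    and n r :: nat
    and S T :: "('a \<Rightarrow> 'a) set set"
  assumes "free_group_of_rank F n"
    and "free_factor F A" and "A \<noteq> carrier F" and "A \<noteq> {\<one>\<^bsub>F\<^esub>}"
    and "free_group_of_rank (F\<lparr>carrier := A\<rparr>) r"
    and "finite_generating_set (Out F) S"
    and "finite_generating_set ((Out F)\<lparr>carrier := Stab F A\<rparr>) T"
  shows "(r + 1 = n \<longrightarrow> lipschitz_retract (Out F) S (Stab F A) T \<and>
                        undistorted (Out F) S (Stab F A) T) \<and>
         (r + 2 \<le> n \<longrightarrow> distorted (Out F) S (Stab F A) T)"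
proof -
  interpret F: group F using assms(1) by (simp add: free_group_of_rank_def)
  obtain X where X: "free_basis F X" "finite X" "card X = n" using assms(1) by (auto simp: free_group_of_rank_def)
  obtain B where prod: "internal_free_product F A B" using assms(2) by (auto simp: free_factor_def)
  then have sub: "subgroup A F" "subgroup B F" by (auto simp: internal_free_product_def)
  interpret AG: group "F\<lparr>carrier := A\<rparr>" by (rule F.sub_group[OF sub(1)])
  obtain Y where Y: "free_basis (F\<lparr>carrier := A\<rparr>) Y" "finite Y" "card Y = r"
    using assms(5) by (auto simp: free_group_of_rank_def)
  note Xc = F.free_basisD(1)[OF X(1)]
  \<comment> \<open>The complement \<open>B\<close> is given without a basis. Nielsen--Schreier
    provides one, and comparison with \<open>X\<close> shows that it has \<open>n - r\<close>
    elements.\<close>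
  obtain c where c: "schreier F B X c"
    using F.schreier_exists[OF sub(2) Xc X(2) F.free_basis_generate[OF X(1)]] by blast
  define Z where "Z = schreier_gens F X c"
  have Z: "free_basis (F\<lparr>carrier := B\<rparr>) Z" unfolding Z_def by (rule F.nielsen_schreier(1)[OF X(1) sub(2) c])
  note YZ = F.free_product_basis[OF prod Y(1) Z]
  have fin: "finite (Y \<union> Z)" "card (Y \<union> Z) = n" using F.free_basis_card[OF X(1,2) YZ(1)] X(3) by auto
  then have finZ: "finite Z" by simp
  have card: "n = r + card Z" using fin(2) card_Un_disjoint[OF Y(2) finZ YZ(2)] Y(3) by simp
  have genA: "generate F Y = A"
    using AG.free_basis_generate[OF Y(1)] AG.free_basisD(1)[OF Y(1)] F.generate_consistent[OF _ sub(1), of Y] by simp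
  \<comment> \<open>Nontriviality of \<open>A\<close> provides the direction \<open>a\<close> of the
    rays, and in higher corank the letter to be mixed with \<open>z\<close>.\<close>
  have "Y \<noteq> {}" using genA F.generate_empty assms(4) by auto
  then obtain a where a: "a \<in> Y" by blast
  have H: "subgroup (Stab F A) (Out F)" using F.Stab_subgroup[of A] subgroup.subset[OF sub(1)] by blast
  interpret Out: group "Out F" by (rule F.group_Out)
  show ?thesis
  proof (intro conjI impI)
    assume "r + 1 = n"
    then obtain t where t: "Z = {t}" using card card_1_singletonE by (metis add_left_cancel)
    interpret M: corank_one F "insert t Y" Y t a
      by unfold_locales (use YZ fin a t in auto)
    have "M.A = A" using genA by (simp add: M.A_def)
    then show r: "lipschitz_retract (Out F) S (Stab F A) T"
      using M.Stab_lipschitz_retract assms(6,7) by simp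
    show "undistorted (Out F) S (Stab F A) T"
      by (rule Out.retract_undistorted[OF H assms(6,7) r])
  next
    assume "r + 2 \<le> n"
    then have "2 \<le> card Z" using card by simp
    then obtain z t where zt: "z \<in> Z" "t \<in> Z" "z \<noteq> t"
      by (metis card_2_iff' card_le_Suc0_iff_eq finZ not_less_eq_eq numeral_2_eq_2)
    interpret M: corank_two F A B Y Z a z t
      by unfold_locales (use prod Y Z finZ a zt in auto)
    show "distorted (Out F) S (Stab F A) T" by (rule M.Stab_distorted[OF assms(6,7)])
  qed
qed

end
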